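(* Let $R$ be a commutative ring, fix two scalars $[2]_s,[2]_t\in R$, and let $n$ be a positive integer. The two-colored Jones--Wenzl projectors $\mathrm{JW}_R({}_s n)$ and $\mathrm{JW}_R({}_t n)$ exist and are rotatable if and only if $\genfrac{[}{]}{0pt}{}{n+1}{k}_s=\genfrac{[}{]}{0pt}{}{n+1}{k}_t=0$ in $R$ for all integers $1\le k\le n$.
   Context: Two-colored Temperley--Lieb algebra: $2\mathrm{TL}_R({}_s n)$ is the $R$-algebra with generators $e_1,\dots,e_{n-1}$ and relations $e_i^2=-[2]_s e_i$ for $i$ odd; $e_i^2=-[2]_t e_i$ for $i$ even; $e_ie_j=e_je_i$ for $|i-j|>1$; $e_ie_{i\pm1}e_i=e_i$. $2\mathrm{TL}_R({}_t n)$ is defined in the same way with the parities swapped in the two quadratic relations. Diagrammatically, $2\mathrm{TL}_R({}_s n)$ has $R$-basis the isotopy classes of Temperley--Lieb diagrams, i.e. crossingless matchings of $n$ bottom and $n$ top boundary points, whose regions are colored alternately $s$ and $t$ with leftmost region colored $s$ (these correspond to the reduced monomials in the $e_i$); multiplication is vertical stacking, a disk of color $t$ inside a region of color $s$ evaluates to $-[2]_s$, and a disk of color $s$ inside a region of color $t$ evaluates to $-[2]_t$. The generator $e_i$ is the diagram with a cup joining top points $i,i+1$, a cap joining bottom points $i,i+1$, and all other strands vertical. A two-colored Jones--Wenzl projector $\mathrm{JW}_R({}_s n)$ is a nonzero idempotent of $2\mathrm{TL}_R({}_s n)$ such that $e_i\,\mathrm{JW}_R({}_s n)=0$ for all $1\le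 i\le n-1$ and the coefficient of $1$ in it is $1$ (unique if it exists); similarly for $\mathrm{JW}_R({}_t n)$. Rotatability: suppose both $\mathrm{JW}_R({}_s n)$ and $\mathrm{JW}_R({}_t n)$ exist. The two rotations (clockwise and counterclockwise) by one strand are the $R$-linear maps $2\mathrm{TL}_R({}_s n)\to 2\mathrm{TL}_R({}_t n)$ which on a diagram (1) bend the strand at the top-left endpoint down to become the new leftmost bottom endpoint and the strand at the bottom-right endpoint up to become the new rightmost top endpoint; respectively (2) bend the bottom-left endpoint up to become the new leftmost top endpoint and the top-right endpoint down to become the new rightmost bottom endpoint. $\mathrm{JW}_R({}_s n)$ is rotatable if there is a scalar $\lambda\in R$ such that both rotations of $\mathrm{JW}_R({}_s n)$ equal $\lambda\,\mathrm{JW}_R({}_t n)$. Rotatability of $\mathrm{JW}_R({}_t n)$ is defined with the roles of $s$ and $t$ exchanged. Two-colored quantum numbers: in $A=\mathbb{Z}[x_s,x_t]$ put $[1]_s=[1]_t=1$, $[2]_s=x_s$, $[2]_t=x_t$ and, for $m>1$, $[m+1]_s=[2]_s[m]_t-[m-1]_s$, $[m+1]_t=[2]_t[m]_s-[m-1]_t$. For $0\le k\le m$ let $\genfrac{[}{]}{0pt}{}{m}{k}_s=\frac{[m]_s!}{[k]_s!\,[m-k]_s!}$, which lies in $A$, where $[m]_s!=[m]_s\cdots[1]_s$, and similarly with $t$. In $R$, these symbols denote images under the ring homomorphism $A\to R$ sending $x_s,x_t$ to the fixed scalars $[2]_s,[2]_t\in R$.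
   Formalization: Proved for n ≥ 2 and nonzero R: for n = 1 both projectors are the identity strand and always rotatable, though [2]_s and [2]_t need not vanish; in the zero ring all binomials vanish but no nonzero idempotent exists. *)

theory Defs
  imports
    "HOL-Library.Poly_Mapping"
    "HOL-Algebra.QuotRing"
    "HOL-Computational_Algebra.Polynomial"
begin

text \<open>
  The pair of scalars $[2]_s, [2]_t$ is a function \<open>q\<close> on colors. A color \<open>c\<close> used as an index of
  an algebra is the color of the leftmost region.
\<close>

datatype color = ColS | ColT

fun other :: "color \<Rightarrow> color" where
  "other ColS = ColT"
| "other ColT = ColS"


section \<open>Two-colored quantum numbers\<close>

text \<open>
  $\mathbb{Z}[x_s,x_t]$ is \<open>int poly poly\<close>, with $x_s$ the outer and $x_t$ the inner variable.
\<close>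

fun qvar :: "color \<Rightarrow> int poly poly" where
  "qvar ColS = [:0, 1:]"
| "qvar ColT = [:[:0, 1:]:]"

text \<open>Setting $[0] = 0$ makes the recursion also produce $[2]_s = x_s$ and $[2]_t = x_t$.\<close>

fun qnum :: "color \<Rightarrow> nat \<Rightarrow> int poly poly" where
  "qnum c 0 = 0"
| "qnum c (Suc 0) = 1"
| "qnum c (Suc (Suc m)) = qvar c * qnum (other c) (Suc m) - qnum c m"

definition qfact :: "color \<Rightarrow> nat \<Rightarrow> int poly poly" where
  "qfact c m = (\<Prod>j=1..m. qnum c j)"

text \<open>
  The division below takes place in the integral domain $\mathbb{Z}[x_s,x_t]$ and is exact.
  It has to be carried out before specializing to the coefficient ring.
\<close>

definition qbinom :: "color \<Rightarrow> nat \<Rightarrow> nat \<Rightarrow> int poly poly" where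
  "qbinom c m k = qfact c m div (qfact c k * qfact c (m - k))"

definition specialize :: "(color \<Rightarrow> 'a::comm_ring_1) \<Rightarrow> int poly poly \<Rightarrow> 'a" where
  "specialize q P = poly (map_poly (\<lambda>p. poly (map_poly of_int p) (q ColT)) P) (q ColS)"


section \<open>The two-colored Temperley--Lieb algebra\<close>

text \<open>
  Words in the generators form the free monoid (written additively, as \<open>Poly_Mapping\<close> requires), so
  that \<open>tl_word \<Rightarrow>\<^sub>0 'a\<close> with its convolution product is the free associative \<open>'a\<close>-algebra.
\<close>

datatype tl_word = Word (letters: "nat list")

instantiation tl_word :: monoid_add
begin

definition "0 = Word []"
definition "v + w = Word (letters v @ letters w)"

instance
  by standard (simp_all add: zero_tl_word_def plus_tl_word_def)

end

definition free_scalar :: "'a::comm_ring_1 \<Rightarrow> (tl_word \<Rightarrow>\<^sub>0 'a)" where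
  "free_scalar a = Poly_Mapping.single 0 a"

definition free_gen :: "nat \<Rightarrow> (tl_word \<Rightarrow>\<^sub>0 'a::comm_ring_1)" where
  "free_gen i = Poly_Mapping.single (Word [i]) 1"

definition free_alg :: "nat \<Rightarrow> (tl_word \<Rightarrow>\<^sub>0 'a::comm_ring_1) ring" where
  "free_alg n =
     \<lparr>carrier = {x. \<forall>w \<in> Poly_Mapping.keys x. set (letters w) \<subseteq> {1..<n}},
      monoid.mult = (*), one = 1, zero = 0, add = (+)\<rparr>"

definition two_at :: "(color \<Rightarrow> 'a) \<Rightarrow> color \<Rightarrow> nat \<Rightarrow> 'a" where
  "two_at q c i = (if odd i then q c else q (other c))"

definition tl_relators :: "(color \<Rightarrow> 'a::comm_ring_1) \<Rightarrow> color \<Rightarrow> nat \<Rightarrow> (tl_word \<Rightarrow>\<^sub>0 'a) set" where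
  "tl_relators q c n =
     {free_gen i * free_gen i + free_scalar (two_at q c i) * free_gen i | i. i \<in> {1..<n}} \<union>
     {free_gen i * free_gen j - free_gen j * free_gen i | i j.
        i \<in> {1..<n} \<and> j \<in> {1..<n} \<and> (i + 1 < j \<or> j + 1 < i)} \<union>
     {free_gen i * free_gen j * free_gen i - free_gen i | i j.
        i \<in> {1..<n} \<and> j \<in> {1..<n} \<and> (j = i + 1 \<or> i = j + 1)}"

definition tl_ideal :: "(color \<Rightarrow> 'a::comm_ring_1) \<Rightarrow> color \<Rightarrow> nat \<Rightarrow> (tl_word \<Rightarrow>\<^sub>0 'a) set" where
  "tl_ideal q c n = genideal (free_alg n) (tl_relators q c n)"

definition TL :: "(color \<Rightarrow> 'a::comm_ring_1) \<Rightarrow> color \<Rightarrow> nat \<Rightarrow> (tl_word \<Rightarrow>\<^sub>0 'a) set ring" where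
  "TL q c n = free_alg n Quot tl_ideal q c n"

definition tl_gen :: "(color \<Rightarrow> 'a::comm_ring_1) \<Rightarrow> color \<Rightarrow> nat \<Rightarrow> nat \<Rightarrow> (tl_word \<Rightarrow>\<^sub>0 'a) set" where
  "tl_gen q c n i = tl_ideal q c n +>\<^bsub>free_alg n\<^esub> free_gen i"


section \<open>Expansion in the diagram basis\<close>

text \<open>
  Boundary points are numbered from left to right, starting from 1. A diagram is the set of its
  strands, each strand being the set of its two endpoints. The coloring need not be recorded, because
  it is determined by the color of the leftmost region.
\<close>

datatype boundary_point = Bot nat | Top nat

type_synonym diagram = "boundary_point set set"

definition id_diagram :: "nat \<Rightarrow> diagram" where
  "id_diagram n = {{Bot i, Top i} | i. i \<in> {1..n}}"

text \<open>
  Stacking $e_i$ on top of a diagram in which \<open>Top i\<close> and \<open>Top (i + 1)\<close> are not joined to each other: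
  their two strands are merged into one, and the cup of $e_i$ is added.
\<close>

definition stack_gen :: "nat \<Rightarrow> diagram \<Rightarrow> diagram" where
  "stack_gen i d =
     {b \<in> d. b \<inter> {Top i, Top (i + 1)} = {}} \<union>
     {{Top i, Top (i + 1)},
      \<Union>{b \<in> d. b \<inter> {Top i, Top (i + 1)} \<noteq> {}} - {Top i, Top (i + 1)}}"

text \<open>
  The value of a monomial: a scalar times a diagram. The product $ab$ has $a$ stacked on top of $b$.
  If \<open>Top i\<close> and \<open>Top (i + 1)\<close> are joined, then stacking $e_i$ closes off a disk, which lies between
  the strand positions $i$ and $i + 1$, and otherwise leaves the diagram unchanged. As words range
  over $e_1, \dots, e_{n-1}$, the resulting diagrams are precisely the crossingless matchings.
\<close>

fun word_value ::
  "(color \<Rightarrow> 'a::comm_ring_1) \<Rightarrow> color \<Rightarrow> nat \<Rightarrow> nat list \<Rightarrow> 'a \<times> diagram" where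
  "word_value q c n [] = (1, id_diagram n)"
| "word_value q c n (i # w) =
     (let (a, d) = word_value q c n w in
      if {Top i, Top (i + 1)} \<in> d then (- two_at q c i * a, d) else (a, stack_gen i d))"

definition free_expansion ::
  "(color \<Rightarrow> 'a::comm_ring_1) \<Rightarrow> color \<Rightarrow> nat \<Rightarrow> (tl_word \<Rightarrow>\<^sub>0 'a) \<Rightarrow> (diagram \<Rightarrow>\<^sub>0 'a)" where
  "free_expansion q c n x =
     (\<Sum>w \<in> Poly_Mapping.keys x.
        let (a, d) = word_value q c n (letters w)
        in Poly_Mapping.single d (Poly_Mapping.lookup x w * a))"

text \<open>
  The coordinates of an element of the Temperley--Lieb algebra in the diagram basis. The elements are
  cosets, and the expansion takes the same value at all representatives, since the defining relations
  hold for stacking of diagrams.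
\<close>

definition expansion ::
  "(color \<Rightarrow> 'a::comm_ring_1) \<Rightarrow> color \<Rightarrow> nat \<Rightarrow> (tl_word \<Rightarrow>\<^sub>0 'a) set \<Rightarrow> (diagram \<Rightarrow>\<^sub>0 'a)" where
  "expansion q c n X = the_elem (free_expansion q c n ` X)"


section \<open>Jones--Wenzl projectors and rotatability\<close>

definition is_JW ::
  "(color \<Rightarrow> 'a::comm_ring_1) \<Rightarrow> color \<Rightarrow> nat \<Rightarrow> (tl_word \<Rightarrow>\<^sub>0 'a) set \<Rightarrow> bool" where
  "is_JW q c n J \<longleftrightarrow>
     J \<in> carrier (TL q c n) \<and>
     J \<noteq> \<zero>\<^bsub>TL q c n\<^esub> \<and>
     J \<otimes>\<^bsub>TL q c n\<^esub> J = J \<and>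
     (\<forall>i \<in> {1..<n}. tl_gen q c n i \<otimes>\<^bsub>TL q c n\<^esub> J = \<zero>\<^bsub>TL q c n\<^esub>) \<and>
     Poly_Mapping.lookup (expansion q c n J) (id_diagram n) = 1"

text \<open>The effect of the two rotations on boundary points; \<open>rot1\<close> bends the top left endpoint down.\<close>

fun rot1 :: "nat \<Rightarrow> boundary_point \<Rightarrow> boundary_point" where
  "rot1 n (Top i) = (if i = 1 then Bot 1 else Top (i - 1))"
| "rot1 n (Bot i) = (if i = n then Top n else Bot (i + 1))"

fun rot2 :: "nat \<Rightarrow> boundary_point \<Rightarrow> boundary_point" where
  "rot2 n (Bot i) = (if i = 1 then Top 1 else Bot (i - 1))"
| "rot2 n (Top i) = (if i = n then Bot n else Top (i + 1))"

text \<open>Linear extension of the relabelling of endpoints by \<open>r\<close>.\<close>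

definition rotate_diagrams ::
  "(boundary_point \<Rightarrow> boundary_point) \<Rightarrow> (diagram \<Rightarrow>\<^sub>0 'a::comm_ring_1) \<Rightarrow> (diagram \<Rightarrow>\<^sub>0 'a)" where
  "rotate_diagrams r v =
     (\<Sum>d \<in> Poly_Mapping.keys v. Poly_Mapping.single ((`) r ` d) (Poly_Mapping.lookup v d))"

text \<open>
  Here \<open>J\<close> and \<open>J'\<close> are the projectors with leftmost color \<open>c\<close> and \<open>other c\<close>. Both sides of the
  equations are elements of the algebra with leftmost color \<open>other c\<close>, in diagram coordinates.
\<close>

definition rotatable ::
  "(color \<Rightarrow> 'a::comm_ring_1) \<Rightarrow> color \<Rightarrow> nat \<Rightarrow>
   (tl_word \<Rightarrow>\<^sub>0 'a) set \<Rightarrow> (tl_word \<Rightarrow>\<^sub>0 'a) set \<Rightarrow> bool" where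
  "rotatable q c n J J' \<longleftrightarrow>
     (\<exists>a. rotate_diagrams (rot1 n) (expansion q c n J) =
            Poly_Mapping.map ((*) a) (expansion q (other c) n J') \<and>
          rotate_diagrams (rot2 n) (expansion q c n J) =
            Poly_Mapping.map ((*) a) (expansion q (other c) n J'))"

end

(*
  After bending the bottom edge, diagrams are noncrossing matchings of 2n points on a circle, and the
  two conditions on a projector say that its coefficient function is annihilated by capping off two
  neighbouring points, except at the two gaps between the edges. Rotatability is annihilation at
  these two gaps as well.

  Relative to a base point, a matching is a word of openers and closers. The relation for the cap at
  u expresses a matching with a valley at u by matchings with a smaller sum of openers. Putting the
  base point into the middle of k nested caps on the bottom edge, this expresses the coefficient of
  the identity by the coefficient of its k-th rotation D_k; the factor is the binomial [n choose k].
  With the base point between the edges, it expresses every coefficient by those of the D_k. To find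
  the factor, one uses the vector "jwnum", which is defined by a recursion without denominators, is
  annihilated by the caps, and has coefficients [k]![n-k]! at D_k and [n]! at the identity.

  If the projectors are rotatable, then the coefficients at the D_k are products of rotation factors,
  the cap at a gap between the edges yields [n+1] = 0, and Pascal's rule gives the vanishing of the
  binomials. Conversely, if the binomials of n+1 vanish, then those of n are units. A multiple of
  jwnum/[n]! is integral by the elimination above, hence can be specialized, and its partial trace
  vanishes because its coefficients are multiples of binomials of n+1.
*)
theory Submission
  imports Defs
begin

text \<open>The obstacle is that nothing can be cancelled in the coefficient ring, so a factor
  produced by elimination cannot be identified there. The elimination therefore yields polynomials P
  in Z[x_s,x_t] that serve every annihilated vector at once, both after specialization and over
  Z[x_s,x_t] itself. Testing P on \<open>jwnum\<close> in this integral domain determines it. This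
  also proves that the divisions in the binomials are exact. For the converse, the partial trace
  settles only the right gap between the edges. A half turn exchanges the edges, and since an
  annihilated vector is determined by its identity coefficient, this settles the left gap. Once all
  2n caps annihilate, rotating by one step preserves annihilation, and uniqueness makes the result a
  multiple of the other projector. The algebra is given by generators and relations, so vanishing in
  it means membership in an ideal, which is more than vanishing coordinates. Hence every matching
  gets a word, and stacking a generator on it is tracked modulo the relations.\<close>

section \<open>Noncrossing matchings\<close>

text \<open>
  A diagram on \<open>n\<close> strands corresponds to a matching of \<open>{..<2 * n}\<close>. The top points from left to right are
  \<open>0, \<dots>, n - 1\<close>, and the bottom points from right to left are \<open>n, \<dots>, 2 * n - 1\<close>. Matchings fix all
  other numbers, so that equality is extensional.
\<close>

definition nc_matching :: "nat \<Rightarrow> (nat \<Rightarrow> nat) \<Rightarrow> bool" where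
  "nc_matching N m \<longleftrightarrow> (\<forall>x<N. m x < N \<and> m x \<noteq> x) \<and> (\<forall>x. m (m x) = x) \<and> (\<forall>x\<ge>N. m x = x) \<and>
     (\<forall>x y. x < y \<and> y < m x \<longrightarrow> m y < m x)"

lemma nc_matchingD:
  assumes "nc_matching N m"
  shows "x < N \<Longrightarrow> m x < N" "x < N \<Longrightarrow> m x \<noteq> x" "m (m x) = x" "N \<le> x \<Longrightarrow> m x = x"
    "x < y \<Longrightarrow> y < m x \<Longrightarrow> m y < m x" "x < y \<Longrightarrow> y < m x \<Longrightarrow> x < m y" "m x = m y \<longleftrightarrow> x = y"
    "m x < N \<longleftrightarrow> x < N"
proof -
  have *: "\<forall>x<N. m x < N \<and> m x \<noteq> x" "\<forall>x. m (m x) = x" "\<forall>x\<ge>N. m x = x"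
     "\<forall>x y. x < y \<and> y < m x \<longrightarrow> m y < m x" using assms unfolding nc_matching_def by blast+
  show "x < N \<Longrightarrow> m x < N" "x < N \<Longrightarrow> m x \<noteq> x" "m (m x) = x" "N \<le> x \<Longrightarrow> m x = x"
    "x < y \<Longrightarrow> y < m x \<Longrightarrow> m y < m x" using * by blast+
  show "x < m y" if "x < y" "y < m x"
  proof (rule ccontr)
    assume "\<not> x < m y"
    moreover have "m y \<noteq> x" using * that by (metis less_irrefl)
    ultimately have "m y < x" by simp
    then show False using *(4)[rule_format, of "m y" x] *(2) that by simp
  qed
  show "m x = m y \<longleftrightarrow> x = y" using * by metis
  show "m x < N \<longleftrightarrow> x < N" using * by (metis not_less)
qed

lemma finite_nc_matching: "finite {m. nc_matching N m}"
proof -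
  let ?r = "\<lambda>m x. if x < N then m x else (0::nat)"
  have "?r ` {m. nc_matching N m} \<subseteq> {f. \<forall>x. (x \<in> {..<N} \<longrightarrow> f x \<in> {..<N}) \<and> (x \<notin> {..<N} \<longrightarrow> f x = 0)}"
    using nc_matchingD(1) by auto
  moreover have "finite {f. \<forall>x. (x \<in> {..<N} \<longrightarrow> f x \<in> {..<N}) \<and> (x \<notin> {..<N} \<longrightarrow> f x = (0::nat))}"
    by (rule finite_set_of_finite_funs) auto
  ultimately have "finite (?r ` {m. nc_matching N m})" by (rule finite_subset)
  moreover have "inj_on ?r {m. nc_matching N m}"
  proof (rule inj_onI, rule ext)
    fix m m' x assume a: "m \<in> {m. nc_matching N m}" "m' \<in> {m. nc_matching N m}" "?r m = ?r m'"
    show "m x = m' x"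
      using a fun_cong[OF a(3), of x] nc_matchingD(4)[of N m x] nc_matchingD(4)[of N m' x] by (cases "x < N") auto
  qed
  ultimately show ?thesis by (rule finite_imageD)
qed

text \<open>The effect of stacking a generator: \<open>u\<close> and \<open>v\<close> are joined,
  and so are their old partners. If \<open>u\<close> and \<open>v\<close> were partners already,
  nothing changes; the scalar of the closed disk is accounted for separately.\<close>

definition cap :: "nat \<Rightarrow> nat \<Rightarrow> (nat \<Rightarrow> nat) \<Rightarrow> nat \<Rightarrow> nat" where
  "cap u v m = (\<lambda>z. if z = u then v else if z = v then u else if z = m u then m v
                    else if z = m v then m u else m z)"

lemma cap_same: "nc_matching N m \<Longrightarrow> m u = v \<Longrightarrow> cap u v m = m"
  using nc_matchingD(3)[of N m u] by (auto simp: cap_def fun_eq_iff)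

text \<open>The partners of two neighbouring points lie both to the left, both to the right, or one
  on each side. In each case no other arc separates them, so they can be joined without a
  crossing.\<close>

lemma nc_matching_cap:
  assumes m: "nc_matching N m" and p: "Suc p < N"
  shows "nc_matching N (cap p (Suc p) m)"
proof (cases "m p = Suc p")
  case True
  then show ?thesis using cap_same[OF m True] m by simp
next
  case False
  define a b where "a = m p" and "b = m (Suc p)"
  note D = nc_matchingD[OF m]
  have pm: "m p = a" "m (Suc p) = b" by (simp_all add: a_def b_def)
  have iff: "m x = a \<longleftrightarrow> x = p" "m x = b \<longleftrightarrow> x = Suc p" "m x = p \<longleftrightarrow> x = a" "m x = Suc p \<longleftrightarrow> x = b" for x
    using D(3) pm by metis+
  have ab: "m a = p" "m b = Suc p" "a < N" "b < N" "a \<noteq> b" "a \<noteq> p" "b \<noteq> Suc p" "a \<noteq> Suc p" "b \<noteq> p"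
    using iff D(1)[of p] D(1)[of "Suc p"] D(2)[of p] D(2)[of "Suc p"] p False pm by force+
  have types: "(b < a \<and> a < p) \<or> (Suc p < b \<and> b < a) \<or> (a < p \<and> Suc p < b)"
  proof (cases "a < p")
    case True
    then show ?thesis using ab(5,7,9) D(5)[of b a] D(5)[of a b] ab(1,2) by linarith
  next
    case False
    then have "Suc p < a" using ab by linarith
    then show ?thesis using D(5)[of p "Suc p"] D(6)[of p "Suc p"] pm ab(5,7,9) by linarith
  qed
  have c: "cap p (Suc p) m z = (if z = p then Suc p else if z = Suc p then p else if z = a then b
                    else if z = b then a else m z)" for z by (simp add: cap_def a_def b_def)
  show ?thesis unfolding nc_matching_def
  proof (intro conjI allI impI)
    fix x
    show "x < N \<Longrightarrow> cap p (Suc p) m x < N" "x < N \<Longrightarrow> cap p (Suc p) m x \<noteq> x"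
      using D(1,2)[of x] ab p by (auto simp: c)
    show "cap p (Suc p) m (cap p (Suc p) m x) = x"
      using D(3) ab iff by (auto simp: c)
    show "N \<le> x \<Longrightarrow> cap p (Suc p) m x = x"
      using D(4)[of x] ab p by (auto simp: c)
  next
    fix x y assume xy: "x < y \<and> y < cap p (Suc p) m x"
    have ord: "s < t \<Longrightarrow> t < m s \<Longrightarrow> s < m t \<and> m t < m s" for s t using D(5,6) by blast
    have inv: "m (m y) = y" using D(3) .
    consider "x = a" | "x = b" | "x \<notin> {p, Suc p, a, b}" using xy c[of x] by force
    then show "cap p (Suc p) m y < cap p (Suc p) m x"
    proof cases
      case 1
      then have xy': "a < y" "y < b" using xy c[of a] ab by auto
      then have "a < p" "Suc p < b" using types by auto
      moreover have "m y < b" if "y \<noteq> p" "y \<noteq> Suc p"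
        using ord[of a y] ord[of "Suc p" y] that xy' \<open>a < p\<close> \<open>Suc p < b\<close> ab(1) pm(2) by linarith
      ultimately show ?thesis using xy' 1 c[of y] c[of a] ab by auto
    next
      case 2
      then have xy': "b < y" "y < a" using xy c[of b] ab by (auto split: if_splits)
      then have t: "a < p \<or> Suc p < b" "b < a" using types by auto
      have "m y < a" "y \<noteq> p" "y \<noteq> Suc p"
      proof -
        show "y \<noteq> p" "y \<noteq> Suc p" using t xy' by auto
        then have ne: "m y \<noteq> a" "m y \<noteq> p" using iff[of y] xy' by auto
        show "m y < a"
        proof (cases "a < p")
          case True
          then have "m y < Suc p" using ord[of b y] xy' ab(2) by linarith
          then show ?thesis using ord[of y a] ne inv xy' ab(1) by linarith
        next
          case False
          then show ?thesis using ord[of p y] xy' t pm by linarith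
        qed
      qed
      then show ?thesis using xy' 2 c[of y] c[of b] ab by auto
    next
      case 3
      then have x: "x < y" "y < m x" "cap p (Suc p) m x = m x" using xy c[of x] by auto
      then have ne: "m x \<notin> {p, Suc p, a, b}" using 3 iff[of x] by auto
      consider "y = p" | "y = Suc p" | "y = a" | "y = b" | "y \<notin> {p, Suc p, a, b}" by blast
      then show ?thesis
      proof cases
        case 3
        have "x < p" "p < m x" using ord[of x a] x 3 ab(1) by auto
        then show ?thesis using ord[of x "Suc p"] pm x 3 ne c[of a] ab by auto
      next
        case 4
        have "x < Suc p" "Suc p < m x" using ord[of x b] x 4 ab(2) by auto
        then show ?thesis using ord[of x p] pm x 4 ne c[of b] ab \<open>x \<notin> _\<close> by auto
      next
        case 1
        then have "Suc p < m x" using x ne by auto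
        then show ?thesis using 1 x(3) c[of p] by simp
      next
        case 2
        then have "p < m x" using x ne by auto
        then show ?thesis using 2 x(3) c[of "Suc p"] by simp
      next
        case 5
        then have "cap p (Suc p) m y = m y" using c[of y] by simp
        then show ?thesis using x ord[of x y] by simp
      qed
    qed
  qed
qed

text \<open>Stacking collects the coefficients of all matchings with the same closure
  \<open>d\<close>. The matching \<open>d\<close> itself is left out because there a disk is closed
  and its coefficient acquires a factor.\<close>

definition fiber :: "nat \<Rightarrow> nat \<Rightarrow> nat \<Rightarrow> (nat \<Rightarrow> nat) \<Rightarrow> (nat \<Rightarrow> nat) set" where
  "fiber N u v d = {D. nc_matching N D \<and> cap u v D = d \<and> D \<noteq> d}"

lemma finite_fiber: "finite (fiber N u v d)"
  by (rule finite_subset[OF _ finite_nc_matching[of N]]) (auto simp: fiber_def)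

section \<open>Inserting and deleting an arc between neighbouring points\<close>

definition skip2 :: "nat \<Rightarrow> nat \<Rightarrow> nat" where "skip2 p x = (if x < p then x else x + 2)"
definition drop2 :: "nat \<Rightarrow> nat \<Rightarrow> nat" where "drop2 p x = (if x < p then x else x - 2)"

text \<open>\<open>ins\<close> and \<open>rem\<close> identify the matchings with an arc at
  \<open>p\<close>, \<open>Suc p\<close> with the matchings on two points fewer. All inductions on
  the number of strands go through this identification.\<close>

definition ins :: "nat \<Rightarrow> (nat \<Rightarrow> nat) \<Rightarrow> nat \<Rightarrow> nat" where
  "ins p m = (\<lambda>x. if x = p then Suc p else if x = Suc p then p else skip2 p (m (drop2 p x)))"
definition rem :: "nat \<Rightarrow> (nat \<Rightarrow> nat) \<Rightarrow> nat \<Rightarrow> nat" where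
  "rem p m = (\<lambda>x. drop2 p (m (skip2 p x)))"

lemma drop2_skip2 [simp]: "drop2 p (skip2 p x) = x"
  by (auto simp: drop2_def skip2_def)

lemma skip2_drop2: "x \<noteq> p \<Longrightarrow> x \<noteq> Suc p \<Longrightarrow> skip2 p (drop2 p x) = x"
  by (auto simp: drop2_def skip2_def)

lemma skip2_neq [simp]: "skip2 p x \<noteq> p" "skip2 p x \<noteq> Suc p"
  by (auto simp: skip2_def)

lemma rem_ins [simp]: "rem p (ins p m) = m"
  by (auto simp: rem_def ins_def fun_eq_iff)

lemma ins_at [simp]: "ins p m p = Suc p" "ins p m (Suc p) = p"
  by (auto simp: ins_def)

lemma ins_inject [simp]: "ins p m = ins p m' \<longleftrightarrow> m = m'"
  by (metis rem_ins)

lemma ins_rem: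
  assumes "nc_matching N m" "m p = Suc p"
  shows "ins p (rem p m) = m"
proof
  fix x
  have "m (Suc p) = p" using assms nc_matchingD(3) by metis
  moreover have "m x \<noteq> p" "m x \<noteq> Suc p" if "x \<noteq> p" "x \<noteq> Suc p"
    using assms nc_matchingD(3) that by metis+
  ultimately show "ins p (rem p m) x = m x"
    using assms by (auto simp: ins_def rem_def skip2_drop2)
qed

lemma nc_matching_ins:
  assumes m: "nc_matching N m" and "p \<le> N"
  shows "nc_matching (N + 2) (ins p m)"
  unfolding nc_matching_def
proof (intro conjI allI impI)
  note D = nc_matchingD[OF m]
  have sk: "skip2 p x < N + 2 \<longleftrightarrow> x < N" for x using assms by (auto simp: skip2_def)
  have dl: "drop2 p x < N \<longleftrightarrow> x < N + 2" if "x \<noteq> p" "x \<noteq> Suc p" for x using assms that by (auto simp: drop2_def)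
  fix x y
  show "x < N + 2 \<Longrightarrow> ins p m x < N + 2" using assms dl[of x] D(1)[of "drop2 p x"] sk by (auto simp: ins_def)
  show "x < N + 2 \<Longrightarrow> ins p m x \<noteq> x" using assms dl[of x] D(2)[of "drop2 p x"] drop2_skip2[of p "m (drop2 p x)"]
    by (auto simp: ins_def simp del: drop2_skip2)
  show "ins p m (ins p m x) = x" using D(3) by (auto simp: ins_def skip2_drop2)
  show "N + 2 \<le> x \<Longrightarrow> ins p m x = x" using assms dl[of x] D(4)[of "drop2 p x"] by (auto simp: ins_def skip2_drop2)
  assume xy: "x < y \<and> y < ins p m x"
  then have x: "x \<noteq> p" "x \<noteq> Suc p" by (auto simp: ins_def)
  then have ix: "ins p m x = skip2 p (m (drop2 p x))" by (simp add: ins_def)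
  show "ins p m y < ins p m x"
  proof (cases "y = p \<or> y = Suc p")
    case True
    then show ?thesis using xy ix skip2_neq[of p "m (drop2 p x)"] by (auto simp del: skip2_neq)
  next
    case False
    then have iy: "ins p m y = skip2 p (m (drop2 p y))" by (simp add: ins_def)
    have "drop2 p x < drop2 p y" using xy x False by (auto simp: drop2_def)
    moreover have "drop2 p y < m (drop2 p x)" using xy ix x False by (auto simp: drop2_def skip2_def split: if_splits)
    ultimately have "m (drop2 p y) < m (drop2 p x)" by (rule D(5))
    then show ?thesis unfolding ix iy by (auto simp: skip2_def)
  qed
qed

lemma nc_matching_rem:
  assumes m: "nc_matching (N + 2) m" and p: "m p = Suc p"
  shows "nc_matching N (rem p m)"
  unfolding nc_matching_def
proof (intro conjI allI impI)
  note D = nc_matchingD[OF m]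
  have pN: "Suc p < N + 2" using D(1)[of p] D(4)[of p] p by (cases "p < N + 2") auto
  have sk: "skip2 p x < N + 2 \<longleftrightarrow> x < N" for x using pN by (auto simp: skip2_def)
  have ne: "m (skip2 p x) \<noteq> p" "m (skip2 p x) \<noteq> Suc p" for x
    using D(3) p skip2_neq by metis+
  fix x y
  show "x < N \<Longrightarrow> rem p m x < N" using D(1)[of "skip2 p x"] sk[of x] ne[of x] pN by (auto simp: rem_def drop2_def)
  show "x < N \<Longrightarrow> rem p m x \<noteq> x" using D(2)[of "skip2 p x"] sk[of x] ne[of x]
    by (metis rem_def skip2_drop2)
  show "rem p m (rem p m x) = x" using D(3) ne by (auto simp: rem_def skip2_drop2)
  show "N \<le> x \<Longrightarrow> rem p m x = x" using D(4)[of "skip2 p x"] sk[of x] by (simp add: rem_def)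
  assume xy: "x < y \<and> y < rem p m x"
  have "skip2 p x < skip2 p y" using xy by (auto simp: skip2_def)
  moreover have "skip2 p y < m (skip2 p x)" using xy ne[of x] by (auto simp: rem_def drop2_def skip2_def split: if_splits)
  ultimately have "m (skip2 p y) < m (skip2 p x)" by (rule D(5))
  then show "rem p m y < rem p m x" unfolding rem_def using ne[of x] ne[of y] unfolding drop2_def by auto
qed

lemma skip2_inject [simp]: "skip2 p x = skip2 p y \<longleftrightarrow> x = y"
  by (metis drop2_skip2)

lemma ins_skip2 [simp]: "ins p m (skip2 p x) = skip2 p (m x)"
  by (simp add: ins_def)

lemma skip2_ext:
  assumes "\<And>x. f (skip2 p x) = g (skip2 p x)" "f p = g p" "f (Suc p) = g (Suc p)"
  shows "f = g"
  using assms by (metis ext skip2_drop2)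

lemma skip2_simps: "x < p \<Longrightarrow> skip2 p x = x" "p \<le> x \<Longrightarrow> skip2 p x = x + 2"
  by (auto simp: skip2_def)

lemma ins_simps: "x < p \<Longrightarrow> ins p m x = skip2 p (m x)" "p \<le> x \<Longrightarrow> ins p m (Suc (Suc x)) = skip2 p (m x)"
  using ins_skip2[of p m x] by (auto simp: skip2_simps simp del: ins_skip2)

lemma skip2_skip2: "p \<le> l \<Longrightarrow> skip2 (l + 2) (skip2 p x) = skip2 p (skip2 l x)"
  by (simp add: skip2_def)

lemma ins_ins:
  assumes "p \<le> l"
  shows "ins p (ins l m) = ins (l + 2) (ins p m)"
proof (rule skip2_ext[where p = p])
  fix x
  show "ins p (ins l m) (skip2 p x) = ins (l + 2) (ins p m) (skip2 p x)"
  proof (cases "x = l \<or> x = Suc l")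
    case True
    then show ?thesis using assms by (auto simp: skip2_simps)
  next
    case False
    then obtain y where "x = skip2 l y" by (metis skip2_drop2)
    moreover have "ins p (ins l m) (skip2 p (skip2 l y)) = skip2 p (skip2 l (m y))"
      "ins (l + 2) (ins p m) (skip2 (l + 2) (skip2 p y)) = skip2 (l + 2) (skip2 p (m y))"
      by (simp_all only: ins_skip2)
    ultimately show ?thesis by (simp only: skip2_skip2[OF assms])
  qed
qed (use assms ins_simps(1)[of _ "l + 2" "ins p m"] in \<open>auto simp: skip2_simps\<close>)

lemma cap_ins_skip2: "cap (skip2 l u) (skip2 l v) (ins l m) = ins l (cap u v m)"
  using skip2_neq[of l, symmetric] by (intro skip2_ext[where p = l]) (auto simp: cap_def simp del: skip2_neq)

lemma cap_ins_far_right: "Suc p < l \<Longrightarrow> cap p (Suc p) (ins l m) = ins l (cap p (Suc p) m)"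
  using cap_ins_skip2[of l p "Suc p" m] by (simp add: skip2_simps)

lemma cap_ins_far_left: "Suc l < p \<Longrightarrow> cap p (Suc p) (ins l m) = ins l (cap (p - 2) (Suc (p - 2)) m)"
proof -
  assume "Suc l < p"
  then have "skip2 l (p - 2) = p" "skip2 l (Suc (p - 2)) = Suc p" by (auto simp: skip2_def)
  then show ?thesis using cap_ins_skip2[of l "p - 2" "Suc (p - 2)" m] by simp
qed

text \<open>Straightening of a zigzag: the strand at \<open>p\<close> runs through the cap and the
  arc at \<open>Suc p\<close> and now ends at \<open>p + 2\<close>. This is the source of the
  relation e_i e_{i+1} e_i = e_i; \<open>cap_Suc_ins\<close> is the mirror image.\<close>

lemma cap_ins_Suc:
  assumes m: "nc_matching N m" and p: "p < N"
  shows "cap p (Suc p) (ins (Suc p) m) = ins p m"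
proof (rule skip2_ext[where p = "Suc p"])
  define a where "a = m p"
  have a: "a \<noteq> p" "m a = p" "m x = p \<longleftrightarrow> x = a" "m x = a \<longleftrightarrow> x = p" for x
    using nc_matchingD[OF m] p unfolding a_def by metis+
  have at: "ins (Suc p) m p = skip2 (Suc p) a" using ins_simps(1)[of p "Suc p" m] by (simp add: a_def)
  have same: "skip2 (Suc p) y = skip2 p y" if "y \<noteq> p" for y using that by (auto simp: skip2_def)
  show "cap p (Suc p) (ins (Suc p) m) (Suc p) = ins p m (Suc p)" by (simp add: cap_def)
  show "cap p (Suc p) (ins (Suc p) m) (Suc (Suc p)) = ins p m (Suc (Suc p))"
    using a same[of a] skip2_neq[of "Suc p" a] by (auto simp: cap_def at ins_simps a_def[symmetric])
  fix x
  show "cap p (Suc p) (ins (Suc p) m) (skip2 (Suc p) x) = ins p m (skip2 (Suc p) x)"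
  proof (cases "x = p")
    case True then show ?thesis by (simp add: skip2_simps cap_def)
  next
    case False
    then have e: "skip2 (Suc p) x = skip2 p x" using same by simp
    show ?thesis
    proof (cases "x = a")
      case True
      then have "ins p m (skip2 (Suc p) x) = Suc (Suc p)" using e ins_skip2[of p m a] unfolding a(2) by (simp add: skip2_simps)
      then show ?thesis using True a e skip2_neq[of p a] by (simp add: cap_def at del: skip2_neq)
    next
      case ne: False
      then have "skip2 p (m x) = skip2 (Suc p) (m x)" using a same by simp
      moreover have "skip2 (Suc p) x \<noteq> p" using False skip2_inject[of "Suc p" x p] by (simp add: skip2_simps)
      moreover have "ins (Suc p) m (skip2 (Suc p) x) = skip2 (Suc p) (m x)" "skip2 (Suc p) x \<noteq> skip2 (Suc p) a" using ne by simp_all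
      moreover have "ins p m (skip2 (Suc p) x) = skip2 p (m x)" unfolding e by simp
      ultimately show ?thesis using skip2_neq(1)[of "Suc p" x] by (simp add: cap_def at)
    qed
  qed
qed

lemma cap_Suc_ins:
  assumes m: "nc_matching N m" and p: "p < N"
  shows "cap (Suc p) (Suc (Suc p)) (ins p m) = ins (Suc p) m"
proof (rule skip2_ext[where p = p])
  define a where "a = m p"
  have a: "a \<noteq> p" "m a = p" "m x = p \<longleftrightarrow> x = a" "m x = a \<longleftrightarrow> x = p" for x
    using nc_matchingD[OF m] p unfolding a_def by metis+
  have at: "ins p m (Suc (Suc p)) = skip2 p a" using ins_simps(2)[of p p m] by (simp add: a_def)
  have same: "skip2 (Suc p) y = skip2 p y" if "y \<noteq> p" for y using that by (auto simp: skip2_def)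
  show "cap (Suc p) (Suc (Suc p)) (ins p m) p = ins (Suc p) m p"
    using a same[of a] skip2_neq[of p a] by (auto simp: cap_def at ins_simps a_def[symmetric])
  show "cap (Suc p) (Suc (Suc p)) (ins p m) (Suc p) = ins (Suc p) m (Suc p)"  by (simp add: cap_def)
  fix x
  show "cap (Suc p) (Suc (Suc p)) (ins p m) (skip2 p x) = ins (Suc p) m (skip2 p x)"
  proof (cases "x = p")
    case True then show ?thesis by (simp add: skip2_simps cap_def)
  next
    case False
    then have e: "skip2 p x = skip2 (Suc p) x" using same by simp
    show ?thesis
    proof (cases "x = a")
      case True
      then have "ins (Suc p) m (skip2 p x) = p" using e ins_skip2[of "Suc p" m a] unfolding a(2) by (simp add: skip2_simps)
      then show ?thesis using True a skip2_inject[of p a p] by (simp add: cap_def at skip2_simps del: skip2_inject)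
    next
      case ne: False
      then have "skip2 p (m x) = skip2 (Suc p) (m x)" using a same by simp
      moreover have "skip2 p x \<noteq> Suc (Suc p)" using False skip2_inject[of p x p] by (simp add: skip2_simps)
      moreover have "ins p m (skip2 p x) = skip2 p (m x)" "skip2 p x \<noteq> skip2 p a" using ne by simp_all
      moreover have "ins (Suc p) m (skip2 p x) = skip2 (Suc p) (m x)" unfolding e by simp
      ultimately show ?thesis using skip2_neq(2)[of p x] by (simp add: cap_def at)
    qed
  qed
qed


section \<open>Words of openers and closers\<close>

definition openers :: "(nat \<Rightarrow> nat) \<Rightarrow> nat set" where
  "openers m = {x. x < m x}"

lemma openers_subset: "nc_matching N m \<Longrightarrow> openers m \<subseteq> {..<N}"
  using nc_matchingD(4)[of N m] by (force simp: openers_def not_less[symmetric])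

lemma not_opener_iff: "nc_matching N m \<Longrightarrow> x < N \<Longrightarrow> x \<notin> openers m \<longleftrightarrow> m x < x"
  using nc_matchingD(2)[of N m x] by (auto simp: openers_def)

text \<open>At the first closer x where two matchings differ, say with f x < g x < x, the opener g x
  is enclosed by the arc of f from f x to x. So f closes it before x, at a point where both
  matchings agree, whereas g closes it at x.\<close>

lemma nc_matching_eqI:
  assumes m: "nc_matching N m" and m': "nc_matching N m'" and op: "openers m = openers m'"
  shows "m = m'"
proof (rule ccontr)
  assume "m \<noteq> m'"
  note D = nc_matchingD[OF m] nc_matchingD[OF m']
  have open_iff: "x < m x \<longleftrightarrow> x < m' x" for x using op by (auto simp: openers_def)
  have "\<exists>x. m x \<noteq> m' x \<and> m x < x"
  proof -
    obtain x where x: "m x \<noteq> m' x" using \<open>m \<noteq> m'\<close> by blast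
    then have "x < N" using D(4,12) by (metis not_less)
    show ?thesis
    proof (cases "m x < x")
      case False
      then have "x < m x" using D(2)[of x] \<open>x < N\<close> by auto
      moreover have "m' (m x) \<noteq> x" using x D(11) by metis
      ultimately show ?thesis using D(3) by (intro exI[of _ "m x"]) auto
    qed (use x in auto)
  qed
  then obtain x where x: "m x \<noteq> m' x" "m x < x" and min: "\<And>y. y < x \<Longrightarrow> m y < y \<Longrightarrow> m y = m' y"
    using exists_least_iff[of "\<lambda>x. m x \<noteq> m' x \<and> m x < x"] by blast
  have "x < N" using x D(4) by (metis less_irrefl not_less)
  then have "m' x < x" using x open_iff[of x] D(10)[of x] by auto
  have *: False if n: "nc_matching N f" "nc_matching N g" "f x < g x" "g x < x"
    and eq: "\<And>y. y < x \<Longrightarrow> f y < y \<Longrightarrow> f y = g y" and "g x < f (g x)" for f g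
  proof -
    have "f (g x) < x" using nc_matchingD(5)[OF n(1), of "f x" "g x"] nc_matchingD(3)[OF n(1)] n by auto
    then have "f (f (g x)) = g (f (g x))" using eq[of "f (g x)"] nc_matchingD(3)[OF n(1)] that(6) by auto
    then show False using nc_matchingD(3)[OF n(1), of "g x"] nc_matchingD(3,7)[OF n(2)]
      \<open>f (g x) < x\<close> by (metis less_irrefl)
  qed
  have 1: "m' x < m (m' x)" using open_iff[of "m' x"] D(11)[of x] \<open>m' x < x\<close> by auto
  have 2: "m x < m' (m x)" using open_iff[of "m x"] D(3)[of x] x(2) by auto
  have min': "m' y = m y" if "y < x" "m' y < y" for y
  proof -
    have "y < N" using that \<open>x < N\<close> by simp
    then have "m y < y" using that open_iff[of y] D(2)[of y] by auto
    then show ?thesis using min that by simp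
  qed
  show False
  proof (cases "m x < m' x")
    case True
    show ?thesis by (rule *[OF m m' True \<open>m' x < x\<close> min 1])
  next
    case False
    then have "m' x < m x" using x(1) by simp
    show ?thesis by (rule *[OF m' m \<open>m' x < m x\<close> x(2) min' 2])
  qed
qed

lemma two_card_openers:
  assumes m: "nc_matching N m"
  shows "2 * card (openers m) = N"
proof -
  have "bij_betw m (openers m) ({..<N} - openers m)"
    unfolding bij_betw_def
  proof
    show "inj_on m (openers m)" using nc_matchingD(7)[OF m] by (auto intro: inj_onI)
    show "m ` openers m = {..<N} - openers m"
    proof (intro equalityI subsetI)
      fix y assume "y \<in> m ` openers m"
      then obtain x where "x < m x" "y = m x" by (auto simp: openers_def)
      then show "y \<in> {..<N} - openers m"
        using nc_matchingD(3)[OF m, of x] nc_matchingD(1)[OF m, of x] nc_matchingD(4)[OF m, of x]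
        by (cases "x < N") (auto simp: openers_def)
    next
      fix y assume "y \<in> {..<N} - openers m"
      then have "m y < y" using not_opener_iff[OF m] by auto
      then show "y \<in> m ` openers m" using nc_matchingD(3)[OF m, of y]
        by (intro image_eqI[of _ _ "m y"]) (auto simp: openers_def)
    qed
  qed
  then have "card (openers m) = card ({..<N} - openers m)" by (rule bij_betw_same_card)
  then show ?thesis using card_Diff_subset[of "openers m" "{..<N}"] openers_subset[OF m]
      card_mono[of "{..<N}" "openers m"] finite_subset[OF openers_subset[OF m]] by auto
qed

text \<open>Since the bottom is numbered from right to left, this joins every top point to the
  bottom point below it: the identity diagram.\<close>

definition rainbow :: "nat \<Rightarrow> nat \<Rightarrow> nat" where
  "rainbow n x = (if x < 2 * n then 2 * n - 1 - x else x)"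

lemma nc_matching_rainbow: "nc_matching (2 * n) (rainbow n)"
  unfolding nc_matching_def rainbow_def by auto presburger

lemma openers_rainbow: "openers (rainbow n) = {..<n}"
  by (auto simp: openers_def rainbow_def split: if_splits)

lemma eq_rainbow:
  assumes m: "nc_matching (2 * n) m" and op: "openers m = {..<t}"
  shows "m = rainbow n"
proof -
  have "t = n" using two_card_openers[OF m] op by simp
  then show ?thesis using nc_matching_eqI[OF m nc_matching_rainbow] op openers_rainbow by simp
qed

section \<open>Valleys and the fibers of a cap\<close>

definition valley :: "nat \<Rightarrow> (nat \<Rightarrow> nat) \<Rightarrow> bool" where
  "valley u D \<longleftrightarrow> D u < u \<and> Suc u < D (Suc u)"

lemma fiberD:
  assumes D: "D \<in> fiber N u v d" and uv: "u < N" "v < N" "u \<noteq> v"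
  shows "nc_matching N D" "D u \<noteq> v" "d (D u) = D v" "d (D v) = D u" "d u = v" "d v = u"
    "z \<notin> {u, v, D u, D v} \<Longrightarrow> d z = D z"
    "D = (\<lambda>z. if z = u then D u else if z = D u then u else if z = v then d (D u)
              else if z = d (D u) then v else d z)"
proof -
  show nc: "nc_matching N D" using D by (simp add: fiber_def)
  note n = nc_matchingD[OF nc]
  have d: "d = cap u v D" and ne: "D \<noteq> d" using D by (auto simp: fiber_def)
  show Du: "D u \<noteq> v" using ne cap_same[OF nc, of u v] unfolding d by auto
  have Dv: "D v \<noteq> u" using Du n(3) by metis
  have self: "D u \<noteq> u" "D v \<noteq> v" "D u \<noteq> D v" using n(2,7) uv by auto
  show d1: "d (D u) = D v" "d (D v) = D u" "d u = v" "d v = u"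
    using Du Dv self uv unfolding d cap_def by auto
  show d2: "z \<notin> {u, v, D u, D v} \<Longrightarrow> d z = D z" for z unfolding d cap_def by auto
  show "D = (\<lambda>z. if z = u then D u else if z = D u then u else if z = v then d (D u)
              else if z = d (D u) then v else d z)"
  proof
    fix z show "D z = (if z = u then D u else if z = D u then u else if z = v then d (D u)
              else if z = d (D u) then v else d z)"
      using d1 d2[of z] n(3)[of u] n(3)[of v] by auto
  qed
qed

text \<open>The cases are the positions of the partners of \<open>u\<close> and
  \<open>Suc u\<close>: both left, both right, or on either side. Compared with the word of
  \<open>d\<close>, a single opener moves: from \<open>u\<close> left to \<open>a\<close>, from
  \<open>b\<close> left to \<open>Suc u\<close>, or from \<open>u\<close> right to
  \<open>Suc u\<close>. Only the last move increases the sum of openers.\<close>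

lemma fiber_cases:
  assumes D: "D \<in> fiber N u (Suc u) d" and u: "Suc u < N"
  obtains (left) a where "a < u" "D u = a" "D (Suc u) < a" "openers D = insert a (openers d - {u})" "u \<in> openers d" "a \<notin> openers d"
  | (right) b where "Suc u < b" "openers D = insert (Suc u) (openers d - {b})" "b \<in> openers d" "Suc u \<notin> openers d"
  | (enc) "valley u D" "openers D = insert (Suc u) (openers d - {u})" "u \<in> openers d" "Suc u \<notin> openers d"
proof -
  have uv: "u < N" "Suc u < N" "u \<noteq> Suc u" using u by auto
  note F = fiberD[OF D uv]
  note n = nc_matchingD[OF F(1)]
  define a b where "a = D u" and "b = D (Suc u)"
  have ne: "a \<noteq> Suc u" "b \<noteq> u" "a \<noteq> u" "b \<noteq> Suc u" "a \<noteq> b" and ab: "D a = u" "D b = Suc u"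
    using F(2) n(2)[of u] n(2)[of "Suc u"] n(3)[of u] n(3)[of "Suc u"] n(7)[of u "Suc u"] uv unfolding a_def b_def
    by (simp_all, metis)
  have Dab: "D u = a" "D (Suc u) = b" by (simp_all add: a_def b_def)
  have d: "d a = b" "d b = a" "d u = Suc u" "d (Suc u) = u" using F a_def b_def by auto
  have gen: "z \<in> openers d \<longleftrightarrow> z \<in> openers D" if "z \<notin> {u, Suc u, a, b}" for z
    using F(7)[of z] that by (auto simp: openers_def a_def b_def)
  have od: "u \<in> openers d" "Suc u \<notin> openers d" "a \<in> openers d \<longleftrightarrow> a < b" "b \<in> openers d \<longleftrightarrow> b < a"
    using d by (auto simp: openers_def)
  have oD: "u \<in> openers D \<longleftrightarrow> u < a" "Suc u \<in> openers D \<longleftrightarrow> Suc u < b" "a \<in> openers D \<longleftrightarrow> a < u" "b \<in> openers D \<longleftrightarrow> b < Suc u"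
    by (simp_all add: openers_def ab Dab)
  have seteq: "openers D = S" if "\<And>z. z \<notin> {u, Suc u, a, b} \<Longrightarrow> z \<in> S \<longleftrightarrow> z \<in> openers d"
     "u \<in> S \<longleftrightarrow> u < a" "Suc u \<in> S \<longleftrightarrow> Suc u < b" "a \<in> S \<longleftrightarrow> a < u" "b \<in> S \<longleftrightarrow> b < Suc u" for S
  proof (rule Set.set_eqI)
    fix z show "z \<in> openers D \<longleftrightarrow> z \<in> S"
      using that oD gen[of z] by (metis empty_iff insert_iff)
  qed
  consider "b < a" "a < u" | "Suc u < b" "b < a" | "a < u" "Suc u < b"
  proof (cases "a < u")
    case True
    have "\<not> (a < b \<and> b < u)" using n(5)[of a b] ab by auto
    then show ?thesis using that True ne(2,4,5) by linarith
  next
    case False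
    then have "Suc u < a" using ne(1,3) by linarith
    then show ?thesis using that n(5)[of u "Suc u"] n(6)[of u "Suc u"] Dab ne(4) by linarith
  qed
  then show thesis
  proof cases
    case 1
    have "openers D = insert a (openers d - {u})"
      by (rule seteq) (use 1 od in auto)
    then show ?thesis by (intro left[of a]) (use 1 od(1,3) Dab in simp_all)
  next
    case 2
    have "openers D = insert (Suc u) (openers d - {b})"
      by (rule seteq) (use 2 od in auto)
    then show ?thesis by (intro right[of b]) (use 2 od(2,4) in simp_all)
  next
    case 3
    have "openers D = insert (Suc u) (openers d - {u})"
      by (rule seteq) (use 3 od in auto)
    then show ?thesis by (intro enc) (use 3 od(1,2) Dab in \<open>simp_all add: valley_def\<close>)
  qed
qed

text \<open>If two valleys over \<open>d\<close> had D u < D' u, then the arc of \<open>D\<close>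
  from D u to u would enclose D' u and keep its partner left of u. But D' u is joined in
  \<open>d\<close>, hence in \<open>D\<close>, to a point beyond u + 1.\<close>

lemma valley_unique:
  assumes D: "D \<in> fiber N u (Suc u) d" and D': "D' \<in> fiber N u (Suc u) d" and u: "Suc u < N"
    and v: "valley u D" "valley u D'"
  shows "D = D'"
proof -
  have uv: "u < N" "Suc u < N" "u \<noteq> Suc u" using u by auto
  have le: "\<not> D u < D' u" if D: "D \<in> fiber N u (Suc u) d" and D': "D' \<in> fiber N u (Suc u) d"
    and v: "valley u D" "valley u D'" for D D'
  proof
    note F = fiberD[OF D uv] and F' = fiberD[OF D' uv]
    assume "D u < D' u"
    moreover have "D' u < u" "Suc u < D (Suc u)" "Suc u < D' (Suc u)" using v by (auto simp: valley_def)
    ultimately have "d (D' u) = D (D' u)" by (intro F(7)) auto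
    then have "D (D' u) = D' (Suc u)" using F'(3) by simp
    moreover have "D (D' u) < u"
      using nc_matchingD(5)[OF F(1), of "D u" "D' u"] nc_matchingD(3)[OF F(1)] \<open>D u < D' u\<close> \<open>D' u < u\<close> by auto
    ultimately show False using \<open>Suc u < D' (Suc u)\<close> by simp
  qed
  have "D u = D' u" using le[OF D D' v] le[OF D' D v(2) v(1)] by simp
  then show ?thesis using fiberD(8)[OF D uv] fiberD(8)[OF D' uv] by metis
qed

lemma cap_in_fiber:
  assumes "nc_matching N D" "Suc u < N" "D u \<noteq> Suc u"
  shows "nc_matching N (cap u (Suc u) D)" "D \<in> fiber N u (Suc u) (cap u (Suc u) D)" "cap u (Suc u) D u = Suc u"
proof -
  show "nc_matching N (cap u (Suc u) D)" by (rule nc_matching_cap[OF assms(1,2)])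
  show c: "cap u (Suc u) D u = Suc u" by (simp add: cap_def)
  then show "D \<in> fiber N u (Suc u) (cap u (Suc u) D)" using assms by (auto simp: fiber_def)
qed

lemma finite_openers: "nc_matching N m \<Longrightarrow> finite (openers m)"
  using finite_subset[OF openers_subset] by blast

text \<open>
  Among all matchings with the same closure at \<open>u\<close>, the one with a valley at \<open>u\<close> has the largest sum
  of openers. So linear relations between these matchings allow valleys to be eliminated.
\<close>

lemma valley_induct [consumes 1, case_names gaps step]:
  assumes "nc_matching N D" and V: "\<And>u. u \<in> V \<Longrightarrow> Suc u < N"
    and step: "\<And>D. nc_matching N D \<Longrightarrow>
      (\<And>u. u \<in> V \<Longrightarrow> valley u D \<Longrightarrow> P (cap u (Suc u) D)) \<Longrightarrow>
      (\<And>u D'. u \<in> V \<Longrightarrow> valley u D \<Longrightarrow> D' \<in> fiber N u (Suc u) (cap u (Suc u) D) \<Longrightarrow> D' \<noteq> D \<Longrightarrow> P D') \<Longrightarrow> P D"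
  shows "P D"
  using assms(1)
proof (induction "\<Sum>(openers D)" arbitrary: D rule: less_induct)
  case less
  show ?case
  proof (rule step[OF less.prems])
    fix u assume u: "u \<in> V" "valley u D"
    have ne: "D u \<noteq> Suc u" using u(2) by (auto simp: valley_def)
    define d where "d = cap u (Suc u) D"
    note cf = cap_in_fiber[OF less.prems V[OF u(1)] ne, folded d_def]
    have fin: "finite (openers d)" using cf(1) finite_openers by blast
    have sum_ins: "\<Sum>(insert y (openers d - {x})) + x = \<Sum>(openers d) + y" if "x \<in> openers d" "y \<notin> openers d" for x y
      using that fin sum.remove[OF fin that(1), of "\<lambda>x. x"] by (simp add: sum.insert_if)
    have D: "\<Sum>(openers D) = Suc (\<Sum>(openers d))"
      using cf(2) V[OF u(1)]
    proof (cases rule: fiber_cases)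
      case (left a)
      then show ?thesis using u(2) by (auto simp: valley_def)
    next
      case (right b)
      have "u \<in> openers d" "u \<notin> openers D" using cf(3) u(2) by (auto simp: openers_def valley_def)
      then show ?thesis using right by auto
    next
      case enc
      then show ?thesis using sum_ins[of u "Suc u"] by simp
    qed
    show "P (cap u (Suc u) D)" using less.hyps[of d] D cf(1) unfolding d_def by simp
    fix D' assume D': "D' \<in> fiber N u (Suc u) (cap u (Suc u) D)" "D' \<noteq> D"
    then have D'f: "D' \<in> fiber N u (Suc u) d" by (simp add: d_def)
    have "\<not> valley u D'" using valley_unique[OF cf(2) D'f V[OF u(1)] u(2)] D'(2) by blast
    with D'f V[OF u(1)] have "\<Sum>(openers D') < \<Sum>(openers d)"
    proof (cases rule: fiber_cases)
      case (left a)
      then show ?thesis using sum_ins[of u a] by simp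
    next
      case (right b)
      then show ?thesis using sum_ins[of b "Suc u"] by simp
    qed blast
    then show "P D'" using less.hyps[of D'] D D'f by (simp add: fiber_def)
  qed
qed

text \<open>Without a valley, an opener of the interval is never preceded there by a closer, so the
  openers form an initial segment.\<close>

lemma valley_free_openers:
  assumes m: "nc_matching N m" and "l \<le> r" "r \<le> N"
    and vf: "\<And>u. l \<le> u \<Longrightarrow> Suc u < r \<Longrightarrow> \<not> valley u m"
  obtains t where "l \<le> t" "t \<le> r" "openers m \<inter> {l..<r} = {l..<t}"
proof -
  have st: "u \<in> openers m" if "l \<le> u" "Suc u < r" "Suc u \<in> openers m" for u
    using vf[OF that(1,2)] that assms not_opener_iff[OF m, of u] by (auto simp: valley_def openers_def)
  have "\<exists>t. l \<le> t \<and> t \<le> k \<and> openers m \<inter> {l..<k} = {l..<t}" if "l \<le> k" "k \<le> r" for k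
    using that
  proof (induction k rule: dec_induct)
    case base then show ?case by auto
  next
    case (step k)
    from step.IH step.prems obtain t where t: "l \<le> t" "t \<le> k" "openers m \<inter> {l..<k} = {l..<t}" by auto
    have e: "{l..<Suc k} = insert k {l..<k}" using step.hyps(1) by (simp add: atLeastLessThanSuc)
    show ?case
    proof (cases "k \<in> openers m")
      case False
      then have "openers m \<inter> {l..<Suc k} = {l..<t}" unfolding e using t(3) by blast
      then show ?thesis using t(1,2) by (intro exI[of _ t]) simp
    next
      case True
      have "t = k"
      proof (cases "k = l")
        case False
        then have "k - 1 \<in> openers m" using st[of "k - 1"] step.hyps step.prems True by auto
        moreover have "k - 1 \<in> {l..<k}" using False step.hyps by simp
        ultimately have "k - 1 \<in> {l..<t}" using t(3) by blast
        then show ?thesis using t by auto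
      qed (use t(1,2) in simp)
      then have "openers m \<inter> {l..<Suc k} = {l..<Suc k}" unfolding e using t(3) True by blast
      then show ?thesis using t(1,2) by (intro exI[of _ "Suc k"]) simp
    qed
  qed
  then show thesis using that assms by blast
qed


section \<open>An integral multiple of the projector\<close>

text \<open>Odd quantum numbers do not depend on the color; even ones are the variable of the color
  times a factor that does not. The second statement is cross-multiplied to avoid division.\<close>

lemma qnum_other:
  "(odd m \<longrightarrow> qnum (other c) m = qnum c m) \<and> (even m \<longrightarrow> qvar c * qnum (other c) m = qvar (other c) * qnum c m)"
proof (induction c m rule: qnum.induct)
  case (3 c m)
  have "other (other c) = c" by (cases c) auto
  with 3 show ?case by (auto simp: algebra_simps)
qed auto

text \<open>The recursion in a single color. Its factor alternates in the same way as the color of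
  the disks along an edge, so it can be compared with disks closed at neighbouring gaps.\<close>

lemma qnum_Suc:
  "1 \<le> j \<Longrightarrow> qnum c (Suc j) = two_at qvar c j * qnum c j - qnum c (j - 1)"
  using qnum_other[of j c] by (cases j) (auto simp: two_at_def)

text \<open>
  The vector \<open>f\<close> is annihilated by capping off \<open>u\<close> and \<open>v\<close> iff its defects vanish at all matchings \<open>d\<close>
  that join \<open>u\<close> and \<open>v\<close>; a closed disk has the value \<open>- x\<close>.
\<close>

definition defect :: "nat \<Rightarrow> 'a::comm_ring_1 \<Rightarrow> nat \<Rightarrow> nat \<Rightarrow> ((nat \<Rightarrow> nat) \<Rightarrow> 'a) \<Rightarrow> (nat \<Rightarrow> nat) \<Rightarrow> 'a" where
  "defect N x u v f d = (\<Sum>D\<in>fiber N u v d. f D) - x * f d"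

lemma nc_matching_gap_less:
  assumes "nc_matching N m" "m p = Suc p" shows "Suc p < N"
  using nc_matchingD(1,4)[OF assms(1), of p] assms(2) by (cases "p < N") auto

lemma rem_rem:
  assumes m: "nc_matching (N + 4) m" and p: "m p = Suc p" and l: "m (l + 2) = Suc (l + 2)" and "p \<le> l"
  shows "rem l (rem p m) = rem p (rem (l + 2) m)"
proof -
  have at: "rem p m l = Suc l" using l \<open>p \<le> l\<close> by (simp add: rem_def skip2_simps drop2_def)
  have nc: "nc_matching (N + 2) (rem p m)" using nc_matching_rem[of "N + 2" m p] m p by (simp add: eval_nat_numeral)
  define m2 where "m2 = rem l (rem p m)"
  have "m = ins p (ins l m2)" using ins_rem[OF m p] ins_rem[OF nc at] by (simp add: m2_def)
  also have "\<dots> = ins (l + 2) (ins p m2)" by (rule ins_ins[OF \<open>p \<le> l\<close>])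
  finally have "rem (l + 2) m = ins p m2" by (metis rem_ins)
  then show ?thesis by (simp add: m2_def[symmetric])
qed

lemma fiber_same: "{D \<in> fiber N p (Suc p) d. D p = Suc p} = {}"
  by (auto simp: fiber_def cap_same)

text \<open>Straightening the zigzag leaves no freedom: for such a \<open>D\<close>, the matching
  \<open>rem (Suc p) D\<close> must be \<open>rem p d\<close>.\<close>

lemma fiber_Suc:
  assumes d: "nc_matching (N + 2) d" "d p = Suc p" and p: "Suc (Suc p) < N + 2"
  shows "{D \<in> fiber (N + 2) p (Suc p) d. D (Suc p) = Suc (Suc p)} = {ins (Suc p) (rem p d)}"
proof -
  have r: "nc_matching N (rem p d)" using nc_matching_rem d by blast
  have c: "cap p (Suc p) (ins (Suc p) (rem p d)) = d" using cap_ins_Suc[OF r] p ins_rem[OF d] by simp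
  have ne: "ins (Suc p) (rem p d) \<noteq> d" using nc_matchingD(3)[OF d(1), of p] d(2) by (metis ins_at(1) less_irrefl lessI Suc_lessD)
  have uniq: "D = ins (Suc p) (rem p d)" if D: "D \<in> fiber (N + 2) p (Suc p) d" "D (Suc p) = Suc (Suc p)" for D
  proof -
    have nD: "nc_matching (N + 2) D" "cap p (Suc p) D = d" using D by (auto simp: fiber_def)
    have "d = ins p (rem (Suc p) D)"
      using cap_ins_Suc[OF nc_matching_rem[OF nD(1) D(2)], of p] p nD(2) ins_rem[OF nD(1) D(2)] by simp
    then show ?thesis using ins_rem[OF nD(1) D(2)] by simp
  qed
  have mem: "ins (Suc p) (rem p d) \<in> fiber (N + 2) p (Suc p) d"
    unfolding fiber_def using c ne nc_matching_ins[OF r, of "Suc p"] p by simp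
  show ?thesis
  proof (rule Set.set_eqI)
    fix D show "D \<in> {D \<in> fiber (N + 2) p (Suc p) d. D (Suc p) = Suc (Suc p)} \<longleftrightarrow> D \<in> {ins (Suc p) (rem p d)}"
      using uniq[of D] mem ins_at(1) unfolding mem_Collect_eq singleton_iff by metis
  qed
qed

lemma fiber_pred:
  assumes d: "nc_matching (N + 2) d" "d (Suc l) = Suc (Suc l)"
  shows "{D \<in> fiber (N + 2) (Suc l) (Suc (Suc l)) d. D l = Suc l} = {ins l (rem (Suc l) d)}"
proof -
  have l: "l < N" using nc_matching_gap_less[OF d] by simp
  have r: "nc_matching N (rem (Suc l) d)" using nc_matching_rem d by blast
  have c: "cap (Suc l) (Suc (Suc l)) (ins l (rem (Suc l) d)) = d" using cap_Suc_ins[OF r l] ins_rem[OF d] by simp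
  have ne: "ins l (rem (Suc l) d) \<noteq> d" using nc_matchingD(3)[OF d(1), of "Suc l"] d(2) by (metis ins_at less_irrefl lessI Suc_lessD)
  have uniq: "D = ins l (rem (Suc l) d)" if D: "D \<in> fiber (N + 2) (Suc l) (Suc (Suc l)) d" "D l = Suc l" for D
  proof -
    have nD: "nc_matching (N + 2) D" "cap (Suc l) (Suc (Suc l)) D = d" using D by (auto simp: fiber_def)
    have "d = ins (Suc l) (rem l D)"
      using cap_Suc_ins[OF nc_matching_rem[OF nD(1) D(2)] l] nD(2) ins_rem[OF nD(1) D(2)] by simp
    then show ?thesis using ins_rem[OF nD(1) D(2)] by simp
  qed
  have mem: "ins l (rem (Suc l) d) \<in> fiber (N + 2) (Suc l) (Suc (Suc l)) d"
    unfolding fiber_def using c ne nc_matching_ins[OF r, of l] l by simp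
  show ?thesis
  proof (rule Set.set_eqI)
    fix D show "D \<in> {D \<in> fiber (N + 2) (Suc l) (Suc (Suc l)) d. D l = Suc l} \<longleftrightarrow> D \<in> {ins l (rem (Suc l) d)}"
      using uniq[of D] mem ins_at(1) unfolding mem_Collect_eq singleton_iff by metis
  qed
qed

lemma fiber_far:
  assumes d: "nc_matching (N + 2) d" "d p = Suc p" "d l = Suc l"
    and c: "\<And>D. cap p (Suc p) (ins l D) = ins l (cap p' (Suc p') D)"
  shows "{D \<in> fiber (N + 2) p (Suc p) d. D l = Suc l} = ins l ` fiber N p' (Suc p') (rem l d)"
proof (intro equalityI subsetI)
  fix D assume D: "D \<in> {D \<in> fiber (N + 2) p (Suc p) d. D l = Suc l}"
  then have nD: "nc_matching (N + 2) D" "cap p (Suc p) D = d" "D \<noteq> d" "D l = Suc l" by (auto simp: fiber_def)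
  have e: "ins l (rem l D) = D" using ins_rem[OF nD(1,4)] .
  have "d = ins l (cap p' (Suc p') (rem l D))" using nD(2) c[of "rem l D"] e by simp
  then have "cap p' (Suc p') (rem l D) = rem l d" by simp
  moreover have "rem l D \<noteq> rem l d" using e ins_rem[OF d(1,3)] nD(3) by metis
  ultimately show "D \<in> ins l ` fiber N p' (Suc p') (rem l d)"
    using e nc_matching_rem[OF nD(1,4)] by (intro image_eqI[of _ _ "rem l D"]) (auto simp: fiber_def)
next
  fix D assume "D \<in> ins l ` fiber N p' (Suc p') (rem l d)"
  then obtain D0 where D0: "D = ins l D0" "nc_matching N D0" "cap p' (Suc p') D0 = rem l d" "D0 \<noteq> rem l d"
    by (auto simp: fiber_def)
  have e: "ins l (rem l d) = d" using ins_rem[OF d(1,3)] .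
  have "l \<le> N" using nc_matching_gap_less[OF d(1,3)] by simp
  then show "D \<in> {D \<in> fiber (N + 2) p (Suc p) d. D l = Suc l}"
    using D0 c[of D0] e nc_matching_ins[OF D0(2)] by (auto simp: fiber_def)
qed

lemma fiber_far_empty:
  assumes "d l \<noteq> Suc l" "Suc p < l \<or> Suc l < p"
  shows "{D \<in> fiber N p (Suc p) d. D l = Suc l} = {}"
proof -
  have "d l = Suc l" if "nc_matching N D" "D l = Suc l" "cap p (Suc p) D = d" for D
  proof -
    have "D (Suc l) = l" using nc_matchingD(3)[OF that(1)] that(2) by metis
    then have "D p \<noteq> l" "D (Suc p) \<noteq> l" using nc_matchingD(7)[OF that(1)] assms(2) by (metis less_irrefl lessI Suc_lessD)+
    then show ?thesis using that(2,3) assms(2) by (auto simp: cap_def)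
  qed
  then show ?thesis using assms(1) by (auto simp: fiber_def)
qed

text \<open>
  Expanding along the closed-off arcs on the bottom edge produces $[n]!$ times the projector without
  any division.
\<close>

fun jwnum :: "color \<Rightarrow> nat \<Rightarrow> (nat \<Rightarrow> nat) \<Rightarrow> int poly poly" where
  "jwnum c 0 m = 1"
| "jwnum c (Suc n) m =
     (\<Sum>p\<in>{p \<in> {n..2 * n}. m p = Suc p}. qnum c (2 * n + 1 - p) * jwnum c n (rem p m))"

text \<open>Exchanging the sums lets the recursion remove the same arc at \<open>l\<close> from
  \<open>d\<close> and from all members of the fiber. So \<open>G\<close> is the part of the defect
  that comes from matchings with an arc at \<open>l\<close>.\<close>

lemma defect_jwnum_Suc:
  fixes c :: color and x :: "int poly poly"
  defines "G \<equiv> (\<lambda>n p d l. (\<Sum>D\<in>{D \<in> fiber (2 * n + 2) p (Suc p) d. D l = Suc l}. jwnum c n (rem l D))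
                  - (if d l = Suc l then x * jwnum c n (rem l d) else 0))"
  shows "defect (2 * n + 2) x p (Suc p) (jwnum c (Suc n)) d
           = (\<Sum>l\<in>{n..2 * n}. qnum c (2 * n + 1 - l) * G n p d l)"
proof -
  let ?F = "fiber (2 * n + 2) p (Suc p) d" and ?u = "\<lambda>l. qnum c (2 * n + 1 - l)"
  have s: "jwnum c (Suc n) D = (\<Sum>l\<in>{n..2 * n}. ?u l * (if D l = Suc l then jwnum c n (rem l D) else 0))" for D
    unfolding jwnum.simps by (subst sum.inter_filter) (auto intro: sum.cong)
  have "(\<Sum>D\<in>?F. jwnum c (Suc n) D)
      = (\<Sum>l\<in>{n..2 * n}. \<Sum>D\<in>?F. ?u l * (if D l = Suc l then jwnum c n (rem l D) else 0))"
    unfolding s by (rule sum.swap)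
  also have "\<dots> = (\<Sum>l\<in>{n..2 * n}. ?u l * (\<Sum>D\<in>{D \<in> ?F. D l = Suc l}. jwnum c n (rem l D)))"
    by (rule sum.cong[OF refl]) (simp add: sum_distrib_left[symmetric] sum.inter_filter finite_fiber)
  finally have 1: "(\<Sum>D\<in>?F. jwnum c (Suc n) D) = \<dots>" .
  have 2: "x * jwnum c (Suc n) d = (\<Sum>l\<in>{n..2 * n}. ?u l * (if d l = Suc l then x * jwnum c n (rem l d) else 0))"
    unfolding s sum_distrib_left by (rule sum.cong) (auto simp: mult.left_commute)
  show ?thesis unfolding defect_def G_def 1 2 by (simp only: sum_subtractf right_diff_distrib)
qed

text \<open>At l = p only \<open>d\<close> itself contributes; at a neighbour of p straightening
  leaves a single matching; a distant arc is just removed, which shifts the cap by two if the arc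
  lies to its left.\<close>

lemma defect_jwnum_terms:
  fixes c :: color and x :: "int poly poly"
  defines "G \<equiv> (\<lambda>n p d l. (\<Sum>D\<in>{D \<in> fiber (2 * n + 2) p (Suc p) d. D l = Suc l}. jwnum c n (rem l D))
                  - (if d l = Suc l then x * jwnum c n (rem l d) else 0))"
  assumes d: "nc_matching (2 * n + 2) d" "d p = Suc p"
  shows "G n p d p = - x * jwnum c n (rem p d)"
    and "Suc p \<le> 2 * n \<Longrightarrow> G n p d (Suc p) = jwnum c n (rem p d)"
    and "p = Suc l \<Longrightarrow> G n p d l = jwnum c n (rem p d)"
    and "Suc p < l \<Longrightarrow> G n p d l =
           (if d l = Suc l then defect (2 * n) x p (Suc p) (jwnum c n) (rem l d) else 0)"
    and "Suc l < p \<Longrightarrow> G n p d l =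
           (if d l = Suc l then defect (2 * n) x (p - 2) (Suc (p - 2)) (jwnum c n) (rem l d) else 0)"
proof -
  have dS: "d (Suc p) = p" using nc_matchingD(3)[OF d(1), of p] d(2) by simp
  show "G n p d p = - x * jwnum c n (rem p d)" unfolding G_def fiber_same using d(2) by simp
  show "G n p d (Suc p) = jwnum c n (rem p d)" if "Suc p \<le> 2 * n"
  proof -
    have F: "{D \<in> fiber (2 * n + 2) p (Suc p) d. D (Suc p) = Suc (Suc p)} = {ins (Suc p) (rem p d)}"
      by (rule fiber_Suc[OF d]) (use that in simp)
    show ?thesis unfolding G_def F using dS by simp
  qed
  show "G n p d l = jwnum c n (rem p d)" if "p = Suc l" for l
  proof -
    have F: "{D \<in> fiber (2 * n + 2) p (Suc p) d. D l = Suc l} = {ins l (rem p d)}"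
      using fiber_pred[of "2 * n" d l] d that by simp
    have "d l \<noteq> Suc l" using nc_matchingD(7)[OF d(1), of l "Suc (Suc l)"] dS that by auto
    then show ?thesis unfolding G_def F by simp
  qed
  have far: "G n p d l = (if d l = Suc l then defect (2 * n) x p' (Suc p') (jwnum c n) (rem l d) else 0)"
    if c: "\<And>D. cap p (Suc p) (ins l D) = ins l (cap p' (Suc p') D)" and o: "Suc p < l \<or> Suc l < p" for l p'
  proof (cases "d l = Suc l")
    case True
    have F: "{D \<in> fiber (2 * n + 2) p (Suc p) d. D l = Suc l} = ins l ` fiber (2 * n) p' (Suc p') (rem l d)"
      by (rule fiber_far[OF d True c])
    have "inj_on (ins l) S" for S by (rule inj_onI) simp
    then show ?thesis unfolding G_def F defect_def using True by (simp add: sum.reindex)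
  next
    case False
    show ?thesis unfolding G_def fiber_far_empty[where d = d and l = l and p = p, OF False o] using False by simp
  qed
  show "Suc p < l \<Longrightarrow> G n p d l =
           (if d l = Suc l then defect (2 * n) x p (Suc p) (jwnum c n) (rem l d) else 0)" for l
    by (rule far) (auto simp: cap_ins_far_right)
  show "Suc l < p \<Longrightarrow> G n p d l =
           (if d l = Suc l then defect (2 * n) x (p - 2) (Suc (p - 2)) (jwnum c n) (rem l d) else 0)" for l
    by (rule far) (auto simp: cap_ins_far_left)
qed

text \<open>Valid on both edges: the bottom points \<open>p\<close> and \<open>p + 1\<close> are at
  the strand positions 2n - p and 2n - 1 - p, and 2n - 1 - p has the parity of p + 1.\<close>

abbreviation gap :: "(color \<Rightarrow> 'a) \<Rightarrow> color \<Rightarrow> nat \<Rightarrow> 'a" where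
  "gap q c p \<equiv> two_at q c (Suc p)"

lemma two_at_cong: "even i = even j \<Longrightarrow> two_at q c i = two_at q c j"
  by (simp add: two_at_def)

lemma sum_eq_on_intersection:
  fixes f :: "nat \<Rightarrow> 'a::comm_monoid_add"
  assumes "finite S" "\<And>l. l \<in> S \<Longrightarrow> l \<notin> T \<Longrightarrow> f l = 0" "finite T" "\<And>l. l \<in> T \<Longrightarrow> l \<notin> S \<Longrightarrow> f l = 0"
  shows "sum f S = sum f T"
proof -
  have "sum f S = sum f (S \<inter> T)" using assms by (intro sum.mono_neutral_right) auto
  also have "\<dots> = sum f T" using assms by (intro sum.mono_neutral_left) auto
  finally show ?thesis .
qed

text \<open>The bottom caps, the partial trace at the right gap and the top caps have to be treated
  together: the last top cap of n + 1 strands sits at the right gap of n strands, so its vanishing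
  uses the partial trace, and the partial trace uses the bottom caps.\<close>

lemma defect_jwnum:
  "(\<forall>p d. n \<le> p \<and> nc_matching (2 * n) d \<and> d p = Suc p \<longrightarrow>
       defect (2 * n) (gap qvar c p) p (Suc p) (jwnum c n) d = 0) \<and>
   (\<forall>p d. Suc p = n \<and> nc_matching (2 * n) d \<and> d p = Suc p \<longrightarrow>
       defect (2 * n) (gap qvar c p) p (Suc p) (jwnum c n) d = - qnum c (Suc n) * jwnum c (n - 1) (rem p d)) \<and>
   (\<forall>p d. Suc p < n \<and> nc_matching (2 * n) d \<and> d p = Suc p \<longrightarrow>
       defect (2 * n) (gap qvar c p) p (Suc p) (jwnum c n) d = 0)"
proof (induction n)
  case 0
  then show ?case using nc_matching_gap_less[of 0] by fastforce
next
  case (Suc n)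
  have N2: "2 * Suc n = 2 * n + 2" by simp
  note E = defect_jwnum_Suc[where c = c and n = n] and T = defect_jwnum_terms[where c = c and n = n]
  show ?case
  proof (intro conjI allI impI; elim conjE)
    fix p d assume p: "Suc n \<le> p" and d: "nc_matching (2 * Suc n) d" "d p = Suc p"
    note d' = d(1)[unfolded N2] d(2)
    have pb: "p \<le> 2 * n" using nc_matching_gap_less[OF d'] by simp
    define x where "x = gap qvar c p"
    note Ex = E[where x = x and p = p and d = d] and Tx = T[where x = x, OF d']
    obtain l where l: "p = Suc l" using p by (cases p) auto
    define u where "u = (\<lambda>l. qnum c (2 * n + 1 - l))"
    \<comment> \<open>Only the arcs at p - 1, p and p + 1 survive; the distant ones vanish by
      induction. For p = 2n the index p + 1 is outside the range of the recursion, but its weight is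
      [0] = 0.\<close>
    have "defect (2 * n + 2) x p (Suc p) (jwnum c (Suc n)) d =
      (\<Sum>k\<in>{l, p, Suc p}. u k * (if k = p then - x * jwnum c n (rem p d) else jwnum c n (rem p d)))"
      unfolding Ex
    proof (rule trans[OF sum_eq_on_intersection[where T = "{l, p, Suc p}"]], goal_cases)
      case (2 k)
      then consider "Suc p < k" | "Suc k < p" using l by fastforce
      then show ?case
      proof cases
        case 1
        then have "defect (2 * n) x p (Suc p) (jwnum c n) (rem k d) = 0" if "d k = Suc k"
          using Suc.IH nc_matching_rem[OF d'(1) that] p d'(2) unfolding x_def
          by (auto simp: rem_def skip2_simps drop2_def)
        then show ?thesis unfolding Tx(4)[OF 1] by simp
      next
        case 2
        have "rem k d (p - 2) = Suc (p - 2)" using 2 d'(2) l by (auto simp: rem_def skip2_def drop2_def)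
        moreover have "gap qvar c (p - 2) = x" using 2 unfolding x_def by (intro two_at_cong) auto
        moreover have "n \<le> p - 2" using 2 \<open>k \<in> {n..2 * n}\<close> by auto
        ultimately have "defect (2 * n) x (p - 2) (Suc (p - 2)) (jwnum c n) (rem k d) = 0" if "d k = Suc k"
          using Suc.IH nc_matching_rem[OF d'(1) that] by auto
        then show ?thesis unfolding Tx(5)[OF 2] by simp
      qed
    next
      case (4 k)
      then show ?case using p pb l by auto
    next
      case 5
      show ?case
      proof (rule sum.cong[OF refl], goal_cases)
        case (1 k)
        then show ?case using Tx(1) Tx(2) Tx(3)[OF l] l pb unfolding u_def by (cases "p = 2 * n") auto
      qed
    qed auto
    also have "\<dots> = (u l - x * u p + u (Suc p)) * jwnum c n (rem p d)"
      using l by (simp add: algebra_simps)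
    also have "u l - x * u p + u (Suc p) = 0"
    proof -
      have "u l = qnum c (Suc (2 * n + 1 - p))" using l pb unfolding u_def by (simp add: Suc_diff_le)
      moreover have "two_at qvar c (2 * n + 1 - p) = x" unfolding x_def using pb by (intro two_at_cong) auto
      ultimately show ?thesis using qnum_Suc[of "2 * n + 1 - p" c] pb unfolding u_def by simp
    qed
    finally show "defect (2 * Suc n) (gap qvar c p) p (Suc p) (jwnum c (Suc n)) d = 0" by (simp add: x_def del: jwnum.simps)
  next
    fix p d assume p: "Suc p = Suc n" and d: "nc_matching (2 * Suc n) d" "d p = Suc p"
    note d' = d(1)[unfolded N2] d(2)
    define x where "x = gap qvar c p"
    note Ex = E[where x = x and p = p and d = d] and Tx = T[where x = x, OF d']
    define u where "u = (\<lambda>l. qnum c (2 * n + 1 - l))"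
    \<comment> \<open>The right gap is the lower end of the range, so the neighbour on the left is
      missing. The three-term recursion of the weights then leaves its missing member [n + 2], up to
      sign.\<close>
    have "defect (2 * n + 2) x p (Suc p) (jwnum c (Suc n)) d =
      (\<Sum>k\<in>{p, Suc p}. u k * (if k = p then - x * jwnum c n (rem p d) else jwnum c n (rem p d)))"
      unfolding Ex
    proof (rule trans[OF sum_eq_on_intersection[where T = "{p, Suc p}"]], goal_cases)
      case (2 k)
      then have k: "Suc p < k" using p by auto
      then have "defect (2 * n) x p (Suc p) (jwnum c n) (rem k d) = 0" if "d k = Suc k"
          using Suc.IH nc_matching_rem[OF d'(1) that] p d'(2) unfolding x_def
          by (auto simp: rem_def skip2_simps drop2_def)
      then show ?case unfolding Tx(4)[OF k] by simp
    next
      case (4 k)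
      then show ?case using p by (cases "n = 0") auto
    next
      case 5
      show ?case
      proof (rule sum.cong[OF refl], goal_cases)
        case (1 k)
        then show ?case using Tx(1) Tx(2) p unfolding u_def by (cases "n = 0") auto
      qed
    qed auto
    also have "\<dots> = - (x * u p - u (Suc p)) * jwnum c n (rem p d)"
      by (simp add: algebra_simps)
    also have "x * u p - u (Suc p) = qnum c (Suc (Suc n))"
    proof -
      have "two_at qvar c (Suc n) = x" unfolding x_def using p by simp
      then show ?thesis using qnum_Suc[of "Suc n" c] p unfolding u_def by (simp add: Suc_diff_le)
    qed
    finally show "defect (2 * Suc n) (gap qvar c p) p (Suc p) (jwnum c (Suc n)) d
       = - qnum c (Suc (Suc n)) * jwnum c (Suc n - 1) (rem p d)" by (simp add: x_def del: jwnum.simps)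
  next
    fix p d assume p: "Suc p < Suc n" and d: "nc_matching (2 * Suc n) d" "d p = Suc p"
    note d' = d(1)[unfolded N2] d(2)
    define x where "x = gap qvar c p"
    note Ex = E[where x = x and p = p and d = d] and Tx = T[where x = x, OF d']
    define u where "u = (\<lambda>l. qnum c (2 * n + 1 - l))"
    have rp: "rem k d p = Suc p" if "Suc p < k" for k using d(2) that by (simp add: rem_def skip2_simps drop2_def)
    show "defect (2 * Suc n) (gap qvar c p) p (Suc p) (jwnum c (Suc n)) d = 0"
    proof (cases "Suc p = n")
      case False
      have "defect (2 * n + 2) x p (Suc p) (jwnum c (Suc n)) d = 0" unfolding Ex
      proof (rule sum.neutral, rule ballI, goal_cases)
        case (1 k)
        then have k: "Suc p < k" using p False by auto
        then have "defect (2 * n) x p (Suc p) (jwnum c n) (rem k d) = 0" if "d k = Suc k"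
          using Suc.IH nc_matching_rem[OF d'(1) that] p False rp[OF k] unfolding x_def by auto
        then show ?case unfolding Tx(4)[OF k] by simp
      qed
      then show ?thesis by (simp add: x_def del: jwnum.simps)
    next
      case True
      then obtain n' where n': "n = Suc n'" "p = n'" by (cases n) auto
      \<comment> \<open>The arc at n is straightened, while every further arc produces a partial
        trace on n strands. These partial traces add up to the recursion for \<open>rem p d\<close>,
        so the two contributions, both with the factor [n + 1], cancel.\<close>
      have "defect (2 * n + 2) x p (Suc p) (jwnum c (Suc n)) d = u n * jwnum c n (rem p d) +
         (\<Sum>k\<in>{Suc n..2 * n}. u k * (if d k = Suc k then - qnum c (Suc n) * jwnum c n' (rem p (rem k d)) else 0))"
      proof -
        have s: "{n..2 * n} = insert n {Suc n..2 * n}" by auto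
        define G where "G = (\<lambda>k. (\<Sum>D\<in>{D \<in> fiber (2 * n + 2) p (Suc p) d. D k = Suc k}. jwnum c n (rem k D))
                  - (if d k = Suc k then x * jwnum c n (rem k d) else 0))"
        have Ex': "defect (2 * n + 2) x p (Suc p) (jwnum c (Suc n)) d = (\<Sum>k\<in>{n..2 * n}. u k * G k)"
          unfolding Ex G_def u_def by (rule refl)
        have Gn: "G n = jwnum c n (rem p d)"
        proof -
          have "Suc p \<le> 2 * n" using True by simp
          from Tx(2)[OF this] show ?thesis unfolding True G_def .
        qed
        have Gk: "G k = (if d k = Suc k then - qnum c (Suc n) * jwnum c n' (rem p (rem k d)) else 0)" if "k \<in> {Suc n..2 * n}" for k
        proof -
          have k: "Suc p < k" using that True by auto
          have "defect (2 * n) x p (Suc p) (jwnum c n) (rem k d) = - qnum c (Suc n) * jwnum c n' (rem p (rem k d))"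
            if "d k = Suc k"
          proof -
            have "defect (2 * n) (gap qvar c p) p (Suc p) (jwnum c n) (rem k d)
              = - qnum c (Suc n) * jwnum c (n - 1) (rem p (rem k d))"
              using Suc.IH nc_matching_rem[OF d'(1) that] True rp[OF k] by blast
            moreover have "n - 1 = n'" using n' by simp
            ultimately show ?thesis unfolding x_def by simp
          qed
          then show ?thesis unfolding G_def Tx(4)[OF k] by simp
        qed
        show ?thesis unfolding Ex' s
          by (subst sum.insert) (auto simp: Gn Gk simp del: jwnum.simps qnum.simps intro!: sum.cong)
      qed
      also have "(\<Sum>k\<in>{Suc n..2 * n}. u k * (if d k = Suc k then - qnum c (Suc n) * jwnum c n' (rem p (rem k d)) else 0))
         = - qnum c (Suc n) * (\<Sum>k\<in>{k \<in> {Suc n..2 * n}. d k = Suc k}. u k * jwnum c n' (rem p (rem k d)))"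
        unfolding sum_distrib_left by (subst sum.inter_filter) (auto intro!: sum.cong simp: algebra_simps)
      also have "(\<Sum>k\<in>{k \<in> {Suc n..2 * n}. d k = Suc k}. u k * jwnum c n' (rem p (rem k d))) = jwnum c n (rem p d)"
      proof -
        have at: "rem p d l = Suc l \<longleftrightarrow> d (l + 2) = Suc (l + 2)" if "p \<le> l" for l
        proof -
          have "d (l + 2) \<notin> {p, Suc p}" using nc_matchingD(3)[OF d(1), of "l + 2"] nc_matchingD(3)[OF d(1), of p] d(2) that by auto
          then show ?thesis using that by (auto simp: rem_def skip2_simps drop2_def)
        qed
        have "jwnum c n (rem p d) = (\<Sum>l\<in>{l \<in> {n'..2 * n'}. rem p d l = Suc l}. qnum c (2 * n' + 1 - l) * jwnum c n' (rem l (rem p d)))"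
          using n' by simp
        also have "\<dots> = (\<Sum>k\<in>{k \<in> {Suc n..2 * n}. d k = Suc k}. u k * jwnum c n' (rem p (rem k d)))"
        proof (rule sum.reindex_bij_witness[where i = "\<lambda>k. k - 2" and j = "\<lambda>l. l + 2"], goal_cases)
          case (2 l) then show ?case using n' at[of l] by auto
        next
          case (4 k)
          then have "k - 2 + 2 = k" "p \<le> k - 2" using n' by auto
          then show ?case using 4 n' at[of "k - 2"] by auto
        next
          case (5 l)
          then have l: "d (l + 2) = Suc (l + 2)" "p \<le> l" using at[of l] n' by auto
          then show ?case using rem_rem[of "2 * n'" d p l] d' n' unfolding u_def by (simp add: eval_nat_numeral)
        qed (use n' in auto)
        finally show ?thesis ..
      qed
      also have "u n = qnum c (Suc n)" unfolding u_def by (simp add: Suc_diff_le)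
      finally show ?thesis by (simp add: x_def del: jwnum.simps)
    qed
  qed
qed


section \<open>Specialization and rotation\<close>

lemma poly_map_poly_hom:
  fixes h :: "'a::comm_ring_1 \<Rightarrow> 'b::comm_ring_1" and x :: 'b
  assumes h: "h 0 = 0" "h 1 = 1" "\<And>a b. h (a + b) = h a + h b" "\<And>a b. h (a * b) = h a * h b"
  defines "H \<equiv> \<lambda>p. poly (map_poly h p) x"
  shows "H 0 = 0" "H 1 = 1" "H (p + r) = H p + H r" "H (p * r) = H p * H r"
    "H (pCons a p) = h a + x * H p"
proof -
  show H0: "H 0 = 0" by (simp add: H_def)
  show C: "H (pCons a p) = h a + x * H p" for a p by (simp add: H_def map_poly_pCons h(1))
  show "H 1 = 1" using C[of 1 0] by (simp add: H0 h(2) flip: one_pCons)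
  show add: "H (p + r) = H p + H r" for p r
  proof (induction p arbitrary: r)
    case 0 then show ?case by (simp add: H0)
  next
    case (pCons a p)
    obtain b r' where r: "r = pCons b r'" by (cases r)
    have "H (pCons a p + r) = h a + h b + x * (H p + H r')" by (simp only: r add_pCons C h(3) pCons.IH)
    then show ?case by (simp only: r C) (simp add: algebra_simps)
  qed
  have smult: "H (smult a r) = h a * H r" for a r
    by (induction r) (simp_all add: H0 C h(4) algebra_simps)
  show "H (p * r) = H p * H r"
    by (induction p) (simp_all add: H0 C add smult h(1) algebra_simps)
qed

lemma specialize_hom:
  "specialize q 0 = 0" "specialize q 1 = 1"
  "specialize q (P + P') = specialize q P + specialize q P'"
  "specialize q (P * P') = specialize q P * specialize q P'"
  "specialize q (qvar c) = q c"
proof -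
  let ?g = "\<lambda>p. poly (map_poly of_int p) (q ColT)"
  note i = poly_map_poly_hom[where h = of_int and x = "q ColT"]
  have g: "?g 0 = 0" "?g 1 = 1" "\<And>a b. ?g (a + b) = ?g a + ?g b" "\<And>a b. ?g (a * b) = ?g a * ?g b"
    using i by simp_all
  note o = poly_map_poly_hom[where h = ?g and x = "q ColS", OF g]
  show "specialize q 0 = 0" "specialize q 1 = 1"
    "specialize q (P + P') = specialize q P + specialize q P'"
    "specialize q (P * P') = specialize q P * specialize q P'"
    unfolding specialize_def using o by blast+
  show "specialize q (qvar c) = q c"
    by (cases c) (simp_all add: specialize_def map_poly_pCons)
qed

lemma specialize_diff: "specialize q (P - P') = specialize q P - specialize q P'"
  using specialize_hom(3)[of q "P - P'" P'] by (simp add: algebra_simps)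

lemma specialize_minus: "specialize q (- P) = - specialize q P"
  using specialize_diff[of q 0 P] by (simp add: specialize_hom)

lemma specialize_sum: "specialize q (sum f A) = (\<Sum>x\<in>A. specialize q (f x))"
  by (induction A rule: infinite_finite_induct) (simp_all add: specialize_hom)

lemma specialize_prod: "specialize q (prod f A) = (\<Prod>x\<in>A. specialize q (f x))"
  by (induction A rule: infinite_finite_induct) (simp_all add: specialize_hom)

lemma specialize_two_at: "specialize q (two_at qvar c i) = two_at q c i"
  by (simp add: two_at_def specialize_hom)

lemma qnum_neq_0: "1 \<le> j \<Longrightarrow> qnum c j \<noteq> 0"
proof -
  \<comment> \<open>With both variables equal to 2, quantum numbers are ordinary integers.\<close>
  have "specialize (\<lambda>_. 2) (qnum c j) = int j"
    by (induction c j rule: qnum.induct) (simp_all add: specialize_hom specialize_diff)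
  then show "1 \<le> j \<Longrightarrow> qnum c j \<noteq> 0" by (auto simp: specialize_hom)
qed

lemma qfact_neq_0: "qfact c m \<noteq> 0"
  using qnum_neq_0 by (auto simp: qfact_def)

lemma qfact_Suc: "qfact c (Suc m) = qfact c m * qnum c (Suc m)"
  by (simp add: qfact_def)

lemma qfact_0: "qfact c 0 = 1"
  by (simp add: qfact_def)

text \<open>The matchings D_k: two families of nested arcs side by side on the circle, namely the
  identity rotated by k steps. Both k = 0 and k = n give the identity.\<close>

definition nest :: "nat \<Rightarrow> nat \<Rightarrow> nat \<Rightarrow> nat" where
  "nest n k x = (if x < 2 * k then 2 * k - 1 - x else if x < 2 * n then 2 * n + 2 * k - 1 - x else x)"

lemma nest_rainbow: "nest n 0 = rainbow n" "nest n n = rainbow n"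
  by (auto simp: nest_def rainbow_def fun_eq_iff)

lemma rem_nest:
  "k \<le> n \<Longrightarrow> rem (n + k) (nest (Suc n) k) = nest n k"
  "rem n (nest (Suc n) (Suc n)) = nest n n"
proof -
  show "rem (n + k) (nest (Suc n) k) = nest n k" if "k \<le> n"
  proof
    fix x
    show "rem (n + k) (nest (Suc n) k) x = nest n k x"
      using that by (cases "x < 2 * k"; cases "x < 2 * n"; cases "x < n + k") (auto simp: rem_def skip2_def drop2_def nest_def)
  qed
  show "rem n (nest (Suc n) (Suc n)) = nest n n"
  proof
    fix x
    show "rem n (nest (Suc n) (Suc n)) x = nest n n x"
      by (cases "x < 2 * n"; cases "x < n") (auto simp: rem_def skip2_def drop2_def nest_def)
  qed
qed

text \<open>On n + 1 strands only one arc lies in the range of the recursion: at n + k with weight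
  [n + 1 - k], or at n with weight [n + 1] if k = n + 1. So the sum collapses to a product.\<close>

lemma jwnum_nest: "k \<le> n \<Longrightarrow> jwnum c n (nest n k) = qfact c k * qfact c (n - k)"
proof (induction n arbitrary: k)
  case 0 then show ?case by (simp add: qfact_0)
next
  case (Suc n)
  show ?case
  proof (cases "k \<le> n")
    case True
    have "{p \<in> {n..2 * n}. nest (Suc n) k p = Suc p} = {n + k}"
      using True by (auto simp: nest_def split: if_splits)
    moreover have "2 * n + 1 - (n + k) = Suc (n - k)" using True by simp
    ultimately show ?thesis using True Suc.IH[OF True]
      by (simp only: jwnum.simps sum.insert rem_nest(1)[OF True])
        (simp add: rem_nest(1)[OF True] Suc_diff_le qfact_Suc del: qnum.simps)
  next
    case False
    then have k: "k = Suc n" using Suc.prems by simp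
    have "{p \<in> {n..2 * n}. nest (Suc n) (Suc n) p = Suc p} = {n}"
      by (auto simp: nest_def split: if_splits)
    then show ?thesis using Suc.IH[of n]
      by (simp only: k jwnum.simps) (simp add: rem_nest(2) Suc_diff_le qfact_Suc qfact_0 del: qnum.simps)
  qed
qed

text \<open>Conjugation by the cyclic shift of the points. As the last point is the bottom left one,
  this bends the bottom left endpoint up, as \<open>rot2\<close> does.\<close>

definition rot :: "nat \<Rightarrow> (nat \<Rightarrow> nat) \<Rightarrow> nat \<Rightarrow> nat" where
  "rot N m x = (if x < N then Suc (m (if x = 0 then N - 1 else x - 1)) mod N else x)"

lemma Suc_mod: "y < N \<Longrightarrow> Suc y mod N = (if Suc y = N then 0 else Suc y)"
  by auto

lemma rot_Suc: "y < N \<Longrightarrow> rot N m (Suc y mod N) = Suc (m y) mod N"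
  by (auto simp: Suc_mod rot_def)

lemma nc_matching_rot:
  assumes m: "nc_matching N m" shows "nc_matching N (rot N m)"
proof (cases "N = 0")
  case True
  then show ?thesis using m by (simp add: nc_matching_def rot_def)
next
  case False
  note D = nc_matchingD[OF m]
  define s where "s = (\<lambda>y. Suc y mod N)"
  have onto: "\<exists>y<N. x = s y" if "x < N" for x
    using that by (intro exI[of _ "if x = 0 then N - 1 else x - 1"]) (auto simp: s_def)
  have sN: "s y < N" for y using False by (simp add: s_def)
  have inj: "s y = s z \<longleftrightarrow> y = z" if "y < N" "z < N" for y z using that by (auto simp: s_def Suc_mod)
  have r: "rot N m (s y) = s (m y)" if "y < N" for y using rot_Suc[OF that] by (simp add: s_def)
  show ?thesis unfolding nc_matching_def
  proof (intro conjI allI impI)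
    fix x assume x: "x < N"
    then obtain y where y: "y < N" "x = s y" using onto by blast
    show "rot N m x < N" "rot N m x \<noteq> x" using y r sN inj D(1,2)[of y] by auto
  next
    fix x show "rot N m (rot N m x) = x"
    proof (cases "x < N")
      case True
      then obtain y where y: "y < N" "x = s y" using onto by blast
      then show ?thesis using r D(1,3)[of y] by auto
    qed (simp add: rot_def)
  next
    fix x assume "N \<le> x" then show "rot N m x = x" by (simp add: rot_def)
  next
    fix x y assume xy: "x < y \<and> y < rot N m x"
    have "x < N" using xy by (auto simp: rot_def split: if_splits)
    then obtain a where a: "a < N" "x = s a" using onto by blast
    have ra: "rot N m x = s (m a)" using a r by simp
    then have "y < N" using xy sN[of "m a"] by simp
    then obtain b where b: "b < N" "y = s b" using onto by blast
    have rb: "rot N m y = s (m b)" using b r by simp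
    have ma: "m a < N" "m b < N" using D(1) a b by auto
    have S: "s z = (if Suc z = N then 0 else Suc z)" if "z < N" for z using that by (simp add: s_def Suc_mod)
    have lt: "s a < s b" "s b < s (m a)" using xy a b ra by auto
    have b1: "s b = Suc b" "s (m a) = Suc (m a)" using lt S[OF b(1)] S[OF ma(1)] by (auto split: if_splits)
    have "b < m a" using lt b1 by simp
    show "rot N m y < rot N m x"
    \<comment> \<open>If \<open>a\<close> is the last point, it is shifted to 0. The arc that ended
      at \<open>a\<close> now starts at 0, and its outside becomes its inside.\<close>
    proof (cases "Suc a = N")
      case True
      have "Suc (m b) \<noteq> N" using True D(3)[of b] \<open>b < m a\<close> by (metis Suc_inject less_irrefl)
      then have "s (m b) = Suc (m b)" using S[OF ma(2)] by simp
      moreover have "m b < m a"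
      proof (rule ccontr)
        assume "\<not> m b < m a"
        then have "m a < m b" using D(7) \<open>b < m a\<close> D(3) by (metis linorder_neqE_nat less_irrefl True a(1) b(1) lt(1) )
        then show False using D(5)[of b "m a"] \<open>b < m a\<close> D(3)[of a] True ma by auto
      qed
      ultimately show ?thesis using ra rb b1 by simp
    next
      case False
      then have "a < b" using lt b1 S[OF a(1)] by simp
      then have "m b < m a" using D(5) \<open>b < m a\<close> by blast
      then show ?thesis using ra rb b1 S[OF ma(2)] by auto
    qed
  qed
qed

lemma nc_matching_rot_pow: "nc_matching N m \<Longrightarrow> nc_matching N ((rot N ^^ s) m)"
  by (induction s) (simp_all add: nc_matching_rot)

lemma rot_pow_at:
  assumes "nc_matching N m" "y < N"
  shows "(rot N ^^ s) m ((y + s) mod N) = (m y + s) mod N"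
proof (induction s)
  case 0 then show ?case using assms nc_matchingD(1) by simp
next
  case (Suc s)
  have "(y + Suc s) mod N = Suc ((y + s) mod N) mod N" "(m y + Suc s) mod N = Suc ((m y + s) mod N) mod N"
    by (simp_all add: mod_Suc_eq)
  then show ?case using rot_Suc[of "(y + s) mod N" N "(rot N ^^ s) m"] Suc assms(2)
    by (simp)
qed

lemma rot_full:
  assumes "nc_matching N m" shows "(rot N ^^ N) m = m"
proof
  fix x show "(rot N ^^ N) m x = m x"
    using rot_pow_at[OF assms, of x N] nc_matchingD(1,4)[OF assms, of x]
      nc_matchingD(4)[OF nc_matching_rot_pow[OF assms], of x N] by (cases "x < N") auto
qed

lemma rot_nest:
  assumes "k < n" shows "rot (2 * n) (nest n k) = nest n (Suc k)"
proof
  fix x show "rot (2 * n) (nest n k) x = nest n (Suc k) x"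
    using assms by (cases "x = 0"; cases "x < 2 * k"; cases "x = 2 * k"; cases "x = Suc (2 * k)"; cases "x < 2 * n") (auto simp: rot_def nest_def)
qed

lemma rot_pow_rainbow: "k \<le> n \<Longrightarrow> (rot (2 * n) ^^ k) (rainbow n) = nest n k"
  by (induction k) (simp_all add: nest_rainbow rot_nest)

lemma nc_matching_nest: "k \<le> n \<Longrightarrow> nc_matching (2 * n) (nest n k)"
  using nc_matching_rot_pow[OF nc_matching_rainbow, of n k] by (simp add: rot_pow_rainbow)

lemma rot_inj:
  assumes "nc_matching N m" "nc_matching N m'" "rot N m = rot N m'" shows "m = m'"
proof (cases N)
  case 0 then show ?thesis using assms by (auto simp: nc_matching_def)
next
  case (Suc N')
  then have "(rot N ^^ N') (rot N m) = (rot N ^^ N') (rot N m')" using assms(3) by simp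
  then have "(rot N ^^ N) m = (rot N ^^ N) m'" using Suc by (simp add: funpow_swap1)
  then show ?thesis using rot_full assms by metis
qed

lemma rot_surj:
  assumes "nc_matching N m" obtains m' where "nc_matching N m'" "rot N m' = m"
proof (cases N)
  case 0
  then have "rot N m = m" using nc_matchingD(4)[OF assms] by (auto simp: rot_def)
  then show ?thesis using assms that by blast
next
  case (Suc N')
  show ?thesis using that[of "(rot N ^^ N') m"] nc_matching_rot_pow[OF assms] rot_full[OF assms] Suc by simp
qed

lemma cap_rot:
  assumes m: "nc_matching N m" and uv: "u < N" "v < N"
  shows "cap (Suc u mod N) (Suc v mod N) (rot N m) = rot N (cap u v m)"
proof
  fix x
  note D = nc_matchingD[OF m]
  show "cap (Suc u mod N) (Suc v mod N) (rot N m) x = rot N (cap u v m) x"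
  proof (cases "x < N")
    case True
    define y where "y = (if x = 0 then N - 1 else x - 1)"
    have y: "y < N" "x = Suc y mod N" using True by (auto simp: y_def)
    have inj: "Suc a mod N = Suc b mod N \<longleftrightarrow> a = b" if "a < N" "b < N" for a b using that by (auto simp: Suc_mod)
    have r: "rot N m (Suc a mod N) = Suc (m a) mod N" if "a < N" for a using rot_Suc[OF that] .
    have "rot N (cap u v m) x = Suc (cap u v m y) mod N" using True by (simp add: rot_def y_def)
    then show ?thesis unfolding y(2) cap_def using uv y(1) D(1) by (simp add: r inj)
  next
    case False
    then have "x \<noteq> Suc u mod N" "x \<noteq> Suc v mod N" "x \<noteq> rot N m (Suc u mod N)" "x \<noteq> rot N m (Suc v mod N)"
      using uv rot_Suc[OF uv(1)] rot_Suc[OF uv(2)] by (auto intro: mod_less_divisor simp del: Suc_mod)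
    then show ?thesis using False by (simp add: cap_def rot_def)
  qed
qed

lemma defect_rot:
  assumes d: "nc_matching N d" and uv: "u < N" "v < N"
  shows "defect N x (Suc u mod N) (Suc v mod N) f (rot N d) = defect N x u v (f \<circ> rot N) d"
proof -
  have "fiber N (Suc u mod N) (Suc v mod N) (rot N d) = rot N ` fiber N u v d"
  proof (intro equalityI subsetI)
    fix D assume D: "D \<in> fiber N (Suc u mod N) (Suc v mod N) (rot N d)"
    then have "nc_matching N D" by (simp add: fiber_def)
    then obtain D' where D': "nc_matching N D'" "rot N D' = D" by (rule rot_surj)
    have e: "rot N (cap u v D') = rot N d" using D D' cap_rot[OF D'(1) uv] by (simp add: fiber_def)
    have "cap u v D' = d"
    proof
      fix y show "cap u v D' y = d y"
      proof (cases "y < N")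
        case True
        have c: "cap u v D' y < N" using True uv nc_matchingD(1)[OF D'(1)] by (simp add: cap_def)
        have "rot N (cap u v D') (Suc y mod N) = Suc (cap u v D' y) mod N" using rot_Suc[OF True] .
        moreover have "rot N d (Suc y mod N) = Suc (d y) mod N" using rot_Suc[OF True] .
        ultimately have "Suc (cap u v D' y) mod N = Suc (d y) mod N" using e by simp
        then show ?thesis using c nc_matchingD(1)[OF d True] by (simp add: Suc_mod split: if_splits)
      next
        case False
        then have "y \<notin> {u, v, D' u, D' v}" using uv nc_matchingD(1)[OF D'(1)] by auto
        then show ?thesis using False nc_matchingD(4)[OF D'(1), of y] nc_matchingD(4)[OF d, of y] by (simp add: cap_def)
      qed
    qed
    moreover have "D' \<noteq> d" using D D'(2) by (auto simp: fiber_def)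
    ultimately show "D \<in> rot N ` fiber N u v d" using D' by (intro image_eqI[of _ _ D']) (simp_all add: fiber_def)
  next
    fix D assume "D \<in> rot N ` fiber N u v d"
    then obtain D' where D': "nc_matching N D'" "cap u v D' = d" "D' \<noteq> d" "D = rot N D'" by (auto simp: fiber_def)
    then show "D \<in> fiber N (Suc u mod N) (Suc v mod N) (rot N d)"
      using cap_rot[OF D'(1) uv] nc_matching_rot[OF D'(1)] rot_inj[OF D'(1) d] D'(2,3)
      unfolding fiber_def D'(4) by auto
  qed
  moreover have "inj_on (rot N) (fiber N u v d)" by (rule inj_onI) (auto simp: fiber_def intro: rot_inj)
  ultimately show ?thesis by (simp add: defect_def sum.reindex)
qed

lemma defect_rot_pow:
  assumes d: "nc_matching N d" and uv: "u < N" "v < N"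
  shows "defect N x ((u + s) mod N) ((v + s) mod N) f ((rot N ^^ s) d) = defect N x u v (f \<circ> (rot N ^^ s)) d"
proof (induction s arbitrary: f)
  case 0 then show ?case using uv by simp
next
  case (Suc s)
  have "(u + Suc s) mod N = Suc ((u + s) mod N) mod N" "(v + Suc s) mod N = Suc ((v + s) mod N) mod N"
    by (simp_all add: mod_Suc_eq)
  moreover have "(u + s) mod N < N" "(v + s) mod N < N" using uv by simp_all
  ultimately have "defect N x ((u + Suc s) mod N) ((v + Suc s) mod N) f ((rot N ^^ Suc s) d)
     = defect N x ((u + s) mod N) ((v + s) mod N) (f \<circ> rot N) ((rot N ^^ s) d)"
    using defect_rot[OF nc_matching_rot_pow[OF d, of s], of "(u + s) mod N" "(v + s) mod N"] by simp
  then show ?case using Suc[of "f \<circ> rot N"] by (simp add: comp_assoc)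
qed


section \<open>Elimination of valleys\<close>

definition top_killed :: "(color \<Rightarrow> 'a::comm_ring_1) \<Rightarrow> color \<Rightarrow> nat \<Rightarrow> ((nat \<Rightarrow> nat) \<Rightarrow> 'a) \<Rightarrow> bool" where
  "top_killed q c n f \<longleftrightarrow> (\<forall>p d. Suc p < n \<and> nc_matching (2 * n) d \<and> d p = Suc p \<longrightarrow>
     defect (2 * n) (gap q c p) p (Suc p) f d = 0)"

definition bot_killed :: "(color \<Rightarrow> 'a::comm_ring_1) \<Rightarrow> color \<Rightarrow> nat \<Rightarrow> ((nat \<Rightarrow> nat) \<Rightarrow> 'a) \<Rightarrow> bool" where
  "bot_killed q c n f \<longleftrightarrow> (\<forall>p d. n \<le> p \<and> nc_matching (2 * n) d \<and> d p = Suc p \<longrightarrow>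
     defect (2 * n) (gap q c p) p (Suc p) f d = 0)"

lemma jwnum_killed: "top_killed qvar c n (jwnum c n)" "bot_killed qvar c n (jwnum c n)"
  unfolding top_killed_def bot_killed_def using defect_jwnum[of n c] by blast+

lemma defect_zero_solve:
  assumes "nc_matching N D" "Suc p < N" "D p \<noteq> Suc p" "defect N x p (Suc p) f (cap p (Suc p) D) = 0"
  shows "f D = x * f (cap p (Suc p) D) - (\<Sum>D'\<in>fiber N p (Suc p) (cap p (Suc p) D) - {D}. f D')"
proof -
  have "D \<in> fiber N p (Suc p) (cap p (Suc p) D)" using cap_in_fiber assms by blast
  then show ?thesis using assms(4) sum.remove[OF finite_fiber, of D N p "Suc p" "cap p (Suc p) D" f]
    by (simp add: defect_def algebra_simps)
qed

text \<open>
  The words relative to the base point in the middle of a nest of \<open>k\<close> caps on the bottom edge. Only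
  top points can be permuted, so there is a single word without valleys, the fully nested one.
\<close>

definition centered :: "nat \<Rightarrow> nat \<Rightarrow> (nat \<Rightarrow> nat) \<Rightarrow> bool" where
  "centered n k m \<longleftrightarrow> {..<n - k} \<subseteq> openers m \<and> {2 * n - k..<2 * n} \<inter> openers m = {}"

text \<open>By \<open>fiber_cases\<close> an opener is only removed at \<open>u\<close> or later and
  only added at \<open>u + 1\<close> or earlier. So the first range loses no opener and the last
  range gains none.\<close>

lemma centered_fiber:
  assumes D: "D \<in> fiber (2 * n) u (Suc u) d" and u: "n - k \<le> u" "Suc u < 2 * n - k" and d: "centered n k d"
  shows "centered n k D"
proof -
  have "Suc u < 2 * n" using u by simp
  with D show ?thesis
  proof (cases rule: fiber_cases)
    case (left a)
    then show ?thesis using u d unfolding centered_def by fastforce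
  next
    case (right b)
    then show ?thesis using u d unfolding centered_def by fastforce
  next
    case enc
    then show ?thesis using u d unfolding centered_def by fastforce
  qed
qed

lemma centered_cap:
  assumes D: "nc_matching (2 * n) D" "valley u D" and u: "n - k \<le> u" "Suc u < 2 * n - k" and c: "centered n k D"
  shows "centered n k (cap u (Suc u) D)"
proof -
  define d where "d = cap u (Suc u) D"
  have uN: "Suc u < 2 * n" using u by simp
  have "D u \<noteq> Suc u" using D(2) by (auto simp: valley_def)
  note cf = cap_in_fiber[OF D(1) uN this, folded d_def]
  have "openers d \<subseteq> insert u (openers D)" "openers D \<subseteq> insert (Suc u) (openers d)"
    using cf(2) uN
  proof (atomize (full), cases rule: fiber_cases)
    case (left a)
    then show "openers d \<subseteq> insert u (openers D) \<and> openers D \<subseteq> insert (Suc u) (openers d)"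
      using D(2) by (auto simp: valley_def)
  next
    case (right b)
    have "u \<in> openers d" "u \<notin> openers D" using cf(3) D(2) by (auto simp: openers_def valley_def)
    then show "openers d \<subseteq> insert u (openers D) \<and> openers D \<subseteq> insert (Suc u) (openers d)" using right by auto
  next
    case enc
    then show "openers d \<subseteq> insert u (openers D) \<and> openers D \<subseteq> insert (Suc u) (openers d)" by auto
  qed
  then show ?thesis using c u unfolding centered_def d_def[symmetric] by fastforce
qed

text \<open>The polynomial is built from the local relations alone, by solving the relation at a
  valley for the coefficient of the valley. Therefore one and the same \<open>P\<close> works for
  all vectors over both rings. The recursion ends at the rainbow, the only centered word without a
  valley among the top points.\<close>

lemma centered_coeff:
  fixes q :: "color \<Rightarrow> 'a::comm_ring_1"
  assumes m: "nc_matching (2 * n) m" and "centered n k m" and k: "k \<le> n"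
  shows "\<exists>P. (\<forall>f. top_killed q c n f \<longrightarrow> f ((rot (2 * n) ^^ (n + k)) m) = specialize q P * f (nest n k)) \<and>
             (\<forall>f. top_killed qvar c n f \<longrightarrow> f ((rot (2 * n) ^^ (n + k)) m) = P * f (nest n k))"
    (is "\<exists>P. ?C m P")
proof -
  define V where "V = {u. n - k \<le> u \<and> Suc u < 2 * n - k}"
  let ?r = "rot (2 * n) ^^ (n + k)"
  have kill: "defect (2 * n) (gap q' c (u - (n - k))) u (Suc u) (f \<circ> ?r) d = 0"
    if "u \<in> V" "nc_matching (2 * n) d" "d u = Suc u" "top_killed q' c n f" for u d f and q' :: "color \<Rightarrow> 'b::comm_ring_1"
  proof -
    have u: "n - k \<le> u" "Suc u < 2 * n - k" using that(1) by (auto simp: V_def)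
    \<comment> \<open>The rotation by n + k carries the positions in \<open>V\<close> to the gaps of
      the top edge.\<close>
    have e: "(u + (n + k)) mod (2 * n) = u - (n - k)"
    proof -
      have "u + (n + k) = (u - (n - k)) + 2 * n" using u k by simp
      then show ?thesis using u k by (simp only: mod_add_self2) simp
    qed
    have e2: "(Suc u + (n + k)) mod (2 * n) = Suc (u - (n - k))"
    proof -
      have "Suc u + (n + k) = Suc (u - (n - k)) + 2 * n" using u k by simp
      then show ?thesis using u k by (simp only: mod_add_self2) simp
    qed
    have uN: "u < 2 * n" "Suc u < 2 * n" using u by auto
    have "?r d (u - (n - k)) = Suc (u - (n - k))"
      using rot_pow_at[OF that(2) uN(1), of "n + k"] that(3) e e2 by simp
    then have "defect (2 * n) (gap q' c (u - (n - k))) (u - (n - k)) (Suc (u - (n - k))) f (?r d) = 0"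
      using that(4) nc_matching_rot_pow[OF that(2)] u k unfolding top_killed_def by simp
    then show ?thesis using defect_rot_pow[OF that(2) uN, of _ "n + k" f] unfolding e e2 by simp
  qed
  show ?thesis using m \<open>centered n k m\<close>
  proof (induction m rule: valley_induct[where V = V])
    case (gaps u) then show ?case by (auto simp: V_def)
  next
    case (step m)
    show ?case
    proof (cases "\<exists>u\<in>V. valley u m")
      case True
      then obtain u where u: "u \<in> V" "valley u m" by blast
      define d where "d = cap u (Suc u) m"
      have uV: "n - k \<le> u" "Suc u < 2 * n - k" "Suc u < 2 * n" using u(1) by (auto simp: V_def)
      have ne: "m u \<noteq> Suc u" using u(2) by (auto simp: valley_def)
      note cf = cap_in_fiber[OF step.hyps uV(3) ne, folded d_def]
      have cd: "centered n k d" using centered_cap[OF step.hyps u(2) uV(1,2) step.prems] by (simp add: d_def)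
      obtain P0 where P0: "?C d P0" using step.IH(1)[OF u] cd by (auto simp: d_def)
      have "\<forall>D\<in>fiber (2 * n) u (Suc u) d - {m}. \<exists>P. ?C D P"
        using step.IH(2)[OF u] centered_fiber[OF _ uV(1,2) cd] by (auto simp: d_def)
      then obtain P where P: "\<forall>D\<in>fiber (2 * n) u (Suc u) d - {m}. ?C D (P D)" by (rule bchoice[THEN exE])
      let ?S = "fiber (2 * n) u (Suc u) d - {m}"
      define x where "x = gap qvar c (u - (n - k))"
      have x: "specialize q x = gap q c (u - (n - k))" by (simp add: x_def specialize_two_at)
      have "?C m (x * P0 - (\<Sum>D\<in>?S. P D))"
      proof (intro conjI allI impI)
        fix f :: "(nat \<Rightarrow> nat) \<Rightarrow> 'a" assume f: "top_killed q c n f"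
        have "f (?r m) = gap q c (u - (n - k)) * f (?r d) - (\<Sum>D\<in>?S. f (?r D))"
          using defect_zero_solve[OF step.hyps uV(3) ne, folded d_def, of "gap q c (u - (n - k))" "f \<circ> ?r"]
             kill[OF u(1) cf(1,3) f] by simp
        also have "\<dots> = specialize q (x * P0 - (\<Sum>D\<in>?S. P D)) * f (nest n k)"
        proof -
          have "(\<Sum>D\<in>?S. f (?r D)) = specialize q (\<Sum>D\<in>?S. P D) * f (nest n k)"
            unfolding specialize_sum sum_distrib_right using P f by (intro sum.cong[OF refl]) blast
          moreover have "f (?r d) = specialize q P0 * f (nest n k)" using P0 f by blast
          ultimately show ?thesis unfolding x[symmetric] by (simp only: specialize_hom specialize_diff left_diff_distrib mult.assoc)
        qed
        finally show "f (?r m) = specialize q (x * P0 - (\<Sum>D\<in>?S. P D)) * f (nest n k)" .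
      next
        fix f :: "(nat \<Rightarrow> nat) \<Rightarrow> int poly poly" assume f: "top_killed qvar c n f"
        have "f (?r m) = x * f (?r d) - (\<Sum>D\<in>?S. f (?r D))"
          using defect_zero_solve[OF step.hyps uV(3) ne, folded d_def, of x "f \<circ> ?r"]
             kill[OF u(1) cf(1,3) f] by (simp add: x_def)
        also have "\<dots> = (x * P0 - (\<Sum>D\<in>?S. P D)) * f (nest n k)"
        proof -
          have "(\<Sum>D\<in>?S. f (?r D)) = (\<Sum>D\<in>?S. P D) * f (nest n k)"
            unfolding sum_distrib_right using P f by (intro sum.cong[OF refl]) blast
          moreover have "f (?r d) = P0 * f (nest n k)" using P0 f by blast
          ultimately show ?thesis by (simp only: left_diff_distrib mult.assoc)
        qed
        finally show "f (?r m) = (x * P0 - (\<Sum>D\<in>?S. P D)) * f (nest n k)" .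
      qed
      then show ?thesis by blast
    next
      case False
      have "n - k \<le> 2 * n - k" "2 * n - k \<le> 2 * n" by auto
      moreover have "\<not> valley u m" if "n - k \<le> u" "Suc u < 2 * n - k" for u using False that by (auto simp: V_def)
      ultimately obtain t where t: "n - k \<le> t" "t \<le> 2 * n - k" "openers m \<inter> {n - k..<2 * n - k} = {n - k..<t}"
        using valley_free_openers[OF step.hyps] by metis
      have "openers m = {..<t}"
      proof (rule Set.set_eqI)
        fix y show "y \<in> openers m \<longleftrightarrow> y \<in> {..<t}"
        proof (cases "y < n - k \<or> 2 * n - k \<le> y")
          case True
          then show ?thesis using step.prems openers_subset[OF step.hyps] t(1,2) unfolding centered_def by force
        next
          case False
          then have "y \<in> openers m \<longleftrightarrow> y \<in> openers m \<inter> {n - k..<2 * n - k}" by auto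
          then show ?thesis unfolding t(3) using False by auto
        qed
      qed
      then have "m = rainbow n" by (rule eq_rainbow[OF step.hyps])
      \<comment> \<open>The identity is invariant under a half turn, so only k of the n + k steps
        matter.\<close>
      then have "?r m = nest n k"
        using rot_pow_rainbow[OF k] rot_pow_rainbow[of n n] by (simp add: nest_rainbow funpow_add add.commute[of n k])
      then show ?thesis by (intro exI[of _ 1]) (simp add: specialize_hom)
    qed
  qed
qed

text \<open>No arc of \<open>D\<close> has both ends among the left n - k bottom points or both
  among the right k. Seen from the base point between these groups, the left group therefore
  consists of openers and the right group of closers.\<close>

lemma centered_of_bottom:
  assumes D: "nc_matching (2 * n) D" and k: "k \<le> n"
    and b: "\<And>y. n + k \<le> y \<Longrightarrow> y < 2 * n \<Longrightarrow> D y < n + k"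
      "\<And>y. n \<le> y \<Longrightarrow> y < n + k \<Longrightarrow> D y < n \<or> n + k \<le> D y"
  obtains m where "nc_matching (2 * n) m" "centered n k m" "(rot (2 * n) ^^ (n + k)) m = D"
proof -
  define m where "m = (rot (2 * n) ^^ (n - k)) D"
  have m: "nc_matching (2 * n) m" using nc_matching_rot_pow[OF D] by (simp add: m_def)
  have r: "(rot (2 * n) ^^ (n + k)) m = D"
  proof -
    have "(rot (2 * n) ^^ (n + k)) m = (rot (2 * n) ^^ (2 * n)) D"
    proof -
      have "2 * n = n + k + (n - k)" using k by simp
      then show ?thesis unfolding m_def by (metis funpow_add comp_apply)
    qed
    then show ?thesis using rot_full[OF D] by simp
  qed
  have at: "m ((y + (n - k)) mod (2 * n)) = (D y + (n - k)) mod (2 * n)" if "y < 2 * n" for y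
    using rot_pow_at[OF D that] by (simp add: m_def)
  have wrap: "(z + (n - k)) mod (2 * n) = (if z < n + k then z + (n - k) else z - (n + k))" if "z < 2 * n" for z
  proof (cases "z < n + k")
    case False
    then have "z + (n - k) = (z - (n + k)) + 2 * n" using k by simp
    then show ?thesis using False that by (simp only: mod_add_self2) simp
  qed (use k in simp)
  have "x < m x" if "x < n - k" for x
  proof -
    have "m x = (D (x + n + k) + (n - k)) mod (2 * n)" using at[of "x + n + k"] wrap[of "x + n + k"] that by simp
    moreover have "D (x + n + k) < n + k" using b(1)[of "x + n + k"] that by simp
    ultimately have "m x = D (x + n + k) + (n - k)" using wrap[of "D (x + n + k)"] k by simp
    then show ?thesis using that by simp
  qed
  moreover have "m x < x" if "2 * n - k \<le> x" "x < 2 * n" for x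
  proof -
    define y where "y = x - (n - k)"
    have y: "n \<le> y" "y < n + k" "y + (n - k) = x" using that k by (auto simp: y_def)
    have "m x = (D y + (n - k)) mod (2 * n)" using at[of y] wrap[of y] y k by simp
    moreover have "D y < 2 * n" using nc_matchingD(1)[OF D] y k by simp
    ultimately show ?thesis using b(2)[OF y(1,2)] wrap[of "D y"] y k by (auto split: if_splits)
  qed
  ultimately have "centered n k m" unfolding centered_def openers_def by force
  then show thesis using that m r by blast
qed

lemma bottom_coeff:
  fixes q :: "color \<Rightarrow> 'a::comm_ring_1"
  assumes D: "nc_matching (2 * n) D" and k: "k \<le> n"
    and b: "\<And>y. n + k \<le> y \<Longrightarrow> y < 2 * n \<Longrightarrow> D y < n + k"
      "\<And>y. n \<le> y \<Longrightarrow> y < n + k \<Longrightarrow> D y < n \<or> n + k \<le> D y"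
  obtains P where "\<And>f. top_killed q c n f \<Longrightarrow> f D = specialize q P * f (nest n k)"
    "\<And>f. top_killed qvar c n f \<Longrightarrow> f D = P * f (nest n k)"
proof -
  obtain m where m: "nc_matching (2 * n) m" "centered n k m" "(rot (2 * n) ^^ (n + k)) m = D"
    using centered_of_bottom[OF assms] by blast
  show thesis using centered_coeff[OF m(1,2) k, of q c] that unfolding m(3) by blast
qed

text \<open>The identity has no arcs on the bottom edge, so \<open>bottom_coeff\<close> applies to
  it for every k. The factor is found by inserting \<open>jwnum\<close>, whose coefficients are
  known and nonzero: P [k]! [n-k]! = [n]!.\<close>

lemma
  assumes "k \<le> n"
  shows qfact_qbinom: "qfact c n = qbinom c n k * (qfact c k * qfact c (n - k))"
    and rainbow_coeff: "top_killed q c n f \<Longrightarrow> f (rainbow n) = specialize q (qbinom c n k) * f (nest n k)"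
proof -
  have b: "n + k \<le> y \<Longrightarrow> y < 2 * n \<Longrightarrow> rainbow n y < n + k"
    "n \<le> y \<Longrightarrow> y < n + k \<Longrightarrow> rainbow n y < n \<or> n + k \<le> rainbow n y" for y
    using assms by (auto simp: rainbow_def)
  obtain P where P: "\<And>f. top_killed q c n f \<Longrightarrow> f (rainbow n) = specialize q P * f (nest n k)"
    "\<And>f. top_killed qvar c n f \<Longrightarrow> f (rainbow n) = P * f (nest n k)"
    using bottom_coeff[OF nc_matching_rainbow assms b, of q c] by blast
  have f: "qfact c n = P * (qfact c k * qfact c (n - k))"
    using P(2)[OF jwnum_killed(1)] jwnum_nest[OF assms, of c] jwnum_nest[of 0 n c]
    by (simp add: nest_rainbow qfact_0)
  then have "qbinom c n k = P" using qfact_neq_0 by (simp add: qbinom_def)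
  then show "qfact c n = qbinom c n k * (qfact c k * qfact c (n - k))"
    "top_killed q c n f \<Longrightarrow> f (rainbow n) = specialize q (qbinom c n k) * f (nest n k)"
    using f P(1) by simp_all
qed

text \<open>In the matchings whose closure at the right gap is the identity, an arc on the bottom
  edge can only involve the rightmost bottom point, so \<open>bottom_coeff\<close> with k = 1
  applies. Hence the partial trace is a universal multiple \<open>X\<close> of the coefficient at
  \<open>nest n 1\<close>, and \<open>X\<close> can be read off from the partial trace of
  \<open>jwnum\<close>.\<close>

lemma right_trace_rainbow:
  assumes "1 \<le> n" and f: "top_killed q c n f"
  shows "defect (2 * n) (gap q c (n - 1)) (n - 1) n f (rainbow n) = - specialize q (qnum c (n + 1)) * f (nest n 1)"
proof -
  let ?F = "fiber (2 * n) (n - 1) n (rainbow n)"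
  have "\<exists>P. (\<forall>f. top_killed q c n f \<longrightarrow> f D = specialize q P * f (nest n 1)) \<and>
       (\<forall>f. top_killed qvar c n f \<longrightarrow> f D = P * f (nest n 1))" if D: "D \<in> ?F" for D
  proof -
    note F = fiberD[OF D]
    have uv: "n - 1 < 2 * n" "n < 2 * n" "n - 1 \<noteq> n" using assms by auto
    have "D y < n + 1" if y: "n + 1 \<le> y" "y < 2 * n" for y
    proof (cases "y = D (n - 1) \<or> y = D n")
      case True
      then have "D y = n - 1 \<or> D y = n" using nc_matchingD(3)[OF F(1)[OF uv]] by auto
      then show ?thesis by auto
    next
      case False
      then have "rainbow n y = D y" using F(7)[OF uv, of y] y by auto
      then show ?thesis using y by (auto simp: rainbow_def)
    qed
    moreover have "D y < n \<or> n + 1 \<le> D y" if "n \<le> y" "y < n + 1" for y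
      using nc_matchingD(2)[OF F(1)[OF uv], of y] that assms by auto
    ultimately show ?thesis using bottom_coeff[OF F(1)[OF uv] assms(1), of q c] by metis
  qed
  then obtain P where P: "\<And>D f. D \<in> ?F \<Longrightarrow> top_killed q c n f \<Longrightarrow> f D = specialize q (P D) * f (nest n 1)"
    "\<And>D f. D \<in> ?F \<Longrightarrow> top_killed qvar c n f \<Longrightarrow> f D = P D * f (nest n 1)" by metis
  define X where "X = (\<Sum>D\<in>?F. P D) - gap qvar c (n - 1) * qbinom c n 1"
  have q1: "specialize q X * f (nest n 1) = defect (2 * n) (gap q c (n - 1)) (n - 1) n f (rainbow n)"
  proof -
    have "(\<Sum>D\<in>?F. f D) = specialize q (\<Sum>D\<in>?F. P D) * f (nest n 1)"
      unfolding specialize_sum sum_distrib_right using P(1)[OF _ f] by (rule sum.cong[OF refl])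
    then show ?thesis unfolding defect_def X_def rainbow_coeff[OF assms(1) f]
      by (simp add: specialize_hom specialize_diff specialize_two_at algebra_simps del: One_nat_def)
  qed
  obtain n' where n': "n = Suc n'" using assms by (cases n) auto
  have "jwnum c n (rainbow n) = qbinom c n 1 * jwnum c n (nest n 1)"
    using qfact_qbinom[OF assms(1), of c] jwnum_nest[OF assms(1), of c] jwnum_nest[of 0 n c]
    by (simp add: nest_rainbow qfact_0)
  then have "X * jwnum c n (nest n 1) = defect (2 * n) (gap qvar c (n - 1)) (n - 1) n (jwnum c n) (rainbow n)"
  proof -
    have s: "(\<Sum>D\<in>?F. jwnum c n D) = (\<Sum>D\<in>?F. P D) * jwnum c n (nest n 1)"
      unfolding sum_distrib_right using P(2)[OF _ jwnum_killed(1)] by (rule sum.cong[OF refl])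
    show ?thesis unfolding defect_def X_def s \<open>jwnum c n (rainbow n) = _\<close>
      by (simp add: algebra_simps del: One_nat_def)
  qed
  also have "\<dots> = - qnum c (Suc n) * jwnum c (n - 1) (rem (n - 1) (rainbow n))"
    using defect_jwnum[of n c] nc_matching_rainbow[of n] n' by (auto simp: rainbow_def)
  also have "rem (n - 1) (rainbow n) = rainbow (n - 1)"
    using rem_nest(2)[of n'] n' by (simp add: nest_rainbow)
  also have "jwnum c (n - 1) (rainbow (n - 1)) = jwnum c n (nest n 1)"
    using jwnum_nest[OF assms(1), of c] jwnum_nest[of 0 "n - 1" c] by (simp add: nest_rainbow qfact_0 qfact_Suc)
  finally have "X * jwnum c n (nest n 1) = - qnum c (n + 1) * jwnum c n (nest n 1)" by simp
  moreover have "jwnum c n (nest n 1) \<noteq> 0" using jwnum_nest[OF assms(1), of c] qfact_neq_0 by simp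
  ultimately have "X = - qnum c (n + 1)" using mult_right_cancel by blast
  then show ?thesis using q1 by (simp add: specialize_minus)
qed

text \<open>With the base point between the edges, eliminating the bottom valleys leads to matchings
  whose first k bottom points open and whose other bottom points close; these are handled by
  \<open>bottom_coeff\<close>. The form with \<open>a\<close> and \<open>b\<close> serves both for
  integrality, with a = [n]!, and for vanishing, with a = 0.\<close>

lemma killed_dvd:
  fixes q :: "color \<Rightarrow> 'a::comm_ring_1"
  assumes f: "top_killed q c n f" "bot_killed q c n f"
    and a: "\<And>k. k \<le> n \<Longrightarrow> a dvd b * f (nest n k)" and D: "nc_matching (2 * n) D"
  shows "a dvd b * f D"
  using D
proof (induction D rule: valley_induct[where V = "{u. n \<le> u \<and> Suc u < 2 * n}"])
  case (gaps u) then show ?case by simp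
next
  case (step D)
  show ?case
  proof (cases "\<exists>u. n \<le> u \<and> Suc u < 2 * n \<and> valley u D")
    case True
    then obtain u where u: "n \<le> u" "Suc u < 2 * n" "valley u D" by blast
    then have ne: "D u \<noteq> Suc u" by (auto simp: valley_def)
    define d where "d = cap u (Suc u) D"
    note cf = cap_in_fiber[OF step.hyps u(2) ne, folded d_def]
    have "defect (2 * n) (gap q c u) u (Suc u) f d = 0" using f(2) cf u(1) unfolding bot_killed_def by blast
    then have e: "f D = gap q c u * f d - (\<Sum>D'\<in>fiber (2 * n) u (Suc u) d - {D}. f D')"
      using defect_zero_solve[OF step.hyps u(2) ne, folded d_def] by blast
    have "a dvd b * f d" using step.IH(1)[of u] u by (simp add: d_def)
    moreover have "a dvd (\<Sum>D'\<in>fiber (2 * n) u (Suc u) d - {D}. b * f D')"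
      using step.IH(2)[of u] u by (intro dvd_sum) (auto simp: d_def)
    ultimately show ?thesis unfolding e
      by (simp add: right_diff_distrib sum_distrib_left[symmetric] mult.left_commute[of b] dvd_diff)
  next
    case False
    then obtain t where t: "n \<le> t" "t \<le> 2 * n" "openers D \<inter> {n..<2 * n} = {n..<t}"
      using valley_free_openers[OF step.hyps, of n "2 * n"] by (metis add_leD1 le_add1 mult_2 order_refl)
    define k where "k = t - n"
    have k: "k \<le> n" "t = n + k" using t by (auto simp: k_def)
    have inv: "D (D y) = y" "D y < 2 * n" if "y < 2 * n" for y
      using nc_matchingD(1,3)[OF step.hyps] that by auto
    have op: "y < D y \<longleftrightarrow> y < n + k" if "n \<le> y" "y < 2 * n" for y
      using that t(3) k by (auto simp: openers_def set_eq_iff)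
    have "D y < n + k" if y: "n + k \<le> y" "y < 2 * n" for y
      using op[of y] op[of "D y"] inv[of y] nc_matchingD(2)[OF step.hyps y(2)] y by (cases "n \<le> D y") auto
    moreover have "D y < n \<or> n + k \<le> D y" if y: "n \<le> y" "y < n + k" for y
      using op[of y] op[of "D y"] inv[of y] y k by (cases "n \<le> D y") auto
    ultimately obtain P where "f D = specialize q P * f (nest n k)"
      using bottom_coeff[OF step.hyps k(1), of q c] f(1) by metis
    then have "b * f D = specialize q P * (b * f (nest n k))" by (simp add: mult.left_commute)
    then show ?thesis using a[OF k(1)] by simp
  qed
qed


section \<open>Binomials at rotatable projectors\<close>

text \<open>Passing a strand, or rotating by one step, changes the leftmost color; this is the color
  after \<open>j\<close> such changes.\<close>

definition shift_color :: "color \<Rightarrow> nat \<Rightarrow> color" where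
  "shift_color c j = (if even j then c else other c)"

lemma other_other [simp]: "other (other c) = c"
  by (cases c) auto

lemma two_at_shift: "two_at q (shift_color c b) a = two_at q c (b + a)"
  by (auto simp: two_at_def shift_color_def)

lemma two_at_other: "two_at q (other c) a = two_at q c (Suc a)"
  by (simp add: two_at_def)

lemma qvar_neq_0: "qvar c \<noteq> 0"
  by (cases c) auto

lemma qnum_odd: "odd m \<Longrightarrow> qnum (other c) m = qnum c m"
  using qnum_other by blast

lemma qnum_even_swap:
  assumes "even a" "even b"
  shows "qnum (other c) a * qnum c b = qnum c a * qnum (other c) b"
proof -
  have a: "qvar c * qnum (other c) a = qvar (other c) * qnum c a"
    and b: "qvar c * qnum (other c) b = qvar (other c) * qnum c b"
    using qnum_other assms by blast+
  have "qvar c * (qnum (other c) a * qnum c b) = (qvar c * qnum (other c) a) * qnum c b" by (simp only: mult.assoc)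
  also have "\<dots> = qnum c a * (qvar (other c) * qnum c b)" unfolding a by (simp only: ac_simps)
  also have "\<dots> = qvar c * (qnum c a * qnum (other c) b)" unfolding b[symmetric] by (simp only: ac_simps)
  finally show ?thesis using qvar_neq_0 by (metis mult_left_cancel)
qed

text \<open>As functions of \<open>a\<close>, both sides satisfy the same three-term recursion with
  the same alternating factor.\<close>

lemma qnum_add:
  "qnum c (b + a + 1) = qnum c (b + 1) * qnum (shift_color c b) (a + 1) - qnum c b * qnum (shift_color c (b + 1)) a"
proof (induction a rule: induct_nat_012)
  case 0 show ?case by simp
next
  case 1
  show ?case using qnum_Suc[of "b + 1" c] by (simp add: two_at_def shift_color_def algebra_simps)
next
  case (ge2 a)
  have l: "qnum c (b + Suc (Suc a) + 1) = two_at qvar c (b + a + 2) * qnum c (b + Suc a + 1) - qnum c (b + a + 1)"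
    using qnum_Suc[of "b + a + 2" c] by (simp del: qnum.simps)
  have r1: "qnum (shift_color c b) (Suc (Suc a) + 1) = two_at qvar c (b + a + 2) * qnum (shift_color c b) (Suc a + 1) - qnum (shift_color c b) (a + 1)"
    using qnum_Suc[of "a + 2" "shift_color c b"] two_at_shift[of qvar c b "a + 2"] by (simp del: qnum.simps)
  have r2: "qnum (shift_color c (b + 1)) (Suc (Suc a)) = two_at qvar c (b + a + 2) * qnum (shift_color c (b + 1)) (Suc a) - qnum (shift_color c (b + 1)) a"
    using qnum_Suc[of "a + 1" "shift_color c (b + 1)"] two_at_shift[of qvar c "b + 1" "a + 1"] by (simp del: qnum.simps)
  show ?case unfolding l r1 r2 ge2 by (simp add: algebra_simps del: qnum.simps)
qed

text \<open>Modulo [n + 1] this says [n - k] = [n] [k + 1], up to colors. In particular, k = n - 1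
  shows that [n] is invertible modulo [n + 1].\<close>

lemma qnum_reflect:
  "k \<le> n \<Longrightarrow> qnum (shift_color c (k + 1)) (n - k)
     = qnum (other c) n * qnum c (k + 1) - qnum c (n + 1) * qnum (other c) k"
proof (induction k rule: induct_nat_012)
  case 0 show ?case by (simp add: shift_color_def)
next
  case 1
  then obtain m where "n = Suc m" by (cases n) auto
  then show ?case by (simp add: shift_color_def algebra_simps)
next
  case (ge2 k)
  then obtain m where n: "n = m + k + 2" by (metis le_add_diff_inverse2 add.commute add_2_eq_Suc' add.assoc)
  have s: "shift_color c (Suc (Suc k) + 1) = shift_color c (k + 1)" "other (shift_color c (k + 1)) = shift_color c (Suc k + 1)"
    by (auto simp: shift_color_def)
  have l: "qnum (shift_color c (k + 1)) m = qvar (shift_color c (k + 1)) * qnum (shift_color c (Suc k + 1)) (Suc m)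
     - qnum (shift_color c (k + 1)) (Suc (Suc m))" using s by simp
  have x: "two_at qvar c (k + 2) = qvar (shift_color c (k + 1))" "two_at qvar (other c) (k + 1) = qvar (shift_color c (k + 1))"
    by (auto simp: two_at_def shift_color_def)
  have r1: "qnum c (Suc (Suc k) + 1) = qvar (shift_color c (k + 1)) * qnum c (Suc k + 1) - qnum c (k + 1)"
    using qnum_Suc[of "k + 2" c] x by (simp del: qnum.simps)
  have r2: "qnum (other c) (Suc (Suc k)) = qvar (shift_color c (k + 1)) * qnum (other c) (Suc k) - qnum (other c) k"
    using qnum_Suc[of "k + 1" "other c"] x by (simp del: qnum.simps)
  have d: "n - Suc (Suc k) = m" "n - Suc k = Suc m" "n - k = Suc (Suc m)" using n by auto
  have i1: "qnum (shift_color c (k + 1)) (Suc (Suc m)) = qnum (other c) n * qnum c (k + 1) - qnum c (n + 1) * qnum (other c) k"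
    using ge2.IH(1) ge2.prems d by simp
  have i2: "qnum (shift_color c (Suc k + 1)) (Suc m) = qnum (other c) n * qnum c (Suc k + 1) - qnum c (n + 1) * qnum (other c) (Suc k)"
    using ge2.IH(2) ge2.prems d by simp
  show ?case unfolding s d r1 r2 l i1 i2 by (simp add: algebra_simps del: qnum.simps)
qed

lemma qbinom_0: "qbinom c n 0 = 1"
  using qfact_qbinom[of 0 n c] qfact_neq_0[of c n] by (simp add: qfact_0)

lemma qbinom_1: "1 \<le> n \<Longrightarrow> qbinom c n 1 = qnum c n"
proof -
  assume n: "1 \<le> n"
  then obtain m where m: "n = Suc m" by (cases n) auto
  have "qfact c n = qbinom c n 1 * qfact c m" using qfact_qbinom[OF n, of c] m qfact_Suc[of c 0] by (simp add: qfact_0)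
  then show ?thesis using qfact_neq_0[of c m] unfolding m qfact_Suc by (simp add: mult.commute)
qed

text \<open>With the common denominator \<open>X\<close>, the three binomials of Pascal's rule
  become [n]! times one quantum number each. Identities between them thus reduce to identities of
  quantum numbers.\<close>

lemma qbinom_scaled:
  fixes c :: color
  assumes "1 \<le> k" "k \<le> n"
  defines "X \<equiv> qfact c k * qfact c (n + 1 - k)"
  shows "X * qbinom c n k = qfact c n * qnum c (n + 1 - k)"
    and "X * qbinom c n (k - 1) = qfact c n * qnum c k"
    and "X * qbinom c (n + 1) k = qfact c n * qnum c (n + 1)"
    and "X \<noteq> 0"
proof -
  have e: "n + 1 - k = Suc (n - k)" "k = Suc (k - 1)" "n - (k - 1) = Suc (n - k)" using assms by auto
  have f: "qfact c (n + 1 - k) = qfact c (n - k) * qnum c (n + 1 - k)" unfolding e(1) by (rule qfact_Suc)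
  have g: "qfact c k = qfact c (k - 1) * qnum c k" using qfact_Suc[of c "k - 1"] e(2) by simp
  show "X * qbinom c n k = qfact c n * qnum c (n + 1 - k)"
    using qfact_qbinom[OF assms(2), of c] unfolding X_def f by (simp only: ac_simps)
  have "qfact c n = qbinom c n (k - 1) * (qfact c (k - 1) * qfact c (n + 1 - k))"
    using qfact_qbinom[of "k - 1" n c] assms(2) unfolding e(3) e(1) by simp
  then show "X * qbinom c n (k - 1) = qfact c n * qnum c k"
    unfolding X_def g by (simp only: ac_simps)
  have "qfact c (n + 1) = qbinom c (n + 1) k * (qfact c k * qfact c (n + 1 - k))"
    using qfact_qbinom[of k "n + 1" c] assms(2) by simp
  then show "X * qbinom c (n + 1) k = qfact c n * qnum c (n + 1)"
    using qfact_Suc[of c n] unfolding X_def by (simp add: ac_simps del: qnum.simps)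
  show "X \<noteq> 0" using qfact_neq_0 by (simp add: X_def)
qed

text \<open>By reflection, [n + 1 - k] and [n] [k] differ by a multiple of [n + 1]. After scaling by
  \<open>X\<close> this is the claim, which later carries invertibility from one binomial of n to
  the next.\<close>

lemma qbinom_step_dvd:
  assumes k: "1 \<le> k" "k \<le> n"
  shows "qbinom c (n + 1) k dvd qbinom c n k - qnum (shift_color c (k + 1)) n * qbinom c n (k - 1)"
proof -
  have "\<exists>Y. qnum c (n + 1 - k) = qnum (shift_color c (k + 1)) n * qnum c k + Y * qnum c (n + 1)"
  proof (cases "even k")
    case True
    have "qnum c (n + 1 - k) = qnum (other c) n * qnum c k - qnum c (n + 1) * qnum (other c) (k - 1)"
      using qnum_reflect[of "k - 1" n c] k True by (simp add: shift_color_def Suc_diff_le)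
    then show ?thesis using True by (intro exI[of _ "- qnum (other c) (k - 1)"]) (simp add: shift_color_def)
  next
    case False
    have "qnum c (n + 1 - k) = qnum c n * qnum c k - qnum (other c) (n + 1) * qnum c (k - 1)"
      using qnum_reflect[of "k - 1" n "other c"] k False qnum_odd[of k c] by (simp add: shift_color_def Suc_diff_le del: qnum.simps)
    \<comment> \<open>For odd k, reflection yields [n + 1] in the wrong color. If n + 1 is odd, the
      color is irrelevant; if it is even, the color can be exchanged with that of the other even
      factor [k - 1].\<close>
    moreover have "\<exists>Y. qnum (other c) (n + 1) * qnum c (k - 1) = Y * qnum c (n + 1)"
    proof (cases "even (n + 1)")
      case True
      then show ?thesis using qnum_even_swap[of "n + 1" "k - 1" c] False k by (auto simp: mult.commute)
    next
      case odd: False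
      then show ?thesis using qnum_odd[of "n + 1" c] by (metis mult.commute)
    qed
    then obtain Y where "qnum (other c) (n + 1) * qnum c (k - 1) = Y * qnum c (n + 1)" by blast
    ultimately show ?thesis using False by (intro exI[of _ "- Y"]) (simp add: shift_color_def del: qnum.simps)
  qed
  then obtain Y where Y: "qnum c (n + 1 - k) = qnum (shift_color c (k + 1)) n * qnum c k + Y * qnum c (n + 1)" by blast
  define X where "X = qfact c k * qfact c (n + 1 - k)"
  note S = qbinom_scaled[OF k, of c, folded X_def]
  have "X * (qbinom c n k - qnum (shift_color c (k + 1)) n * qbinom c n (k - 1)) =
     X * qbinom c n k - qnum (shift_color c (k + 1)) n * (X * qbinom c n (k - 1))"
    by (simp add: algebra_simps del: qnum.simps)
  also have "\<dots> = Y * (X * qbinom c (n + 1) k)" unfolding S(1-3) Y by (simp add: algebra_simps del: qnum.simps)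
  finally have "X * (qbinom c n k - qnum (shift_color c (k + 1)) n * qbinom c n (k - 1)) = X * (Y * qbinom c (n + 1) k)"
    by (simp only: ac_simps)
  then have "qbinom c n k - qnum (shift_color c (k + 1)) n * qbinom c n (k - 1) = Y * qbinom c (n + 1) k"
    using S(4) mult_left_cancel by blast
  then show ?thesis by simp
qed

text \<open>Pascal's rule [n+1 choose k] = [k+1] [n choose k] - [n-k] [n choose k-1], with [n-k]
  replaced by [n] [k+1] at the cost of a multiple of [n + 1]. In this form the right side vanishes
  if [n + 1] = 0 and consecutive binomials of n differ by the factor [n].\<close>

lemma qbinom_pascal:
  assumes k: "1 \<le> k" "k \<le> n"
  obtains Y where "qbinom c (n + 1) k = qnum (shift_color c (n - k)) (k + 1) *
      (qbinom c n k - qnum (shift_color c (k + 1)) n * qbinom c n (k - 1)) + Y * qnum c (n + 1)"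
proof -
  let ?w = "shift_color c (n - k)" and ?y = "shift_color c (k + 1)"
  have add: "qnum c (n + 1) = qnum c (n + 1 - k) * qnum ?w (k + 1) - qnum c (n - k) * qnum (shift_color c (n - k + 1)) k"
    using qnum_add[of c "n - k" k] k by (simp add: Suc_diff_le)
  \<comment> \<open>Color bookkeeping: odd numbers ignore the color, and in a product of two even
    ones the colors may be exchanged.\<close>
  have sw: "qnum c (n - k) * qnum (shift_color c (n - k + 1)) k = qnum ?y (n - k) * qnum c k"
  proof (cases "even (n - k)")
    case True
    then show ?thesis using qnum_even_swap[of "n - k" k c] qnum_odd[of k c] by (cases "even k") (simp_all add: shift_color_def)
  next
    case False
    then show ?thesis using qnum_odd[of "n - k" c] by (auto simp: shift_color_def)
  qed
  have rfl: "qnum ?y (n - k) = qnum (other c) n * qnum c (k + 1) - qnum c (n + 1) * qnum (other c) k"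
    by (rule qnum_reflect[OF k(2)])
  have z: "qnum (other c) n * qnum c (k + 1) = qnum ?w (k + 1) * qnum ?y n"
  proof (cases "even k")
    case True
    then show ?thesis using qnum_odd[of "k + 1" c] by (auto simp: shift_color_def simp del: qnum.simps)
  next
    case False
    show ?thesis
    proof (cases "even n")
      case True
      then show ?thesis using False k qnum_even_swap[of n "k + 1" c] by (simp add: shift_color_def mult.commute del: qnum.simps)
    next
      case nodd: False
      then show ?thesis using False k qnum_odd[of n c] by (simp add: shift_color_def mult.commute del: qnum.simps)
    qed
  qed
  define X where "X = qfact c k * qfact c (n + 1 - k)"
  define Y where "Y = qnum (other c) k * qbinom c n (k - 1)"
  note S = qbinom_scaled[OF k, of c, folded X_def]
  have "X * (qnum ?w (k + 1) * (qbinom c n k - qnum ?y n * qbinom c n (k - 1)) + Y * qnum c (n + 1))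
     = qnum ?w (k + 1) * (X * qbinom c n k) - qnum ?w (k + 1) * qnum ?y n * (X * qbinom c n (k - 1))
        + qnum (other c) k * qnum c (n + 1) * (X * qbinom c n (k - 1))"
    unfolding Y_def by (simp add: algebra_simps del: qnum.simps)
  also have "\<dots> = qfact c n * (qnum c (n + 1 - k) * qnum ?w (k + 1)
       - (qnum ?w (k + 1) * qnum ?y n - qnum c (n + 1) * qnum (other c) k) * qnum c k)"
    unfolding S(1-3) by (simp add: algebra_simps del: qnum.simps)
  also have "\<dots> = qfact c n * qnum c (n + 1)" unfolding z[symmetric] rfl[symmetric] sw[symmetric] add[symmetric] by (rule refl)
  also have "\<dots> = X * qbinom c (n + 1) k" using S(3) by simp
  finally show thesis using that[of Y] S(4) mult_left_cancel by metis
qed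

lemma defect_cong:
  assumes "nc_matching N d" "\<And>m. nc_matching N m \<Longrightarrow> f m = a * g m"
  shows "defect N x u v f d = a * defect N x u v g d"
proof -
  have "(\<Sum>D\<in>fiber N u v d. f D) = a * (\<Sum>D\<in>fiber N u v d. g D)"
    unfolding sum_distrib_left using assms(2) by (intro sum.cong) (auto simp: fiber_def)
  then show ?thesis using assms by (simp add: defect_def algebra_simps)
qed

text \<open>Following the identity through its rotations, v c (nest n k) is a product of k rotation
  factors of alternating color, and \<open>lam c\<close> is the inverse of [n]. So consecutive
  binomials of n differ by the factor [n], and \<open>qbinom_pascal\<close> leaves only [n + 1] = 0
  to be shown.\<close>

lemma qbinom_zero_of_rotatable:
  fixes q :: "color \<Rightarrow> 'a::comm_ring_1"
  assumes n: "2 \<le> n" and kill: "\<And>c. top_killed q c n (v c)" and one: "\<And>c. v c (rainbow n) = 1"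
    and rotv: "\<And>c m. nc_matching (2 * n) m \<Longrightarrow> v c (rot (2 * n) m) = lam c * v (other c) m"
    and k: "1 \<le> k" "k \<le> n"
  shows "specialize q (qbinom c (n + 1) k) = 0"
proof -
  have b: "specialize q (qbinom c n k) * v c (nest n k) = 1" if "k \<le> n" for c k
    using rainbow_coeff[OF that kill[of c]] one by simp
  have f: "v c (nest n (Suc k)) = lam c * v (other c) (nest n k)" if "k < n" for c k
    using rotv[OF nc_matching_nest[of k n], of c] rot_nest[OF that] that by simp
  have f1: "v c (nest n 1) = lam c" for c using f[of 0 c] one n by (simp add: nest_rainbow)
  have unit: "specialize q (qnum c n) * lam c = 1" for c
    using b[of 1 c] f1 n qbinom_1[of n c] by simp
  have f2: "v c (nest n (Suc k)) = lam (shift_color c k) * v c (nest n k)" if "k < n" for c k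
    using that
  proof (induction k arbitrary: c)
    case 0 then show ?case using f1[of c] one by (simp add: nest_rainbow shift_color_def)
  next
    case (Suc k)
    have "v c (nest n (Suc (Suc k))) = lam c * (lam (shift_color (other c) k) * v (other c) (nest n k))"
      using f[OF Suc.prems, of c] Suc.IH[of "other c"] Suc.prems by simp
    also have "\<dots> = lam (shift_color c (Suc k)) * v c (nest n (Suc k))"
      using f[of k c] Suc.prems by (simp add: shift_color_def)
    finally show ?case .
  qed
  have bstep: "specialize q (qbinom c n k) = specialize q (qnum (shift_color c (k + 1)) n) * specialize q (qbinom c n (k - 1))"
  proof -
    let ?y = "shift_color c (k + 1)"
    obtain j where j: "k = Suc j" using k by (cases k) auto
    have y: "shift_color c j = ?y" by (simp add: j shift_color_def)
    have "specialize q (qbinom c n k) = specialize q (qbinom c n k) * (specialize q (qbinom c n (k - 1)) * v c (nest n j)) * (specialize q (qnum ?y n) * lam ?y)"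
      using b[of j c] unit[of ?y] k j by simp
    also have "\<dots> = (specialize q (qbinom c n k) * (lam ?y * v c (nest n j))) * specialize q (qnum ?y n) * specialize q (qbinom c n (k - 1))"
      by (simp only: ac_simps)
    also have "lam ?y * v c (nest n j) = v c (nest n k)" using f2[of j c] k j y by simp
    finally show ?thesis using b[OF k(2), of c] by simp
  qed
  \<comment> \<open>The right gap of one projector is the rotated last top gap of the other, where
    capping gives 0; such a top gap exists because n is at least 2. At the identity the partial
    trace is also - [n + 1] times the invertible \<open>lam c\<close>.\<close>
  have zero: "specialize q (qnum c (n + 1)) = 0"
  proof -
    obtain n' where n': "n = Suc (Suc n')" using n that[of "n - 2"] by simp
    let ?d = "nest n (Suc n')"
    have d: "nc_matching (2 * n) ?d" by (rule nc_matching_nest) (use n' in simp)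
    have rd: "rot (2 * n) ?d = rainbow n" using rot_nest[of "Suc n'" n] n' by (simp add: nest_rainbow)
    have "defect (2 * n) (gap q c (n - 1)) (Suc n' mod (2 * n)) (Suc (Suc n') mod (2 * n)) (v c) (rot (2 * n) ?d)
       = defect (2 * n) (gap q c (n - 1)) n' (Suc n') (v c \<circ> rot (2 * n)) ?d"
      by (rule defect_rot[OF d]) (use n' in auto)
    also have "\<dots> = lam c * defect (2 * n) (gap q c (n - 1)) n' (Suc n') (v (other c)) ?d"
      by (rule defect_cong[OF d]) (simp add: rotv)
    also have "gap q c (n - 1) = gap q (other c) n'" unfolding two_at_other using n' by simp
    also have "defect (2 * n) (gap q (other c) n') n' (Suc n') (v (other c)) ?d = 0"
      using kill[of "other c"] d n' unfolding top_killed_def by (auto simp: nest_def)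
    finally have "defect (2 * n) (gap q (other c) n') (Suc n' mod (2 * n)) (Suc (Suc n') mod (2 * n)) (v c) (rainbow n) = 0"
      by (simp add: rd)
    moreover have "Suc n' mod (2 * n) = n - 1" "Suc (Suc n') mod (2 * n) = n" using n' by auto
    moreover have "gap q (other c) n' = gap q c (n - 1)" unfolding two_at_other using n' by simp
    ultimately have "specialize q (qnum c (n + 1)) * lam c = 0"
      using right_trace_rainbow[OF _ kill[of c]] n f1[of c] by simp
    then have "specialize q (qnum c (n + 1)) * (specialize q (qnum c n) * lam c) = 0" by (metis mult.left_commute mult_zero_right)
    then show ?thesis using unit by simp
  qed
  obtain Y where "qbinom c (n + 1) k = qnum (shift_color c (n - k)) (k + 1) *
      (qbinom c n k - qnum (shift_color c (k + 1)) n * qbinom c n (k - 1)) + Y * qnum c (n + 1)"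
    using qbinom_pascal[OF k] by blast
  then show ?thesis by (simp only: specialize_hom specialize_diff bstep zero diff_self mult_zero_right add_0_right)
qed


section \<open>Construction of rotatable projectors\<close>

lemma qnum_unit:
  assumes "1 \<le> n" and z: "specialize q (qnum c (n + 1)) = 0"
  shows "specialize q (qnum c n) * specialize q (qnum (other c) n) = 1"
proof -
  have "n - (n - 1) = Suc 0" "n - 1 + 1 = n" "n - 1 \<le> n" using assms by auto
  then have "1 = qnum (other c) n * qnum c n - qnum c (n + 1) * qnum (other c) (n - 1)"
    using qnum_reflect[of "n - 1" n c] by (simp del: qnum.simps(3))
  then have "specialize q 1 = specialize q (qnum (other c) n * qnum c n - qnum c (n + 1) * qnum (other c) (n - 1))"
    by simp
  then show ?thesis using z by (simp only: specialize_hom specialize_diff mult_zero_left diff_zero mult.commute)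
qed

text \<open>When the binomials of n + 1 vanish, each step in k multiplies the binomial of n by [n],
  whose inverse is [n] in the other color.\<close>

lemma qbinom_unit:
  fixes q :: "color \<Rightarrow> 'a::comm_ring_1"
  assumes z: "\<And>c k. 1 \<le> k \<Longrightarrow> k \<le> n \<Longrightarrow> specialize q (qbinom c (n + 1) k) = 0" and "k \<le> n"
  shows "specialize q (qbinom c n k) dvd 1"
  using \<open>k \<le> n\<close>
proof (induction k)
  case 0 then show ?case by (simp add: qbinom_0 specialize_hom)
next
  case (Suc k)
  have u: "specialize q (qnum c n) dvd 1" for c
  proof -
    have "1 \<le> n" using Suc.prems by simp
    moreover have "specialize q (qnum c (n + 1)) = 0" using z[of 1 c] \<open>1 \<le> n\<close> qbinom_1[of "n + 1" c] by simp
    ultimately have "specialize q (qnum c n) * specialize q (qnum (other c) n) = 1" by (rule qnum_unit)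
    then show ?thesis by (metis dvd_triv_left)
  qed
  obtain Y where "qbinom c n (Suc k) - qnum (shift_color c (Suc k + 1)) n * qbinom c n k = qbinom c (n + 1) (Suc k) * Y"
    using qbinom_step_dvd[of "Suc k" n c] Suc.prems by (auto elim: dvdE)
  then have "specialize q (qbinom c n (Suc k) - qnum (shift_color c (Suc k + 1)) n * qbinom c n k) = 0"
    using z[of "Suc k" c] Suc.prems by (simp add: specialize_hom)
  then have "specialize q (qbinom c n (Suc k)) = specialize q (qnum (shift_color c (Suc k + 1)) n) * specialize q (qbinom c n k)"
    by (simp add: specialize_diff specialize_hom)
  moreover have "specialize q (qnum (shift_color c (Suc k + 1)) n) * specialize q (qbinom c n k) dvd 1 * 1"
    using u Suc by (intro mult_dvd_mono) auto
  ultimately show ?case by simp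
qed

lemma defect_diff: "defect N x u v (\<lambda>m. f m - g m) d = defect N x u v f d - defect N x u v g d"
  by (simp add: defect_def sum_subtractf algebra_simps)

lemma defect_mult: "defect N x u v (\<lambda>m. a * f m) d = a * defect N x u v f d"
  by (simp add: defect_def sum_distrib_left algebra_simps)

lemma defect_specialize:
  "defect N (specialize q x) u v (\<lambda>m. specialize q (f m)) d = specialize q (defect N x u v f d)"
  by (simp add: defect_def specialize_sum specialize_diff specialize_hom)

text \<open>The difference vanishes at the identity, hence at every \<open>nest n k\<close> because
  the binomials are units, hence everywhere by \<open>killed_dvd\<close> with divisor 0.\<close>

lemma killed_unique:
  fixes q :: "color \<Rightarrow> 'a::comm_ring_1"
  assumes unit: "\<And>k. k \<le> n \<Longrightarrow> specialize q (qbinom c n k) dvd 1"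
    and f: "top_killed q c n f" "bot_killed q c n f" and g: "top_killed q c n g" "bot_killed q c n g"
    and r: "f (rainbow n) = a * g (rainbow n)" and d: "nc_matching (2 * n) d"
  shows "f d = a * g d"
proof -
  define h where "h = (\<lambda>m. f m - a * g m)"
  have dh: "defect N x u v h d = defect N x u v f d - a * defect N x u v g d" for N x u v d
    by (simp add: h_def defect_diff defect_mult)
  have h: "top_killed q c n h" "bot_killed q c n h"
    using f g unfolding top_killed_def bot_killed_def dh by auto
  have "0 dvd 1 * h d"
  proof (rule killed_dvd[OF h _ d])
    fix k assume k: "k \<le> n"
    obtain u where u: "1 = specialize q (qbinom c n k) * u" using unit[OF k] by (rule dvdE)
    have "specialize q (qbinom c n k) * h (nest n k) = 0" using rainbow_coeff[OF k h(1)] r by (simp add: h_def)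
    then have "h (nest n k) = 0" by (metis mult.assoc mult.commute mult_1 mult_zero_left u)
    then show "0 dvd 1 * h (nest n k)" by simp
  qed
  then show ?thesis by (simp add: h_def)
qed

text \<open>\<open>A\<close> is \<open>Q\<close> times the generic projector. The product
  \<open>Q\<close> clears the denominators, as [n]! = [n choose k] [k]! [n-k]! divides Q [k]! [n-k]!
  for each k. It is also harmless, since it specializes to a unit wherever the binomials of n
  do.\<close>

lemma integral_projector:
  obtains Q and A :: "(nat \<Rightarrow> nat) \<Rightarrow> int poly poly" where
    "Q = (\<Prod>k\<le>n. qbinom c n k)" "\<And>d. nc_matching (2 * n) d \<Longrightarrow> qfact c n * A d = Q * jwnum c n d"
    "top_killed qvar c n A" "bot_killed qvar c n A" "A (rainbow n) = Q"
proof -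
  define Q where "Q = (\<Prod>k\<le>n. qbinom c n k)"
  define A where "A = (\<lambda>d. Q * jwnum c n d div qfact c n)"
  have A: "qfact c n * A d = Q * jwnum c n d" if "nc_matching (2 * n) d" for d
  proof -
    have "qfact c n dvd Q * jwnum c n d"
    proof (rule killed_dvd[OF jwnum_killed _ that])
      fix k assume k: "k \<le> n"
      then have "qbinom c n k dvd Q" unfolding Q_def by (intro dvd_prodI) auto
      then show "qfact c n dvd Q * jwnum c n (nest n k)"
        unfolding jwnum_nest[OF k] by (subst qfact_qbinom[OF k]) (rule mult_dvd_mono, simp_all)
    qed
    then show ?thesis by (simp add: A_def)
  qed
  have dA: "qfact c n * defect (2 * n) x u v A d = Q * defect (2 * n) x u v (jwnum c n) d" if "nc_matching (2 * n) d" for x u v d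
    using defect_cong[OF that, of "\<lambda>m. qfact c n * A m" Q "jwnum c n" x u v] A by (simp add: defect_mult)
  have "top_killed qvar c n A" "bot_killed qvar c n A"
    using jwnum_killed[of c n] dA qfact_neq_0[of c n] unfolding top_killed_def bot_killed_def
    by (metis mult_eq_0_iff)+
  moreover have "A (rainbow n) = Q"
    using A[OF nc_matching_rainbow] jwnum_nest[of 0 n c] qfact_neq_0[of c n] by (simp add: nest_rainbow qfact_0)
  ultimately show thesis using that Q_def A by blast
qed

text \<open>The partial trace of the projector has the coefficients [n+1] [k]! [n-1-k]! / [n]! at
  \<open>nest (n - 1) k\<close>, up to sign. Two binomials of n, which specialize to units, turn
  this into a binomial of n + 1.\<close>

lemma qbinom_trace:
  assumes "k < n"
  shows "qnum c (n + 1) * (qfact c k * qfact c (n - 1 - k)) * (qbinom c n k * qbinom c n (k + 1))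
    = qfact c n * qbinom c (n + 1) (k + 1)"
proof -
  have k: "1 \<le> k + 1" "k + 1 \<le> n" "n - k = Suc (n - 1 - k)" using assms by auto
  have f: "qfact c (n - k) = qfact c (n - 1 - k) * qnum c (n - k)" unfolding k(3) by (rule qfact_Suc)
  define X where "X = qfact c (k + 1) * qfact c (n + 1 - (k + 1))"
  have e: "n + 1 - (k + 1) = n - k" by simp
  note S = qbinom_scaled[OF k(1,2), of c, folded X_def, unfolded e]
  have q: "qfact c k * qfact c (n - k) * qbinom c n k = qfact c n"
    using qfact_qbinom[of k n c] assms by (simp add: ac_simps)
  have "(X * qnum c (n - k)) * (qnum c (n + 1) * (qfact c k * qfact c (n - 1 - k)) * (qbinom c n k * qbinom c n (k + 1)))
    = qnum c (n + 1) * (qfact c k * (qfact c (n - 1 - k) * qnum c (n - k)) * qbinom c n k) * (X * qbinom c n (k + 1))"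
    by (simp only: ac_simps)
  also have "\<dots> = qnum c (n + 1) * qfact c n * (qfact c n * qnum c (n - k))"
    unfolding f[symmetric] q S(1) ..
  also have "\<dots> = (X * qnum c (n - k)) * (qfact c n * qbinom c (n + 1) (k + 1))"
  proof -
    have "qnum c (n + 1) * qfact c n * (qfact c n * qnum c (n - k))
       = (qfact c n * qnum c (n + 1)) * (qfact c n * qnum c (n - k))" by (simp only: ac_simps)
    also have "\<dots> = (X * qbinom c (n + 1) (k + 1)) * (qfact c n * qnum c (n - k))" unfolding S(3) ..
    finally show ?thesis by (simp only: ac_simps)
  qed
  finally show ?thesis using S(4) qnum_neq_0[of "n - k" c] assms by simp
qed

lemma rotatable_of_qbinom_zero:
  fixes q :: "color \<Rightarrow> 'a::comm_ring_1"
  assumes n: "1 \<le> n" and z: "\<And>c k. 1 \<le> k \<Longrightarrow> k \<le> n \<Longrightarrow> specialize q (qbinom c (n + 1) k) = 0"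
  obtains v :: "color \<Rightarrow> (nat \<Rightarrow> nat) \<Rightarrow> 'a" and lam where
    "\<And>c. top_killed q c n (v c)" "\<And>c. v c (rainbow n) = 1"
    "\<And>c m. nc_matching (2 * n) m \<Longrightarrow> v c (rot (2 * n) m) = lam c * v (other c) m"
    "\<And>c m. nc_matching (2 * n) m \<Longrightarrow> v c m = lam c * v (other c) (rot (2 * n) m)"
proof -
  note unit = qbinom_unit[OF z]
  have z1: "specialize q (qnum c (n + 1)) = 0" for c using z[of 1 c] n qbinom_1[of "n + 1" c] by simp
  have "\<exists>f. top_killed q c n f \<and> bot_killed q c n f \<and> f (rainbow n) = 1 \<and>
    (\<forall>d. nc_matching (2 * n) d \<and> d (n - 1) = n \<longrightarrow> defect (2 * n) (gap q c (n - 1)) (n - 1) n f d = 0)" for c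
  proof -
    obtain Q A where AQ: "Q = (\<Prod>k\<le>n. qbinom c n k)" "\<And>d. nc_matching (2 * n) d \<Longrightarrow> qfact c n * A d = Q * jwnum c n d"
      "top_killed qvar c n A" "bot_killed qvar c n A" "A (rainbow n) = Q"
      by (rule integral_projector[of c n]) (rule that; assumption)
    have "specialize q Q dvd 1" unfolding AQ(1) specialize_prod
    proof -
      have "(\<Prod>k\<in>{..n}. specialize q (qbinom c n k)) dvd (\<Prod>k\<in>{..n}. 1)"
        by (rule prod_dvd_prod) (use unit in auto)
      then show "(\<Prod>k\<le>n. specialize q (qbinom c n k)) dvd 1" by simp
    qed
    then obtain u where u: "1 = specialize q Q * u" by (rule dvdE)
    define f where "f = (\<lambda>d. u * specialize q (A d))"
    have df: "defect N (gap q c p) x y f d = u * specialize q (defect N (gap qvar c p) x y A d)" for N p x y d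
      unfolding f_def defect_mult using defect_specialize[of N q "gap qvar c p" x y A d] by (simp add: specialize_two_at)
    have f: "top_killed q c n f" "bot_killed q c n f"
      using AQ(3,4) unfolding top_killed_def bot_killed_def df by (auto simp: specialize_hom)
    have f1: "f (rainbow n) = 1" using u AQ(5) by (simp add: f_def mult.commute)
    obtain n' where n': "n = Suc n'" using n by (cases n) auto
    \<comment> \<open>The right partial trace of \<open>A\<close>, as a vector on n - 1 strands. It
      is proportional to \<open>jwnum\<close> over the generic ring, so it is annihilated at both
      edges and its vanishing can be checked at the \<open>nest n' k\<close>.\<close>
    define T where "T = (\<lambda>m. defect (2 * n) (gap qvar c n') n' (Suc n') A (ins n' m))"
    have T: "qfact c n * T m = (- Q * qnum c (n + 1)) * jwnum c n' m" if m: "nc_matching (2 * n') m" for m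
    proof -
      have im: "nc_matching (2 * n) (ins n' m)" using nc_matching_ins[OF m, of n'] n' by simp
      have "qfact c n * T m = Q * defect (2 * n) (gap qvar c n') n' (Suc n') (jwnum c n) (ins n' m)"
        unfolding T_def using defect_cong[OF im, of "\<lambda>m. qfact c n * A m" Q "jwnum c n"] AQ(2) by (simp add: defect_mult)
      also have "defect (2 * n) (gap qvar c n') n' (Suc n') (jwnum c n) (ins n' m) = - qnum c (Suc n) * jwnum c n' m"
        using defect_jwnum[of n c, THEN conjunct2, THEN conjunct1, rule_format, of n' "ins n' m"] im n' by simp
      finally show ?thesis by (simp del: qnum.simps)
    qed
    have dT: "qfact c n * defect (2 * n') x y w T d = (- Q * qnum c (n + 1)) * defect (2 * n') x y w (jwnum c n') d"
      if "nc_matching (2 * n') d" for x y w d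
      using defect_cong[OF that, of "\<lambda>m. qfact c n * T m" "- Q * qnum c (n + 1)" "jwnum c n'" x y w] T unfolding defect_mult by blast
    have "top_killed qvar c n' T" "bot_killed qvar c n' T"
      using jwnum_killed[of c n'] dT qfact_neq_0[of c n] unfolding top_killed_def bot_killed_def
      by (metis mult_eq_0_iff)+
    moreover define t where "t = (\<lambda>m. specialize q (T m))"
    ultimately have t: "top_killed q c n' t" "bot_killed q c n' t"
      using defect_specialize[of _ q "gap qvar c _"] unfolding top_killed_def bot_killed_def t_def specialize_two_at
      by (metis specialize_hom(1))+
    have t0: "t (nest n' k) = 0" if k: "k \<le> n'" for k
    proof -
      have kn: "k < n" "n - 1 - k = n' - k" using k n' by auto
      have "qfact c n * (T (nest n' k) * (qbinom c n k * qbinom c n (k + 1)))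
         = - Q * (qnum c (n + 1) * (qfact c k * qfact c (n' - k)) * (qbinom c n k * qbinom c n (k + 1)))"
        using T[OF nc_matching_nest[OF k]] jwnum_nest[OF k, of c] by (simp only: mult.assoc[symmetric])
      also have "\<dots> = qfact c n * (- Q * qbinom c (n + 1) (k + 1))"
        using qbinom_trace[OF kn(1), of c] unfolding kn(2) by (simp only: ac_simps)
      finally have "T (nest n' k) * (qbinom c n k * qbinom c n (k + 1)) = - Q * qbinom c (n + 1) (k + 1)"
        using qfact_neq_0 mult_left_cancel by blast
      then have "specialize q (T (nest n' k) * (qbinom c n k * qbinom c n (k + 1))) = specialize q (- Q * qbinom c (n + 1) (k + 1))" by simp
      then have e: "t (nest n' k) * (specialize q (qbinom c n k) * specialize q (qbinom c n (k + 1))) = 0"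
        using z[of "k + 1" c] kn(1) by (simp add: t_def specialize_hom specialize_minus)
      have "specialize q (qbinom c n k) * specialize q (qbinom c n (k + 1)) dvd 1 * 1"
        using unit[of k c] unit[of "k + 1" c] kn(1) by (intro mult_dvd_mono) auto
      then obtain w where "1 = specialize q (qbinom c n k) * specialize q (qbinom c n (k + 1)) * w" unfolding mult_1 by (rule dvdE)
      then show ?thesis using e by (metis mult.assoc mult_1_right mult_zero_left)
    qed
    have tz: "t m = 0" if "nc_matching (2 * n') m" for m
      using killed_dvd[OF t _ that, of 0 1] t0 by simp
    have "defect (2 * n) (gap q c (n - 1)) (n - 1) n f d = 0" if d: "nc_matching (2 * n) d" "d (n - 1) = n" for d
    proof -
      have d': "nc_matching (2 * n' + 2) d" "d n' = Suc n'" using d n' by auto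
      have "T (rem n' d) = defect (2 * n) (gap qvar c n') n' (Suc n') A d"
        unfolding T_def ins_rem[OF d'] ..
      then have "specialize q (defect (2 * n) (gap qvar c n') n' (Suc n') A d) = 0"
        using tz[OF nc_matching_rem[OF d']] by (simp add: t_def)
      then show ?thesis using df[of "2 * n" "n - 1" "n - 1" n d] n' by simp
    qed
    then show ?thesis using f f1 by blast
  qed
  then obtain v where v: "\<And>c. top_killed q c n (v c)" "\<And>c. bot_killed q c n (v c)" "\<And>c. v c (rainbow n) = 1"
    and vt: "\<And>c d. nc_matching (2 * n) d \<Longrightarrow> d (n - 1) = n \<Longrightarrow> defect (2 * n) (gap q c (n - 1)) (n - 1) n (v c) d = 0"
    by metis
  \<comment> \<open>A half turn moves the left gap to the right one. The turned vector is
    annihilated at both edges, so it is the projector with the leftmost color shifted by n, whose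
    right partial trace is already known to vanish.\<close>
  have vl: "defect (2 * n) (gap q c (2 * n - 1)) (2 * n - 1) 0 (v c) d = 0"
    if d: "nc_matching (2 * n) d" "d (2 * n - 1) = 0" for c d
  proof -
    let ?w = "v c \<circ> (rot (2 * n) ^^ n)" and ?c = "shift_color c n"
    have g: "gap q ?c u = two_at q c (n + Suc u)" for u by (rule two_at_shift)
    have w: "top_killed q ?c n ?w" unfolding top_killed_def
    proof (intro allI impI; elim conjE)
      fix u d assume u: "Suc u < n" and d: "nc_matching (2 * n) d" "d u = Suc u"
      have uN: "u < 2 * n" "Suc u < 2 * n" using u by auto
      have e: "(u + n) mod (2 * n) = u + n" "(Suc u + n) mod (2 * n) = Suc (u + n)" using u by auto
      have "(rot (2 * n) ^^ n) d (u + n) = Suc (u + n)" using rot_pow_at[OF d(1) uN(1), of n] d(2) e by simp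
      then have "defect (2 * n) (gap q c (u + n)) (u + n) (Suc (u + n)) (v c) ((rot (2 * n) ^^ n) d) = 0"
        using v(2)[of c] nc_matching_rot_pow[OF d(1), of n] unfolding bot_killed_def by simp
      moreover have "gap q c (u + n) = gap q ?c u" unfolding g by (simp add: add.commute)
      ultimately show "defect (2 * n) (gap q ?c u) u (Suc u) ?w d = 0"
        using defect_rot_pow[OF d(1) uN, of _ n "v c"] unfolding e by simp
    qed
    have w': "bot_killed q ?c n ?w" unfolding bot_killed_def
    proof (intro allI impI; elim conjE)
      fix u d assume u: "n \<le> u" and d: "nc_matching (2 * n) d" "d u = Suc u"
      have uN: "u < 2 * n" "Suc u < 2 * n" using nc_matching_gap_less[OF d] by auto
      have e1: "u + n = (u - n) + 2 * n" "Suc u + n = Suc (u - n) + 2 * n" using u by auto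
      have e: "(u + n) mod (2 * n) = u - n" "(Suc u + n) mod (2 * n) = Suc (u - n)"
        unfolding e1 mod_add_self2 using uN u by auto
      have "(rot (2 * n) ^^ n) d (u - n) = Suc (u - n)" using rot_pow_at[OF d(1) uN(1), of n] d(2) e by simp
      then have "defect (2 * n) (gap q c (u - n)) (u - n) (Suc (u - n)) (v c) ((rot (2 * n) ^^ n) d) = 0"
        using v(1)[of c] nc_matching_rot_pow[OF d(1), of n] uN u unfolding top_killed_def by auto
      moreover have "gap q c (u - n) = gap q ?c u" unfolding g by (rule two_at_cong) (use u in auto)
      ultimately show "defect (2 * n) (gap q ?c u) u (Suc u) ?w d = 0"
        using defect_rot_pow[OF d(1) uN, of _ n "v c"] unfolding e by simp
    qed
    have wr: "?w (rainbow n) = 1 * v ?c (rainbow n)" using rot_pow_rainbow[of n n] v(3) by (simp add: nest_rainbow)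
    have weq: "?w m = 1 * v ?c m" if "nc_matching (2 * n) m" for m
      using killed_unique[OF unit w w' v(1,2) wr that] by simp
    define d' where "d' = (rot (2 * n) ^^ n) d"
    have d': "nc_matching (2 * n) d'" unfolding d'_def by (rule nc_matching_rot_pow[OF d(1)])
    have dd: "(rot (2 * n) ^^ n) d' = d"
      unfolding d'_def using rot_full[OF d(1)] by (metis comp_apply funpow_add mult_2)
    have uN: "n - 1 < 2 * n" "n < 2 * n" "2 * n - 1 < 2 * n" using n by auto
    have e: "(n - 1 + n) mod (2 * n) = 2 * n - 1" "(n + n) mod (2 * n) = 0"
      using n by (auto simp flip: mult_2)
    have "(2 * n - 1 + n) mod (2 * n) = n - 1"
    proof -
      have "2 * n - 1 + n = (n - 1) + 2 * n" using n by simp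
      then show ?thesis using n by (simp only: mod_add_self2) simp
    qed
    then have "d' (n - 1) = n" using rot_pow_at[OF d(1) uN(3), of n] d(2) n by (simp add: d'_def)
    then have "defect (2 * n) (gap q ?c (n - 1)) (n - 1) n (v ?c) d' = 0" using vt[OF d'] by simp
    then have "defect (2 * n) (gap q ?c (n - 1)) (n - 1) n ?w d' = 0" using defect_cong[OF d', of ?w 1 "v ?c"] weq by simp
    then have "defect (2 * n) (gap q ?c (n - 1)) (2 * n - 1) 0 (v c) d = 0"
      using defect_rot_pow[OF d' uN(1,2), of _ n "v c"] unfolding e dd by simp
    moreover have "gap q ?c (n - 1) = gap q c (2 * n - 1)" unfolding g by (rule two_at_cong) (use n in auto)
    ultimately show ?thesis by simp
  qed
  have vall: "defect (2 * n) (gap q c u) u (Suc u mod (2 * n)) (v c) d = 0"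
    if d: "nc_matching (2 * n) d" "d u = Suc u mod (2 * n)" and u: "u < 2 * n" for c u d
  proof -
    consider "Suc u < n" | "u = n - 1" | "n \<le> u" "Suc u < 2 * n" | "u = 2 * n - 1" using u by linarith
    then show ?thesis
    proof cases
      case 1 then show ?thesis using v(1)[of c] d unfolding top_killed_def by auto
    next
      case 2
      then have "Suc u mod (2 * n) = n" using n by auto
      then show ?thesis using vt[OF d(1), of c] d(2) 2 by simp
    next
      case 3 then show ?thesis using v(2)[of c] d unfolding bot_killed_def by auto
    next
      case 4
      then have "Suc u mod (2 * n) = 0" using n by auto
      then show ?thesis using vl[OF d(1), of c] d(2) 4 by simp
    qed
  qed
  \<comment> \<open>The factor is dictated by the identity coefficient, since the identity is
    rotated to \<open>nest n 1\<close>.\<close>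
  define lam where "lam c = v c (nest n 1)" for c
  have lam1: "specialize q (qnum c n) * lam c = 1" for c
    using rainbow_coeff[OF n v(1)[of c]] v(3)[of c] qbinom_1[OF n, of c] by (simp add: lam_def)
  have lam: "lam c * lam (other c) = 1" for c
  proof -
    have "1 = (specialize q (qnum c n) * lam c) * (specialize q (qnum (other c) n) * lam (other c))" using lam1 by simp
    also have "\<dots> = (specialize q (qnum c n) * specialize q (qnum (other c) n)) * (lam c * lam (other c))" by (simp only: ac_simps)
    finally show ?thesis using qnum_unit[OF n z1[of c]] by simp
  qed
  have r: "v c (rot (2 * n) m) = lam c * v (other c) m" if m: "nc_matching (2 * n) m" for c m
  proof -
    let ?w = "v c \<circ> rot (2 * n)"
    \<comment> \<open>Capping the rotated vector at u amounts to capping \<open>v c\<close> at u +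
      1. The gaps between the edges enter at u = n - 2 and u = 2n - 2.\<close>
    have k: "defect (2 * n) (gap q (other c) u) u (Suc u) ?w d = 0"
      if d: "nc_matching (2 * n) d" "d u = Suc u" for u d
    proof -
      have uN: "u < 2 * n" "Suc u < 2 * n" using nc_matching_gap_less[OF d] by auto
      then have s: "Suc u mod (2 * n) = Suc u" by simp
      have "rot (2 * n) d (Suc u) = Suc (Suc u) mod (2 * n)" using rot_Suc[OF uN(1), of d] d(2) s by simp
      then have "defect (2 * n) (gap q c (Suc u)) (Suc u) (Suc (Suc u) mod (2 * n)) (v c) (rot (2 * n) d) = 0"
        using vall[OF nc_matching_rot[OF d(1)]] uN by blast
      then show ?thesis using defect_rot[OF d(1) uN, of "gap q c (Suc u)" "v c"] unfolding s two_at_other by simp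
    qed
    have w: "top_killed q (other c) n ?w" "bot_killed q (other c) n ?w"
      unfolding top_killed_def bot_killed_def using k by blast+
    have "?w (rainbow n) = lam c * v (other c) (rainbow n)"
      using rot_nest[of 0 n] n v(3) by (simp add: lam_def nest_rainbow)
    then have "?w m = lam c * v (other c) m" using killed_unique[OF unit w v(1,2) _ m] by blast
    then show ?thesis by simp
  qed
  have "v c m = lam c * v (other c) (rot (2 * n) m)" if "nc_matching (2 * n) m" for c m
    using r[OF that, of "other c"] lam[of c] by (simp add: mult.assoc[symmetric])
  then show thesis using that[of v lam] v(1,3) r by blast
qed


section \<open>Normal words of matchings\<close>

text \<open>Only the relations without scalars are imposed, so words are compared without
  coefficients. The quadratic relation is used separately, where a disk is closed.\<close>

inductive word_eq :: "nat \<Rightarrow> nat list \<Rightarrow> nat list \<Rightarrow> bool" for N where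
  comm: "set (xs @ [i, j] @ ys) \<subseteq> {1..<N} \<Longrightarrow> i + 1 < j \<or> j + 1 < i \<Longrightarrow> word_eq N (xs @ [i, j] @ ys) (xs @ [j, i] @ ys)"
| braid: "set (xs @ [i, j] @ ys) \<subseteq> {1..<N} \<Longrightarrow> j = i + 1 \<or> i = j + 1 \<Longrightarrow> word_eq N (xs @ [i, j, i] @ ys) (xs @ [i] @ ys)"
| refl: "word_eq N w w"
| sym: "word_eq N w w' \<Longrightarrow> word_eq N w' w"
| trans [trans]: "word_eq N w w' \<Longrightarrow> word_eq N w' w'' \<Longrightarrow> word_eq N w w''"

lemma word_eq_mono: "word_eq N w w' \<Longrightarrow> N \<le> N' \<Longrightarrow> word_eq N' w w'"
proof (induction rule: word_eq.induct)
  case (comm xs i j ys) then show ?case by (intro word_eq.comm) auto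
next
  case (braid xs i j ys) then show ?case by (intro word_eq.braid) auto
qed (auto intro: word_eq.intros)

lemma word_eq_cong:
  "word_eq N w w' \<Longrightarrow> set us \<subseteq> {1..<N} \<Longrightarrow> set vs \<subseteq> {1..<N} \<Longrightarrow> word_eq N (us @ w @ vs) (us @ w' @ vs)"
proof (induction rule: word_eq.induct)
  case (comm xs i j ys)
  then show ?case using word_eq.comm[of "us @ xs" i j "ys @ vs" N] by auto
next
  case (braid xs i j ys)
  then show ?case using word_eq.braid[of "us @ xs" i j "ys @ vs" N] by auto
qed (auto intro: word_eq.intros)

lemma word_eq_append_left: "word_eq N w w' \<Longrightarrow> set us \<subseteq> {1..<N} \<Longrightarrow> word_eq N (us @ w) (us @ w')"
  using word_eq_cong[of N w w' us "[]"] by simp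

lemma word_eq_append_right: "word_eq N w w' \<Longrightarrow> set vs \<subseteq> {1..<N} \<Longrightarrow> word_eq N (w @ vs) (w' @ vs)"
  using word_eq_cong[of N w w' "[]" vs] by simp

lemma word_eq_Cons: "word_eq N w w' \<Longrightarrow> i \<in> {1..<N} \<Longrightarrow> word_eq N (i # w) (i # w')"
  using word_eq_append_left[of N w w' "[i]"] by simp

lemma word_eq_commute:
  "set (i # xs) \<subseteq> {1..<N} \<Longrightarrow> \<forall>j\<in>set xs. i + 1 < j \<or> j + 1 < i \<Longrightarrow> word_eq N (i # xs) (xs @ [i])"
proof (induction xs)
  case Nil then show ?case by (simp add: word_eq.refl)
next
  case (Cons j xs)
  have "word_eq N (i # j # xs) (j # i # xs)" using Cons.prems word_eq.comm[of "[]" i j xs N] by auto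
  also have "word_eq N (j # (i # xs)) (j # (xs @ [i]))" using Cons by (intro word_eq_Cons) auto
  finally show ?case by simp
qed

lemma upt_split: "a \<le> b \<Longrightarrow> b \<le> c \<Longrightarrow> [a..<c] = [a..<b] @ [b..<c]"
  using upt_add_eq_append[of a b "c - b"] by simp

text \<open>The letter i commutes up to i - 1, where i, i - 1, i shrinks to i. Then i - 2 is
  expanded to i - 2, i - 1, i - 2, and its last letter commutes to the end.\<close>

lemma word_eq_shift:
  assumes "1 \<le> a" "a + 2 \<le> i" "i < N"
  shows "word_eq N (i # [a..<N]) ([a..<N] @ [i - 2])"
proof -
  have s1: "[a..<N] = [a..<i - 1] @ [i - 1, i] @ [Suc i..<N]"
    using upt_split[of a "i - 1" N] assms by (simp add: upt_conv_Cons Suc_diff_Suc numeral_2_eq_2)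
  have s2: "[a..<N] = [a..<i - 2] @ [i - 2, i - 1] @ [i..<N]"
  proof -
    have "Suc (i - 2) = i - 1" "Suc (i - 1) = i" using assms by auto
    then show ?thesis using upt_split[of a "i - 2" N] assms by (simp add: upt_conv_Cons)
  qed
  have "word_eq N ((i # [a..<i - 1]) @ ([i - 1, i] @ [Suc i..<N])) (([a..<i - 1] @ [i]) @ ([i - 1, i] @ [Suc i..<N]))"
    using assms by (intro word_eq_append_right word_eq_commute) auto
  also have "([a..<i - 1] @ [i]) @ ([i - 1, i] @ [Suc i..<N]) = [a..<i - 1] @ [i, i - 1, i] @ [Suc i..<N]" by simp
  also have "word_eq N \<dots> ([a..<i - 1] @ [i] @ [Suc i..<N])"
    using assms by (intro word_eq.braid) auto
  also have "[a..<i - 1] @ [i] @ [Suc i..<N] = [a..<i - 2] @ [i - 2] @ [i..<N]"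
  proof -
    have "[a..<i - 1] = [a..<i - 2] @ [i - 2]"
      using upt_Suc_append[of a "i - 2"] assms by (simp add: Suc_diff_Suc numeral_2_eq_2)
    then show ?thesis using assms by (simp add: upt_conv_Cons)
  qed
  also have "word_eq N \<dots> ([a..<i - 2] @ [i - 2, i - 1, i - 2] @ [i..<N])"
    using assms by (intro word_eq.sym[OF word_eq.braid]) auto
  also have "\<dots> = ([a..<i - 2] @ [i - 2, i - 1]) @ ((i - 2) # [i..<N])" by simp
  also have "word_eq N \<dots> (([a..<i - 2] @ [i - 2, i - 1]) @ ([i..<N] @ [i - 2]))"
    using assms by (intro word_eq_append_left word_eq_commute) auto
  also have "\<dots> = [a..<N] @ [i - 2]" using s2 by simp
  also have "(i # [a..<i - 1]) @ ([i - 1, i] @ [Suc i..<N]) = i # [a..<N]" using s1 by simp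
  finally show ?thesis .
qed

text \<open>This is \<open>ins_ins\<close> for words: the runs insert two cups in either order.
  Descending in b, each new first letter passes the other run by
  \<open>word_eq_shift\<close>.\<close>

lemma word_eq_exchange:
  assumes a: "1 \<le> a" "a + 2 \<le> b" "b \<le> Suc n"
  shows "word_eq (Suc n) ([b..<Suc n] @ [a..<n]) ([a..<Suc n] @ [b - 2..<n])"
  using a(3,2)
proof (induction b rule: inc_induct)
  case base
  then obtain k where k: "n = Suc k" using a by (cases n) auto
  have "word_eq (Suc n) ([a..<k] @ [k, Suc k, k] @ []) ([a..<k] @ [k] @ [])"
    using base a k by (intro word_eq.braid) auto
  moreover have "[a..<Suc n] @ [Suc n - 2..<n] = [a..<k] @ [k, Suc k, k]" "[a..<n] = [a..<k] @ [k]"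
    using base a k by (auto simp: upt_conv_Cons)
  ultimately show ?case by (simp del: upt_Suc add: word_eq.sym)
next
  case (step b)
  have "word_eq (Suc n) (b # ([Suc b..<Suc n] @ [a..<n])) (b # ([a..<Suc n] @ [Suc b - 2..<n]))"
    using step a by (intro word_eq_Cons) auto
  also have "b # ([a..<Suc n] @ [Suc b - 2..<n]) = (b # [a..<Suc n]) @ [Suc b - 2..<n]" by (simp del: upt_Suc)
  also have "word_eq (Suc n) \<dots> (([a..<Suc n] @ [b - 2]) @ [Suc b - 2..<n])"
    using step a by (intro word_eq_append_right word_eq_shift) auto
  also have "([a..<Suc n] @ [b - 2]) @ [Suc b - 2..<n] = [a..<Suc n] @ [b - 2..<n]"
  proof -
    have "b - 2 < n" "Suc (b - 2) = Suc b - 2" using step a by auto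
    then have "[b - 2..<n] = (b - 2) # [Suc b - 2..<n]" using upt_conv_Cons[of "b - 2" n] by simp
    then show ?thesis by (simp del: upt_Suc)
  qed
  also have "b # ([Suc b..<Suc n] @ [a..<n]) = [b..<Suc n] @ [a..<n]" using step by (simp add: upt_conv_Cons del: upt_Suc)
  finally show ?case .
qed

text \<open>
  A matching with a cup at \<open>u\<close> arises from \<open>rem u m\<close>, with a vertical strand added on the right, by
  stacking $e_{u+1} \cdots e_{n-1}$ on top. The word does not depend on the choice of the cup, up to
  the relations.
\<close>

fun normal_word :: "nat \<Rightarrow> (nat \<Rightarrow> nat) \<Rightarrow> nat list" where
  "normal_word 0 m = []"
| "normal_word (Suc n) m =
     (let u = (LEAST u. m u = Suc u) in [Suc u..<Suc n] @ normal_word n (rem u m))"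

text \<open>As n + 1 of the points are openers, the first closer is at most n + 1, and it is joined
  to its predecessor. The value u = n is possible; the arc is then the vertical strand on the
  right.\<close>

lemma ex_cup:
  assumes m: "nc_matching (2 * Suc n) m"
  obtains u where "u \<le> n" "m u = Suc u" "(LEAST u. m u = Suc u) = u"
proof -
  have "\<exists>t. t \<le> Suc n \<and> t \<notin> openers m"
  proof (rule ccontr)
    assume "\<not> ?thesis"
    then have "{..Suc n} \<subseteq> openers m" by auto
    then have "card {..Suc n} \<le> card (openers m)" using finite_openers[OF m] by (rule card_mono[rotated])
    then show False using two_card_openers[OF m] by simp
  qed
  then obtain t where t: "t \<le> Suc n" "t \<notin> openers m" "\<And>s. s < t \<Longrightarrow> s \<in> openers m"
    using exists_least_iff[of "\<lambda>t. t \<le> Suc n \<and> t \<notin> openers m"] by (metis le_trans less_imp_le_nat)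
  have tN: "t < 2 * Suc n" using t by simp
  have mt: "m t < t" using not_opener_iff[OF m tN] t(2) by blast
  have "m t = t - 1"
  proof (rule ccontr)
    assume ne: "m t \<noteq> t - 1"
    have "m (t - 1) < t" using nc_matchingD(5)[OF m, of "m t" "t - 1"] nc_matchingD(3)[OF m, of t] ne mt by simp
    moreover have "t - 1 < m (t - 1)" using t(3)[of "t - 1"] mt by (auto simp: openers_def)
    ultimately show False by simp
  qed
  then have ex: "m (t - 1) = Suc (t - 1)" using nc_matchingD(3)[OF m, of t] mt by simp
  define u where "u = (LEAST u. m u = Suc u)"
  have "m u = Suc u" unfolding u_def by (rule LeastI[of _ "t - 1"]) (rule ex)
  moreover have "u \<le> t - 1" unfolding u_def by (rule Least_le) (rule ex)
  ultimately have "u \<le> n" "m u = Suc u" using t(1) by linarith+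
  then show thesis using that u_def[symmetric] by blast
qed

lemma normal_word_letters: "nc_matching (2 * n) m \<Longrightarrow> set (normal_word n m) \<subseteq> {1..<n}"
proof (induction n arbitrary: m)
  case (Suc n)
  obtain u where u: "u \<le> n" "m u = Suc u" "(LEAST u. m u = Suc u) = u" using ex_cup[OF Suc.prems] .
  have "nc_matching (2 * n) (rem u m)" using nc_matching_rem[of "2 * n" m u] Suc.prems u by simp
  then show ?case using Suc.IH[of "rem u m"] u by (auto simp: Let_def)
qed simp

lemma rem_cup_iff:
  assumes m: "nc_matching N m" "m u = Suc u"
  shows "Suc g < u \<Longrightarrow> rem u m g = Suc g \<longleftrightarrow> m g = Suc g"
    "Suc u < g \<Longrightarrow> rem u m (g - 2) = Suc (g - 2) \<longleftrightarrow> m g = Suc g"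
proof -
  have ne: "m g \<noteq> u" "m g \<noteq> Suc u" if "g \<noteq> u" "g \<noteq> Suc u" for g
    using nc_matchingD(3)[OF m(1)] m(2) that by metis+
  show "Suc g < u \<Longrightarrow> rem u m g = Suc g \<longleftrightarrow> m g = Suc g"
    using ne[of g] by (auto simp: rem_def skip2_simps drop2_def)
  assume g: "Suc u < g"
  then have "skip2 u (g - 2) = g" by (auto simp: skip2_def)
  then show "rem u m (g - 2) = Suc (g - 2) \<longleftrightarrow> m g = Suc g"
    using ne[of g] g by (auto simp: rem_def drop2_def)
qed

text \<open>Two different cups are disjoint, so they can be removed in either order with the same
  result. By induction each of the two words can be continued with the other cup, and
  \<open>word_eq_exchange\<close> compares the prefixes.\<close>

lemma normal_word_any_cup:
  "nc_matching (2 * Suc n) m \<Longrightarrow> u \<le> n \<Longrightarrow> m u = Suc u \<Longrightarrow>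
     word_eq (Suc n) ([Suc u..<Suc n] @ normal_word n (rem u m)) (normal_word (Suc n) m)"
proof (induction n arbitrary: m u)
  case 0
  obtain u0 where u0: "u0 \<le> 0" "m u0 = Suc u0" "(LEAST u. m u = Suc u) = u0" using ex_cup[OF 0(1)] .
  then show ?case using 0 by (auto intro: word_eq.refl)
next
  case (Suc n)
  note m = Suc.prems(1)
  obtain u0 where u0: "u0 \<le> Suc n" "m u0 = Suc u0" "(LEAST u. m u = Suc u) = u0" using ex_cup[OF m] .
  have nf: "normal_word (Suc (Suc n)) m = [Suc u0..<Suc (Suc n)] @ normal_word (Suc n) (rem u0 m)"
    unfolding normal_word.simps(2)[of "Suc n"] u0(3) Let_def ..
  show ?case
  proof (cases "u = u0")
    case True
    then show ?thesis unfolding nf by (auto intro: word_eq.refl)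
  next
    case False
    have "u0 \<le> u" using Least_le[of "\<lambda>u. m u = Suc u" u] Suc.prems(3) u0(3) by simp
    moreover have "u \<noteq> Suc u0" using nc_matchingD(3)[OF m, of u0] u0(2) Suc.prems(3) by auto
    ultimately have u: "u0 + 2 \<le> u" using False by simp
    have m2: "nc_matching (2 * Suc n + 2) m" using m by simp
    have r: "nc_matching (2 * Suc n) (rem u m)" "nc_matching (2 * Suc n) (rem u0 m)"
      using nc_matching_rem[OF m2] u0(2) Suc.prems(3) by blast+
    have c1: "rem u m u0 = Suc u0" using rem_cup_iff(1)[OF m Suc.prems(3), of u0] u u0(2) by simp
    have c2: "rem u0 m (u - 2) = Suc (u - 2)" using rem_cup_iff(2)[OF m u0(2), of u] u Suc.prems(3) by simp
    have "nc_matching (2 * n + 4) m" using m by (simp add: eval_nat_numeral)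
    then have rr: "rem (u - 2) (rem u0 m) = rem u0 (rem u m)"
    proof -
      have "u - 2 + 2 = u" "u0 \<le> u - 2" using u by auto
      then show ?thesis using rem_rem[OF \<open>nc_matching (2 * n + 4) m\<close> u0(2), of "u - 2"] Suc.prems(3) by simp
    qed
    have e1: "word_eq (Suc n) (normal_word (Suc n) (rem u m)) ([Suc u0..<Suc n] @ normal_word n (rem u0 (rem u m)))"
      by (rule word_eq.sym, rule Suc.IH[OF r(1) _ c1]) (use u Suc.prems(2) in simp)
    have e2: "word_eq (Suc n) ([Suc (u - 2)..<Suc n] @ normal_word n (rem u0 (rem u m))) (normal_word (Suc n) (rem u0 m))"
      using Suc.IH[OF r(2) _ c2] u Suc.prems(2) unfolding rr by simp
    have lt: "set (normal_word n (rem u0 (rem u m))) \<subseteq> {1..<Suc (Suc n)}"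
    proof -
      have "nc_matching (2 * n) (rem u0 (rem u m))" using nc_matching_rem[of "2 * n" "rem u m" u0] r(1) c1 by simp
      then show ?thesis using normal_word_letters by fastforce
    qed
    have "word_eq (Suc (Suc n)) ([Suc u..<Suc (Suc n)] @ normal_word (Suc n) (rem u m))
       ([Suc u..<Suc (Suc n)] @ ([Suc u0..<Suc n] @ normal_word n (rem u0 (rem u m))))"
      by (intro word_eq_append_left word_eq_mono[OF e1]) auto
    also have "\<dots> = ([Suc u..<Suc (Suc n)] @ [Suc u0..<Suc n]) @ normal_word n (rem u0 (rem u m))" by (simp del: upt_Suc)
    also have "word_eq (Suc (Suc n)) \<dots> (([Suc u0..<Suc (Suc n)] @ [Suc u - 2..<Suc n]) @ normal_word n (rem u0 (rem u m)))"
      using u Suc.prems(2) by (intro word_eq_append_right[OF _ lt] word_eq_exchange) auto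
    also have "\<dots> = [Suc u0..<Suc (Suc n)] @ ([Suc (u - 2)..<Suc n] @ normal_word n (rem u0 (rem u m)))"
    proof -
      have "Suc u - 2 = Suc (u - 2)" using u by simp
      then show ?thesis by (simp only: append_assoc)
    qed
    also have "word_eq (Suc (Suc n)) \<dots> ([Suc u0..<Suc (Suc n)] @ normal_word (Suc n) (rem u0 m))"
      by (intro word_eq_append_left word_eq_mono[OF e2]) auto
    finally show ?thesis unfolding nf .
  qed
qed

text \<open>Expand the word along some cup u. If u is next to g, the new letter prolongs the run or
  is absorbed by the braid relation; otherwise it passes the run, as g + 1 or g - 1, and the
  induction hypothesis applies to \<open>rem u m\<close>.\<close>

lemma normal_word_stack:
  "nc_matching (2 * Suc n) m \<Longrightarrow> g < n \<Longrightarrow> m g \<noteq> Suc g \<Longrightarrow>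
     word_eq (Suc n) (Suc g # normal_word (Suc n) m) (normal_word (Suc n) (cap g (Suc g) m))"
proof (induction n arbitrary: m g)
  case (Suc n)
  note m = Suc.prems(1)
  have m2: "nc_matching (2 * Suc n + 2) m" using m by simp
  obtain u where u: "u \<le> Suc n" "m u = Suc u" using ex_cup[OF m] by blast
  define m0 where "m0 = rem u m"
  have m0: "nc_matching (2 * Suc n) m0" unfolding m0_def by (rule nc_matching_rem[OF m2 u(2)])
  have mi: "m = ins u m0" using ins_rem[OF m u(2)] by (simp add: m0_def)
  have d: "nc_matching (2 * Suc (Suc n)) (cap g (Suc g) m)" using Suc.prems(2) by (intro nc_matching_cap[OF m]) simp
  have gi: "Suc g \<in> {1..<Suc (Suc n)}" using Suc.prems(2) by simp
  have L: "set (normal_word (Suc n) m0) \<subseteq> {1..<Suc (Suc n)}" using normal_word_letters[OF m0] by auto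
  have "word_eq (Suc (Suc n)) (Suc g # normal_word (Suc (Suc n)) m) (Suc g # ([Suc u..<Suc (Suc n)] @ normal_word (Suc n) m0))"
    unfolding m0_def by (rule word_eq_Cons[OF word_eq.sym[OF normal_word_any_cup[OF m u]] gi])
  also have "word_eq (Suc (Suc n)) (Suc g # ([Suc u..<Suc (Suc n)] @ normal_word (Suc n) m0)) (normal_word (Suc (Suc n)) (cap g (Suc g) m))"
  proof -
    have gu: "g \<noteq> u" using u Suc.prems(3) by auto
    consider "u = Suc g" | "g = Suc u" | "Suc g < u" | "Suc u < g" using gu by linarith
    then show ?thesis
    proof cases
      case 1
      have c: "cap g (Suc g) m = ins g m0" unfolding mi 1 by (rule cap_ins_Suc[OF m0]) (use Suc.prems(2) in simp)
      have "word_eq (Suc (Suc n)) ([Suc g..<Suc (Suc n)] @ normal_word (Suc n) (rem g (ins g m0))) (normal_word (Suc (Suc n)) (ins g m0))"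
        by (rule normal_word_any_cup) (use d c Suc.prems(2) in auto)
      moreover have "[Suc g..<Suc (Suc n)] = Suc g # [Suc u..<Suc (Suc n)]" unfolding 1 using Suc.prems(2) by (simp add: upt_conv_Cons del: upt_Suc)
      ultimately show ?thesis unfolding c by (simp del: upt_Suc normal_word.simps)
    next
      case 2
      have c: "cap g (Suc g) m = ins g m0" unfolding mi 2 by (rule cap_Suc_ins[OF m0]) (use Suc.prems(2) 2 in simp)
      have s: "[Suc u..<Suc (Suc n)] = [g, Suc g] @ [Suc (Suc g)..<Suc (Suc n)]" unfolding 2 using Suc.prems(2) 2 by (simp add: upt_conv_Cons del: upt_Suc)
      have "word_eq (Suc (Suc n)) ([] @ [Suc g, g, Suc g] @ ([Suc (Suc g)..<Suc (Suc n)] @ normal_word (Suc n) m0))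
         ([] @ [Suc g] @ ([Suc (Suc g)..<Suc (Suc n)] @ normal_word (Suc n) m0))"
        using L Suc.prems(2) 2 by (intro word_eq.braid) auto
      also have "[] @ [Suc g] @ ([Suc (Suc g)..<Suc (Suc n)] @ normal_word (Suc n) m0) = [Suc g..<Suc (Suc n)] @ normal_word (Suc n) (rem g (ins g m0))"
        using Suc.prems(2) by (simp add: upt_conv_Cons del: upt_Suc normal_word.simps)
      also have "word_eq (Suc (Suc n)) \<dots> (normal_word (Suc (Suc n)) (ins g m0))"
        by (rule normal_word_any_cup) (use d c Suc.prems(2) in auto)
      finally show ?thesis unfolding c s by (simp del: upt_Suc normal_word.simps)
    next
      case 3
      then have gn: "g < n" using u by simp
      have ne: "m0 g \<noteq> Suc g" using rem_cup_iff(1)[OF m u(2) 3] Suc.prems(3) by (simp add: m0_def)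
      have c: "cap g (Suc g) m = ins u (cap g (Suc g) m0)" unfolding mi by (rule cap_ins_far_right[OF 3])
      have "word_eq (Suc (Suc n)) ((Suc g # [Suc u..<Suc (Suc n)]) @ normal_word (Suc n) m0) (([Suc u..<Suc (Suc n)] @ [Suc g]) @ normal_word (Suc n) m0)"
        using 3 gi by (intro word_eq_append_right[OF _ L] word_eq_commute) auto
      also have "\<dots> = [Suc u..<Suc (Suc n)] @ (Suc g # normal_word (Suc n) m0)" by (simp del: upt_Suc normal_word.simps)
      also have "word_eq (Suc (Suc n)) \<dots> ([Suc u..<Suc (Suc n)] @ normal_word (Suc n) (cap g (Suc g) m0))"
        by (intro word_eq_append_left word_eq_mono[OF Suc.IH[OF m0 gn ne]]) auto
      also have "word_eq (Suc (Suc n)) ([Suc u..<Suc (Suc n)] @ normal_word (Suc n) (rem u (ins u (cap g (Suc g) m0)))) (normal_word (Suc (Suc n)) (ins u (cap g (Suc g) m0)))"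
        by (rule normal_word_any_cup) (use d c u in auto)
      then have "word_eq (Suc (Suc n)) ([Suc u..<Suc (Suc n)] @ normal_word (Suc n) (cap g (Suc g) m0)) (normal_word (Suc (Suc n)) (cap g (Suc g) m))"
        unfolding c by (simp del: upt_Suc normal_word.simps)
      finally show ?thesis by (simp del: upt_Suc normal_word.simps)
    next
      case 4
      then have gn: "g - 2 < n" using Suc.prems(2) by simp
      have ne: "m0 (g - 2) \<noteq> Suc (g - 2)" using rem_cup_iff(2)[OF m u(2) 4] Suc.prems(3) by (simp add: m0_def)
      have c: "cap g (Suc g) m = ins u (cap (g - 2) (Suc (g - 2)) m0)" unfolding mi by (rule cap_ins_far_left[OF 4])
      have "word_eq (Suc (Suc n)) ((Suc g # [Suc u..<Suc (Suc n)]) @ normal_word (Suc n) m0) (([Suc u..<Suc (Suc n)] @ [Suc g - 2]) @ normal_word (Suc n) m0)"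
        using 4 gi by (intro word_eq_append_right[OF _ L] word_eq_shift) auto
      also have "\<dots> = [Suc u..<Suc (Suc n)] @ (Suc (g - 2) # normal_word (Suc n) m0)"
      proof -
        have "Suc g - 2 = Suc (g - 2)" using 4 by simp
        then show ?thesis by (simp only: append_assoc append_Cons append_Nil)
      qed
      also have "word_eq (Suc (Suc n)) \<dots> ([Suc u..<Suc (Suc n)] @ normal_word (Suc n) (cap (g - 2) (Suc (g - 2)) m0))"
        by (intro word_eq_append_left word_eq_mono[OF Suc.IH[OF m0 gn ne]]) auto
      also have "word_eq (Suc (Suc n)) ([Suc u..<Suc (Suc n)] @ normal_word (Suc n) (rem u (ins u (cap (g - 2) (Suc (g - 2)) m0)))) (normal_word (Suc (Suc n)) (ins u (cap (g - 2) (Suc (g - 2)) m0)))"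
        by (rule normal_word_any_cup) (use d c u in auto)
      then have "word_eq (Suc (Suc n)) ([Suc u..<Suc (Suc n)] @ normal_word (Suc n) (cap (g - 2) (Suc (g - 2)) m0)) (normal_word (Suc (Suc n)) (cap g (Suc g) m))"
        unfolding c by (simp del: upt_Suc normal_word.simps)
      finally show ?thesis by (simp del: upt_Suc normal_word.simps)
    qed
  qed
  finally show ?case .
qed simp

section \<open>Evaluation of words in matchings\<close>

fun matching_value :: "(color \<Rightarrow> 'a::comm_ring_1) \<Rightarrow> color \<Rightarrow> nat \<Rightarrow> nat list \<Rightarrow> 'a \<times> (nat \<Rightarrow> nat)" where
  "matching_value q c n [] = (1, rainbow n)"
| "matching_value q c n (i # w) =
     (let (a, m) = matching_value q c n w in
      (if m (i - 1) = i then - two_at q c i * a else a, cap (i - 1) i m))"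

lemma nc_matching_value:
  "set w \<subseteq> {1..<n} \<Longrightarrow> nc_matching (2 * n) (snd (matching_value q c n w))"
proof (induction w)
  case Nil then show ?case by (simp add: nc_matching_rainbow)
next
  case (Cons i w)
  then have "nc_matching (2 * n) (cap (i - 1) (Suc (i - 1)) (snd (matching_value q c n w)))"
    by (intro nc_matching_cap) auto
  then show ?case using Cons.prems by (simp add: case_prod_beta Let_def)
qed

text \<open>The word does not touch the last strand, which is the arc at n.\<close>

lemma matching_value_Suc:
  "set w \<subseteq> {1..<n} \<Longrightarrow> matching_value q c (Suc n) w
     = (fst (matching_value q c n w), ins n (snd (matching_value q c n w)))"
proof (induction w)
  case Nil
  have "ins n (rem n (rainbow (Suc n))) = rainbow (Suc n)"
    by (rule ins_rem[OF nc_matching_rainbow]) (simp add: rainbow_def)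
  then have "rainbow (Suc n) = ins n (rainbow n)" using rem_nest(2)[of n] by (simp add: nest_rainbow)
  then show ?case by simp
next
  case (Cons i w)
  define m where "m = snd (matching_value q c n w)"
  have i: "1 \<le> i" "i < n" using Cons.prems by auto
  then have "Suc (i - 1) = i" "Suc (i - 1) < n" by auto
  then have "cap (i - 1) i (ins n m) = ins n (cap (i - 1) i m)" using cap_ins_far_right[of "i - 1" n m] by simp
  moreover have "ins n m (i - 1) = i \<longleftrightarrow> m (i - 1) = i"
    using i ins_simps(1)[of "i - 1" n m] by (auto simp: skip2_def)
  moreover have "matching_value q c (Suc n) w = (fst (matching_value q c n w), ins n m)"
    using Cons by (simp add: m_def)
  ultimately show ?case by (simp add: case_prod_beta Let_def m_def[symmetric])
qed

text \<open>The run begins with the vertical strand, the arc at n; each letter moves this arc one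
  step to the left by straightening, so no disk is ever closed.\<close>

lemma matching_value_normal_word:
  "nc_matching (2 * n) m \<Longrightarrow> matching_value q c n (normal_word n m) = (1, m)"
proof (induction n arbitrary: m)
  case 0
  then have "m x = x" for x using nc_matchingD(4)[OF 0, of x] by simp
  then show ?case by (auto simp: rainbow_def)
next
  case (Suc n)
  obtain u where u: "u \<le> n" "m u = Suc u" "(LEAST u. m u = Suc u) = u" using ex_cup[OF Suc.prems] .
  define m0 where "m0 = rem u m"
  have m0: "nc_matching (2 * n) m0" using nc_matching_rem[of "2 * n" m u] Suc.prems u by (simp add: m0_def)
  have mi: "m = ins u m0" using ins_rem[OF Suc.prems u(2)] by (simp add: m0_def)
  have base: "matching_value q c (Suc n) (normal_word n m0) = (1, ins n m0)"
    using matching_value_Suc[OF normal_word_letters[OF m0], of q c] Suc.IH[OF m0] by simp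
  have "matching_value q c (Suc n) ([Suc k..<Suc n] @ normal_word n m0) = (1, ins k m0)" if "k \<le> n" for k
    using that
  proof (induction k rule: inc_induct)
    case base then show ?case using \<open>matching_value q c (Suc n) (normal_word n m0) = (1, ins n m0)\<close> by simp
  next
    case (step k)
    have s: "[Suc k..<Suc n] = Suc k # [Suc (Suc k)..<Suc n]" using step by (simp add: upt_conv_Cons del: upt_Suc)
    have "cap k (Suc k) (ins (Suc k) m0) = ins k m0" by (rule cap_ins_Suc[OF m0]) (use step in simp)
    moreover have "ins (Suc k) m0 k \<noteq> Suc k"
      using ins_simps(1)[of k "Suc k" m0] skip2_neq(1)[of "Suc k" "m0 k"] by simp
    ultimately show ?case unfolding s using step.IH by (simp del: upt_Suc normal_word.simps)
  qed
  from this[OF u(1)] have "matching_value q c (Suc n) ([Suc u..<Suc n] @ normal_word n m0) = (1, m)"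
    unfolding mi[symmetric] .
  moreover have "normal_word (Suc n) m = [Suc u..<Suc n] @ normal_word n m0"
    unfolding normal_word.simps u(3) Let_def m0_def ..
  ultimately show ?case by simp
qed

lemma normal_word_rainbow: "normal_word n (rainbow n) = []"
proof (induction n)
  case (Suc n)
  have "(LEAST u. rainbow (Suc n) u = Suc u) = n"
    by (rule Least_equality) (auto simp: rainbow_def split: if_splits)
  then show ?case using Suc rem_nest(2)[of n] by (simp add: nest_rainbow)
qed simp


section \<open>Matchings and diagrams\<close>

text \<open>The points enclosed by an arc are matched among themselves, so their number is even.
  This ensures that the colors of the regions are consistent.\<close>

lemma nc_matching_parity:
  assumes m: "nc_matching N m" and "x < N"
  shows "even (m x) \<longleftrightarrow> odd x"
proof -
  have *: "even (m x) \<longleftrightarrow> odd x" if x: "x < m x" for x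
  proof -
    define S where "S = {x<..<m x}"
    have mS: "m y \<in> S" if "y \<in> S" for y using nc_matchingD(5,6)[OF m, of x y] that by (auto simp: S_def)
    have ne: "m y \<noteq> y" if "y \<in> S" for y using nc_matchingD(4)[OF m, of y] nc_matchingD(2)[OF m, of y]
      nc_matchingD(1,4)[OF m, of x] that x by (cases "x < N") (auto simp: S_def)
    have "bij_betw m {y \<in> S. y < m y} {y \<in> S. m y < y}"
      by (rule bij_betwI[where g = m]) (use mS nc_matchingD(3)[OF m] in auto)
    then have "card {y \<in> S. y < m y} = card {y \<in> S. m y < y}" by (rule bij_betw_same_card)
    moreover have "S = {y \<in> S. y < m y} \<union> {y \<in> S. m y < y}" using ne by force
    moreover have "card ({y \<in> S. y < m y} \<union> {y \<in> S. m y < y}) = card {y \<in> S. y < m y} + card {y \<in> S. m y < y}"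
      by (intro card_Un_disjoint) (auto simp: S_def)
    ultimately have "even (card S)" by simp
    then show ?thesis using x by (auto simp: S_def)
  qed
  show ?thesis
  proof (cases "x < m x")
    case False
    then have "m x < m (m x)" using nc_matchingD(2)[OF m assms(2)] nc_matchingD(3)[OF m, of x] by simp
    then show ?thesis using *[of "m x"] nc_matchingD(3)[OF m, of x] by simp
  qed (rule *)
qed

lemma cap_swap: "v \<noteq> v' \<Longrightarrow> m v \<noteq> m v' \<Longrightarrow> cap v v' m = cap v' v m"
  by (auto simp: cap_def fun_eq_iff)

text \<open>Here the caps share the strand from \<open>u\<close> to \<open>v\<close>. In either
  order the partners of \<open>u'\<close> and \<open>v'\<close> become joined, or a loop is closed
  if \<open>u'\<close> and \<open>v'\<close> are partners.\<close>

lemma cap_commute_linked: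
  assumes inv: "\<And>z. m (m z) = z" and uv: "m u = v"
    and ne: "m u' \<noteq> u'" "m v' \<noteq> v'" and d: "distinct [u, u', v, v']"
  shows "cap u u' (cap v v' m) = cap v v' (cap u u' m)"
proof
  fix x
  define b f where "b = m u'" and "f = m v'"
  have A: "m v = u" "m u' = b" "m v' = f" "m b = u'" "m f = v'" using inv uv by (auto simp: b_def f_def)
  have D: "u \<noteq> u'" "u \<noteq> v" "u \<noteq> v'" "u' \<noteq> v" "u' \<noteq> v'" "v \<noteq> v'" "u' \<noteq> u" "v \<noteq> u" "v' \<noteq> u" "v \<noteq> u'" "v' \<noteq> u'" "v' \<noteq> v"
    using d by auto
  show "cap u u' (cap v v' m) x = cap v v' (cap u u' m) x"
  proof (cases "b = v'")
    case True
    then have "f = u'" using A by metis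
    then show ?thesis using D True by (simp add: cap_def A uv)
  next
    case False
    then have "f \<noteq> u'" using A by metis
    have "b \<noteq> u'" "f \<noteq> v'" using ne A by auto
    moreover have "b \<noteq> u" "b \<noteq> v" "f \<noteq> u" "f \<noteq> v" "b \<noteq> f" using A uv D by metis+
    ultimately show ?thesis using D False \<open>f \<noteq> u'\<close>
      by (cases "x = b"; cases "x = f") (simp_all add: cap_def A uv)
  qed
qed

lemma cap_commute:
  assumes inv: "\<And>z. m (m z) = z" and ne: "m u \<noteq> u" "m u' \<noteq> u'" "m v \<noteq> v" "m v' \<noteq> v'"
    and d: "distinct [u, u', v, v']" and cup: "m u \<noteq> u'" "m v \<noteq> v'"
  shows "cap u u' (cap v v' m) = cap v v' (cap u u' m)"
proof -
  have inj: "m x = m y \<longleftrightarrow> x = y" for x y using inv by metis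
  have d': "distinct [u, u', v', v]" "distinct [u', u, v, v']" "distinct [u', u, v', v]" using d by auto
  have ucap: "cap u u' k = cap u' u k" if "k u \<noteq> k u'" for k using cap_swap d that by force
  have vcap: "cap v v' k = cap v' v k" if "k v \<noteq> k v'" for k using cap_swap d that by force
  have ucv: "cap v v' m u \<noteq> cap v v' m u'" and vcu: "cap u u' m v \<noteq> cap u u' m v'"
    using d inj by (auto simp: cap_def)
  have mm: "m u \<noteq> m u'" "m v \<noteq> m v'" using inj d by auto
  consider "m u = v" | "m u = v'" | "m u' = v" | "m u' = v'" | "m u \<notin> {v, v'}" "m u' \<notin> {v, v'}" by blast
  then show ?thesis
  proof cases
    case 1 show ?thesis by (rule cap_commute_linked[OF inv 1 ne(2,4) d])
  next
    case 2
    show ?thesis using cap_commute_linked[OF inv 2 ne(2,3) d'(1)] vcap[OF mm(2)] vcap[OF vcu] by simp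
  next
    case 3
    show ?thesis using cap_commute_linked[OF inv 3 ne(1,4) d'(2)] ucap[OF mm(1)] ucap[OF ucv] by simp
  next
    case 4
    show ?thesis using cap_commute_linked[OF inv 4 ne(1,3) d'(3)] ucap[OF mm(1)] vcap[OF mm(2)] ucap[OF ucv] vcap[OF vcu] by simp
  next
    case 5
    define a b e f where "a = m u" and "b = m u'" and "e = m v" and "f = m v'"
    have A: "m u = a" "m u' = b" "m v = e" "m v' = f" by (simp_all add: a_def b_def e_def f_def)
    have ne2: "a \<noteq> v" "a \<noteq> v'" "b \<noteq> v" "b \<noteq> v'" "e \<noteq> u" "e \<noteq> u'" "f \<noteq> u" "f \<noteq> u'"
      using 5 inv[of u] inv[of u'] inv[of v] inv[of v'] A by auto
    have ne3: "a \<noteq> b" "a \<noteq> e" "a \<noteq> f" "b \<noteq> e" "b \<noteq> f" "e \<noteq> f" using inj d by (auto simp: a_def b_def e_def f_def)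
    have ne4: "a \<noteq> u" "a \<noteq> u'" "b \<noteq> u'" "b \<noteq> u" "e \<noteq> v" "e \<noteq> v'" "f \<noteq> v'" "f \<noteq> v"
      using ne cup inv[of u] inv[of u'] inv[of v] inv[of v'] A by auto
    have D: "u \<noteq> u'" "u \<noteq> v" "u \<noteq> v'" "u' \<noteq> v" "u' \<noteq> v'" "v \<noteq> v'" using d by auto
    show ?thesis
    proof
      fix x
      note N = D ne2 ne3 ne4 D[symmetric] ne2[symmetric] ne3[symmetric] ne4[symmetric]
      show "cap u u' (cap v v' m) x = cap v v' (cap u u' m) x"
        by (simp add: cap_def A N)
    qed
  qed
qed

lemma matching_value_square:
  assumes "set (i # w) \<subseteq> {1..<n}"
  shows "matching_value q c n (i # i # w)
    = (- two_at q c i * fst (matching_value q c n (i # w)), snd (matching_value q c n (i # w)))"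
proof -
  define m where "m = snd (matching_value q c n (i # w))"
  have nc: "nc_matching (2 * n) m" unfolding m_def by (rule nc_matching_value[OF assms])
  have cup: "m (i - 1) = i" by (simp add: m_def case_prod_beta Let_def cap_def)
  show ?thesis using cap_same[OF nc cup] cup
    by (subst matching_value.simps(2)) (simp add: case_prod_beta Let_def m_def[symmetric] del: matching_value.simps)
qed

lemma matching_value_commute:
  assumes w: "set (i # j # w) \<subseteq> {1..<n}" and far: "i + 1 < j \<or> j + 1 < i"
  shows "matching_value q c n (i # j # w) = matching_value q c n (j # i # w)"
proof -
  obtain a m where am: "matching_value q c n w = (a, m)" by fastforce
  have nc: "nc_matching (2 * n) m" using nc_matching_value[of w n q c] w am by simp
  note D = nc_matchingD[OF nc]
  define u v where "u = i - 1" and "v = j - 1"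
  have uv: "i = Suc u" "j = Suc v" "Suc u < n" "Suc v < n" "Suc u < v \<or> Suc v < u" using w far by (auto simp: u_def v_def)
  let ?L = "\<lambda>u m. if m u = Suc u then - gap q c u else 1"
  have val: "matching_value q c n (Suc x # Suc y # w) = (?L x (cap y (Suc y) m) * (?L y m * a), cap x (Suc x) (cap y (Suc y) m))" for x y
    by (simp add: am)
  have sym: "?L u (cap v (Suc v) m) * (?L v m * a) = ?L v (cap u (Suc u) m) * (?L u m * a)
    \<and> cap u (Suc u) (cap v (Suc v) m) = cap v (Suc v) (cap u (Suc u) m)"
  proof (cases "m u = Suc u \<or> m v = Suc v")
    case True
    have *: "cap v (Suc v) m u = Suc u" if "m u = Suc u" "Suc u < v \<or> Suc v < u" for u v
    proof -
      have "m (Suc u) = u" using D(3)[of u] that by simp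
      then have "m v \<noteq> u" "m (Suc v) \<noteq> u" using D(3)[of v] D(3)[of "Suc v"] that by auto
      then show ?thesis using that by (auto simp: cap_def)
    qed
    from True show ?thesis
    proof
      assume t: "m u = Suc u"
      have "cap u (Suc u) (cap v (Suc v) m) = cap v (Suc v) m"
        by (rule cap_same[OF nc_matching_cap[OF nc]]) (use *[OF t] uv in auto)
      then show ?thesis using t *[OF t, of v] uv(5) cap_same[OF nc t] by (auto simp: algebra_simps)
    next
      assume t: "m v = Suc v"
      have "cap v (Suc v) (cap u (Suc u) m) = cap u (Suc u) m"
        by (rule cap_same[OF nc_matching_cap[OF nc]]) (use *[OF t] uv in auto)
      then show ?thesis using t *[OF t, of u] uv(5) cap_same[OF nc t] by (auto simp: algebra_simps)
    qed
  next
    case False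
    have c: "cap u (Suc u) (cap v (Suc v) m) = cap v (Suc v) (cap u (Suc u) m)"
      by (rule cap_commute) (use D(2,3) uv False in auto)
    have l: "cap v (Suc v) m u = Suc u \<longleftrightarrow> (m u = v \<and> m (Suc u) = Suc v) \<or> (m u = Suc v \<and> m (Suc u) = v)"
      if "Suc u < v \<or> Suc v < u" "m u \<noteq> Suc u" for u v
    proof -
      have e: "cap v (Suc v) m u = (if m v = u then m (Suc v) else if m (Suc v) = u then m v else m u)"
        using that by (auto simp: cap_def)
      have i: "m v = u \<longleftrightarrow> m u = v" "m v = Suc u \<longleftrightarrow> m (Suc u) = v" "m (Suc v) = u \<longleftrightarrow> m u = Suc v"
        "m (Suc v) = Suc u \<longleftrightarrow> m (Suc u) = Suc v" using D(3) by metis+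
      show ?thesis unfolding e using that(2) i by (simp split: if_splits)
    qed
    have sw: "(m u = v \<and> m (Suc u) = Suc v) \<or> (m u = Suc v \<and> m (Suc u) = v) \<longleftrightarrow>
       (m v = u \<and> m (Suc v) = Suc u) \<or> (m v = Suc u \<and> m (Suc v) = u)" using D(3) by metis
    show ?thesis
    proof (cases "(m u = v \<and> m (Suc u) = Suc v) \<or> (m u = Suc v \<and> m (Suc u) = v)")
      case True
      \<comment> \<open>Both strands run between the two caps, so whichever cap comes second closes
        the disk, once at u and once at v. Joined points have opposite parity, so both disks have
        the same value.\<close>
      have "m u \<noteq> v" using nc_matchingD(5)[OF nc, of u "Suc u"] nc_matchingD(5)[OF nc, of v "Suc v"] True D(3)[of u] D(3)[of "Suc u"] uv(5) by auto
      then have "even (Suc v) \<longleftrightarrow> odd u" using nc_matching_parity[OF nc, of u] True uv by auto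
      then have "gap q c u = gap q c v" by (intro two_at_cong) auto
      moreover have "cap v (Suc v) m u = Suc u" using l[of u v] uv(5) False True by blast
      moreover have "cap u (Suc u) m v = Suc v" using l[of v u] uv(5) False True sw by blast
      ultimately show ?thesis using False c by simp
    next
      case nl: False
      then have "cap v (Suc v) m u \<noteq> Suc u" using l[of u v] uv(5) False by blast
      moreover have "cap u (Suc u) m v \<noteq> Suc v" using l[of v u] uv(5) False nl sw by blast
      ultimately show ?thesis using False c by simp
    qed
  qed
  show ?thesis unfolding uv(1,2) val prod.inject by (rule sym)
qed

text \<open>The cup created by e_i is moved to position j and back by straightening, without closing
  a disk.\<close>

lemma matching_value_braid:
  assumes w: "set (i # j # w) \<subseteq> {1..<n}" and "j = i + 1 \<or> i = j + 1"
  shows "matching_value q c n (i # j # i # w) = matching_value q c n (i # w)"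
proof -
  have wi: "set (i # w) \<subseteq> {1..<n}" using w by auto
  define m where "m = snd (matching_value q c n (i # w))"
  define a where "a = fst (matching_value q c n (i # w))"
  have am: "matching_value q c n (i # w) = (a, m)" by (simp add: a_def m_def)
  have nc: "nc_matching (2 * n) m" unfolding m_def by (rule nc_matching_value[OF wi])
  define u where "u = i - 1"
  have u: "i = Suc u" "Suc u < n" using w by (auto simp: u_def)
  have cup: "m u = Suc u" by (simp add: m_def u_def case_prod_beta Let_def cap_def) (use u in simp)
  obtain n' where n': "2 * n = 2 * n' + 2" using u(2) by (cases n) auto
  define m0 where "m0 = rem u m"
  have m0: "nc_matching (2 * n') m0" unfolding m0_def using nc_matching_rem[of "2 * n'" m u] nc n' cup by simp
  have mi: "ins u m0 = m" unfolding m0_def by (rule ins_rem[OF nc cup])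
  show ?thesis
  proof (cases "j = i + 1")
    case True
    then have j: "j = Suc (Suc u)" using u by simp
    have "u < 2 * n'" using j w n' by auto
    have c1: "cap (Suc u) (Suc (Suc u)) m = ins (Suc u) m0" unfolding mi[symmetric] by (rule cap_Suc_ins[OF m0]) fact
    have c2: "cap u (Suc u) (ins (Suc u) m0) = m" unfolding mi[symmetric] by (rule cap_ins_Suc[OF m0]) fact
    have "m (Suc u) \<noteq> Suc (Suc u)" using cup nc_matchingD(3)[OF nc, of u] by simp
    moreover have "ins (Suc u) m0 u \<noteq> Suc u" using ins_simps(1)[of u "Suc u" m0] skip2_neq(1)[of "Suc u" "m0 u"] by simp
    ultimately show ?thesis using am c1 c2 unfolding j u(1) by simp
  next
    case False
    then obtain l where l: "u = Suc l" "j = Suc l" using assms u w by (cases u) auto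
    have "l < 2 * n'" using l u n' by auto
    have c1: "cap l (Suc l) m = ins l m0" unfolding mi[symmetric] l(1) by (rule cap_ins_Suc[OF m0]) fact
    have c2: "cap (Suc l) (Suc (Suc l)) (ins l m0) = m" unfolding mi[symmetric] l(1) by (rule cap_Suc_ins[OF m0]) fact
    have "m l \<noteq> Suc l" using cup nc_matchingD(3)[OF nc, of l] l(1) by auto
    moreover have "ins l m0 (Suc l) \<noteq> Suc (Suc l)" by simp
    ultimately show ?thesis using am c1 c2 unfolding u(1) l by simp
  qed
qed

section \<open>Translation of matchings into diagrams\<close>

definition point :: "nat \<Rightarrow> nat \<Rightarrow> boundary_point" where
  "point n x = (if x < n then Top (x + 1) else Bot (2 * n - x))"

lemma point_eq_iff: "x < 2 * n \<Longrightarrow> y < 2 * n \<Longrightarrow> point n x = point n y \<longleftrightarrow> x = y"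
  by (auto simp: point_def)

definition strands :: "nat \<Rightarrow> (nat \<Rightarrow> nat) \<Rightarrow> diagram" where
  "strands n m = (\<lambda>x. {point n x, point n (m x)}) ` {..<2 * n}"

lemma strand_mem_iff:
  assumes m: "nc_matching (2 * n) m" and "x < 2 * n" "y < 2 * n"
  shows "{point n x, point n y} \<in> strands n m \<longleftrightarrow> m x = y"
proof
  assume "{point n x, point n y} \<in> strands n m"
  then obtain z where z: "z < 2 * n" "{point n x, point n y} = {point n z, point n (m z)}" by (auto simp: strands_def)
  then have "x = z \<and> y = m z \<or> x = m z \<and> y = z"
    using point_eq_iff assms(2,3) nc_matchingD(1)[OF m, of z] unfolding doubleton_eq_iff by auto
  then show "m x = y" using nc_matchingD(3)[OF m] by auto
next
  assume "m x = y" then show "{point n x, point n y} \<in> strands n m" using assms(2) by (auto simp: strands_def)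
qed

lemma strands_inject:
  assumes "nc_matching (2 * n) m" "nc_matching (2 * n) m'" "strands n m = strands n m'"
  shows "m = m'"
proof
  fix x show "m x = m' x"
  proof (cases "x < 2 * n")
    case True
    then have "{point n x, point n (m x)} \<in> strands n m'" unfolding assms(3)[symmetric] by (auto simp: strands_def)
    then show ?thesis using strand_mem_iff[OF assms(2) True] nc_matchingD(1)[OF assms(1) True] by simp
  next
    case False
    then show ?thesis using nc_matchingD(4)[OF assms(1), of x] nc_matchingD(4)[OF assms(2), of x] by simp
  qed
qed

lemma strands_rainbow: "strands n (rainbow n) = id_diagram n"
proof (intro equalityI subsetI)
  fix b assume "b \<in> strands n (rainbow n)"
  then obtain x where x: "x < 2 * n" "b = {point n x, point n (rainbow n x)}" by (auto simp: strands_def)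
  show "b \<in> id_diagram n"
  proof (cases "x < n")
    case True
    then have "b = {Bot (x + 1), Top (x + 1)}" using x by (auto simp: point_def rainbow_def)
    then show ?thesis using True by (auto simp: id_diagram_def)
  next
    case False
    then have "b = {Bot (2 * n - x), Top (2 * n - x)}" using x by (auto simp: point_def rainbow_def)
    moreover have "2 * n - x \<in> {1..n}" using False x by auto
    ultimately show ?thesis by (auto simp: id_diagram_def)
  qed
next
  fix b assume "b \<in> id_diagram n"
  then obtain i where "1 \<le> i" "i \<le> n" "b = {Bot i, Top i}" by (auto simp: id_diagram_def)
  then show "b \<in> strands n (rainbow n)" unfolding strands_def
    by (intro image_eqI[of _ _ "i - 1"]) (auto simp: point_def rainbow_def)
qed

lemma stack_gen_strands:
  assumes m: "nc_matching (2 * n) m" and u: "Suc u < n" and "m u \<noteq> Suc u"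
  shows "stack_gen (Suc u) (strands n m) = strands n (cap u (Suc u) m)"
proof -
  note D = nc_matchingD[OF m]
  have N: "u < 2 * n" "Suc u < 2 * n" using u by auto
  define a b where "a = m u" and "b = m (Suc u)"
  have ab: "a < 2 * n" "b < 2 * n" "m a = u" "m b = Suc u" using D N by (auto simp: a_def b_def)
  have ne: "a \<noteq> u" "a \<noteq> Suc u" "b \<noteq> u" "b \<noteq> Suc u" "a \<noteq> b"
    using assms(3) D(2)[OF N(1)] D(2)[OF N(2)] D(7)[of u "Suc u"] D(3)[of u] D(3)[of "Suc u"] by (auto simp: a_def b_def)
  let ?p = "point n"
  have T: "Top (Suc u) = ?p u" "Top (Suc u + 1) = ?p (Suc u)" using u by (auto simp: point_def)
  let ?T = "{?p u, ?p (Suc u)}"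
  have meets: "{?p x, ?p (m x)} \<inter> ?T \<noteq> {} \<longleftrightarrow> x \<in> {u, Suc u, a, b}" if "x < 2 * n" for x
  proof -
    have "m x = u \<longleftrightarrow> x = a" "m x = Suc u \<longleftrightarrow> x = b" using D(3) a_def b_def by metis+
    then show ?thesis using point_eq_iff[OF that N(1)] point_eq_iff[OF that N(2)]
      point_eq_iff[OF D(1)[OF that] N(1)] point_eq_iff[OF D(1)[OF that] N(2)] by auto
  qed
  have rest: "{s \<in> strands n m. s \<inter> ?T = {}} = (\<lambda>x. {?p x, ?p (m x)}) ` ({..<2 * n} - {u, Suc u, a, b})"
    using meets by (auto simp: strands_def)
  have "{s \<in> strands n m. s \<inter> ?T \<noteq> {}} = (\<lambda>x. {?p x, ?p (m x)}) ` {u, Suc u, a, b}"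
  proof (intro equalityI subsetI)
    fix s assume "s \<in> {s \<in> strands n m. s \<inter> ?T \<noteq> {}}"
    then obtain x where "x < 2 * n" "s = {?p x, ?p (m x)}" "s \<inter> ?T \<noteq> {}" by (auto simp: strands_def)
    then show "s \<in> (\<lambda>x. {?p x, ?p (m x)}) ` {u, Suc u, a, b}" using meets by blast
  next
    fix s assume "s \<in> (\<lambda>x. {?p x, ?p (m x)}) ` {u, Suc u, a, b}"
    then obtain x where x: "x \<in> {u, Suc u, a, b}" "s = {?p x, ?p (m x)}" by blast
    then have "x < 2 * n" using N ab by auto
    then show "s \<in> {s \<in> strands n m. s \<inter> ?T \<noteq> {}}" using meets x by (auto simp: strands_def)
  qed
  also have "\<dots> = {{?p u, ?p a}, {?p (Suc u), ?p b}}"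
    using ab by (auto simp: a_def[symmetric] b_def[symmetric] insert_commute)
  finally have e: "{s \<in> strands n m. s \<inter> ?T \<noteq> {}} = {{?p u, ?p a}, {?p (Suc u), ?p b}}" .
  have "\<Union>{s \<in> strands n m. s \<inter> ?T \<noteq> {}} - ?T = {?p u, ?p a, ?p (Suc u), ?p b} - ?T" unfolding e by auto
  also have "\<dots> = {?p a, ?p b}"
    using ne point_eq_iff[OF ab(1) N(1)] point_eq_iff[OF ab(1) N(2)] point_eq_iff[OF ab(2) N(1)] point_eq_iff[OF ab(2) N(2)] by auto
  finally have U: "\<Union>{s \<in> strands n m. s \<inter> ?T \<noteq> {}} - ?T = {?p a, ?p b}" .
  have c: "cap u (Suc u) m x = (if x = u then Suc u else if x = Suc u then u else if x = a then b else if x = b then a else m x)" for x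
    by (simp add: cap_def a_def b_def)
  have "{..<2 * n} = ({..<2 * n} - {u, Suc u, a, b}) \<union> {u, Suc u, a, b}" using N ab by auto
  then have "strands n (cap u (Suc u) m) = (\<lambda>x. {?p x, ?p (cap u (Suc u) m x)}) ` ({..<2 * n} - {u, Suc u, a, b})
      \<union> (\<lambda>x. {?p x, ?p (cap u (Suc u) m x)}) ` {u, Suc u, a, b}" unfolding strands_def by (metis image_Un)
  also have "(\<lambda>x. {?p x, ?p (cap u (Suc u) m x)}) ` ({..<2 * n} - {u, Suc u, a, b}) = (\<lambda>x. {?p x, ?p (m x)}) ` ({..<2 * n} - {u, Suc u, a, b})"
    by (rule image_cong[OF HOL.refl]) (simp add: c)
  also have "(\<lambda>x. {?p x, ?p (cap u (Suc u) m x)}) ` {u, Suc u, a, b} = {?T, {?p a, ?p b}}"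
    using ne by (simp add: c insert_commute)
  finally show ?thesis unfolding stack_gen_def T rest U by simp
qed

lemma word_value_matching:
  "set w \<subseteq> {1..<n} \<Longrightarrow> word_value q c n w = (fst (matching_value q c n w), strands n (snd (matching_value q c n w)))"
proof (induction w)
  case Nil then show ?case by (simp add: strands_rainbow)
next
  case (Cons i w)
  obtain a m where am: "matching_value q c n w = (a, m)" by fastforce
  have nc: "nc_matching (2 * n) m" using nc_matching_value[of w n q c] Cons.prems am by simp
  define u where "u = i - 1"
  have u: "i = Suc u" "Suc u < n" using Cons.prems by (auto simp: u_def)
  have T: "{Top i, Top (i + 1)} \<in> strands n m \<longleftrightarrow> m u = Suc u"
    using strand_mem_iff[OF nc, of u "Suc u"] u by (simp add: point_def)
  have "word_value q c n w = (a, strands n m)" using Cons am by simp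
  then show ?case using T u cap_same[OF nc, of u "Suc u"] stack_gen_strands[OF nc u(2)] am by simp
qed

text \<open>In the numbering by \<open>point\<close>, \<open>rot2\<close> is the cyclic shift by
  one, and \<open>rot1\<close> is its inverse.\<close>

lemma rot2_strands:
  assumes m: "nc_matching (2 * n) m"
  shows "(`) (rot2 n) ` strands n m = strands n (rot (2 * n) m)"
proof -
  have p: "rot2 n (point n x) = point n (Suc x mod (2 * n))" if "x < 2 * n" for x
    using that by (auto simp: point_def Suc_mod)
  have "(`) (rot2 n) ` strands n m = (\<lambda>x. {point n (Suc x mod (2 * n)), point n (rot (2 * n) m (Suc x mod (2 * n)))}) ` {..<2 * n}"
    unfolding strands_def image_image by (rule image_cong[OF HOL.refl]) (simp add: p nc_matchingD(1)[OF m] rot_Suc)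
  also have "\<dots> = (\<lambda>y. {point n y, point n (rot (2 * n) m y)}) ` ((\<lambda>x. Suc x mod (2 * n)) ` {..<2 * n})"
    by (simp add: image_image)
  also have "(\<lambda>x. Suc x mod (2 * n)) ` {..<2 * n} = {..<2 * n}"
  proof (intro equalityI subsetI)
    fix y assume "y \<in> {..<2 * n}"
    then show "y \<in> (\<lambda>x. Suc x mod (2 * n)) ` {..<2 * n}"
      by (intro image_eqI[of _ _ "if y = 0 then 2 * n - 1 else y - 1"]) auto
  qed auto
  finally show ?thesis by (simp add: strands_def)
qed

lemma rot1_strands:
  assumes m: "nc_matching (2 * n) m"
  shows "(`) (rot1 n) ` strands n (rot (2 * n) m) = strands n m"
proof -
  have "rot1 n (rot2 n (point n x)) = point n x" if "x < 2 * n" for x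
    using that by (auto simp: point_def)
  then have "(`) (rot1 n) ` ((`) (rot2 n) ` strands n m) = strands n m"
    unfolding strands_def image_image using nc_matchingD(1)[OF m] by (intro image_cong[OF HOL.refl]) simp
  then show ?thesis by (simp only: rot2_strands[OF m])
qed


section \<open>The expansion of the Temperley--Lieb algebra\<close>

abbreviation "lookup \<equiv> Poly_Mapping.lookup"
abbreviation "single \<equiv> Poly_Mapping.single"
abbreviation "support \<equiv> Poly_Mapping.keys"

text \<open>Common form of the expansion, of stacking and of the rotations. The map \<open>h\<close>
  takes the coefficient as an argument, so additivity of \<open>h\<close> in it makes the extension
  additive.\<close>

definition spread :: "('b \<Rightarrow> 'a::comm_ring_1 \<Rightarrow> ('c \<Rightarrow>\<^sub>0 'a)) \<Rightarrow> ('b \<Rightarrow>\<^sub>0 'a) \<Rightarrow> ('c \<Rightarrow>\<^sub>0 'a)" where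
  "spread h f = (\<Sum>k\<in>support f. h k (lookup f k))"

lemma spread_superset:
  assumes "\<And>k. h k 0 = 0" "finite S" "support f \<subseteq> S"
  shows "spread h f = (\<Sum>k\<in>S. h k (lookup f k))"
  unfolding spread_def using assms by (intro sum.mono_neutral_left) (auto simp: in_keys_iff)

lemma spread_add:
  assumes "\<And>k. h k 0 = 0" "\<And>k a b. h k (a + b) = h k a + h k b"
  shows "spread h (f + g) = spread h f + spread h g"
proof -
  let ?S = "support f \<union> support g"
  have "spread h x = (\<Sum>k\<in>?S. h k (lookup x k))" if "x \<in> {f, g, f + g}" for x
    using that keys_add[of f g] by (intro spread_superset assms) auto
  then show ?thesis by (simp add: lookup_add assms sum.distrib)
qed

lemma spread_single: "h k 0 = 0 \<Longrightarrow> spread h (single k a) = h k a"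
  by (simp add: spread_def)

lemma poly_mapping_eq_sum: "f = (\<Sum>k\<in>support f. single k (lookup f k))"
  by (rule poly_mapping_eqI) (simp add: lookup_sum lookup_single when_def in_keys_iff)

lemma additive_sum:
  assumes "F 0 = 0" "\<And>f g. F (f + g) = F f + F g"
  shows "F (sum f A) = (\<Sum>x\<in>A. F (f x))"
  by (induction A rule: infinite_finite_induct) (simp_all add: assms)

context
  fixes q :: "color \<Rightarrow> 'a::comm_ring_1" and c :: color and n :: nat
begin

lemma free_expansion_spread:
  "free_expansion q c n = spread (\<lambda>w a. single (snd (word_value q c n (letters w))) (a * fst (word_value q c n (letters w))))"
  by (rule ext) (simp add: free_expansion_def spread_def case_prod_beta Let_def)

lemma free_expansion_add: "free_expansion q c n (x + y) = free_expansion q c n x + free_expansion q c n y"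
  unfolding free_expansion_spread by (rule spread_add) (simp_all add: distrib_right single_add)

lemma free_expansion_single: "free_expansion q c n (single w a) = single (snd (word_value q c n (letters w))) (a * fst (word_value q c n (letters w)))"
  unfolding free_expansion_spread by (rule spread_single) simp

lemma free_expansion_zero: "free_expansion q c n 0 = 0"
  by (simp add: free_expansion_def)

lemma free_expansion_minus: "free_expansion q c n (x - y) = free_expansion q c n x - free_expansion q c n y"
  using free_expansion_add[of "x - y" y] by (simp add: algebra_simps)

lemma free_expansion_sum: "free_expansion q c n (sum f A) = (\<Sum>x\<in>A. free_expansion q c n (f x))"
  by (rule additive_sum) (simp_all add: free_expansion_zero free_expansion_add)

definition stack_lin :: "nat \<Rightarrow> (diagram \<Rightarrow>\<^sub>0 'a) \<Rightarrow> (diagram \<Rightarrow>\<^sub>0 'a)" where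
  "stack_lin i = spread (\<lambda>d a. if {Top i, Top (i + 1)} \<in> d then single d (- two_at q c i * a) else single (stack_gen i d) a)"

lemma stack_lin_add: "stack_lin i (f + g) = stack_lin i f + stack_lin i g"
  unfolding stack_lin_def
proof (rule spread_add)
  fix d :: diagram and a b :: 'a
  have "single d (- two_at q c i * (a + b)) = single d (- two_at q c i * a) + single d (- two_at q c i * b)"
    by (simp only: distrib_left single_add)
  then show "(if {Top i, Top (i + 1)} \<in> d then single d (- two_at q c i * (a + b)) else single (stack_gen i d) (a + b))
    = (if {Top i, Top (i + 1)} \<in> d then single d (- two_at q c i * a) else single (stack_gen i d) a)
    + (if {Top i, Top (i + 1)} \<in> d then single d (- two_at q c i * b) else single (stack_gen i d) b)"
    by (simp only: single_add split: if_split) blast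
qed simp

lemma stack_lin_zero: "stack_lin i 0 = 0"
  by (simp add: stack_lin_def spread_def)

lemma stack_lin_single: "stack_lin i (single d a) = (if {Top i, Top (i + 1)} \<in> d then single d (- two_at q c i * a) else single (stack_gen i d) a)"
  unfolding stack_lin_def by (rule spread_single) simp

lemma gen_times_single: "free_gen i * single (Word w) a = single (Word (i # w)) a"
  by (simp add: free_gen_def mult_single plus_tl_word_def)

text \<open>Words are evaluated from their last letter upwards, so a new first letter is stacked on
  the value of the rest. This is why left multiplication descends to expansions.\<close>

lemma free_expansion_gen: "free_expansion q c n (free_gen i * x) = stack_lin i (free_expansion q c n x)"
proof -
  have "free_expansion q c n (free_gen i * x) = (\<Sum>w\<in>support x. free_expansion q c n (free_gen i * single w (lookup x w)))"
    by (subst poly_mapping_eq_sum[of x]) (simp only: sum_distrib_left free_expansion_sum)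
  also have "\<dots> = (\<Sum>w\<in>support x. stack_lin i (free_expansion q c n (single w (lookup x w))))"
  proof (rule sum.cong[OF HOL.refl])
    fix w
    obtain l where w: "w = Word l" by (cases w)
    show "free_expansion q c n (free_gen i * single w (lookup x w)) = stack_lin i (free_expansion q c n (single w (lookup x w)))"
      unfolding w gen_times_single free_expansion_single stack_lin_single
      by (simp add: case_prod_beta Let_def algebra_simps)
  qed
  also have "\<dots> = stack_lin i (free_expansion q c n x)"
    by (subst (3) poly_mapping_eq_sum[of x]) (simp only: free_expansion_sum additive_sum[of "stack_lin i", OF stack_lin_zero stack_lin_add])
  finally show ?thesis .
qed

lemma keys_free_alg: "x \<in> carrier (free_alg n) \<longleftrightarrow> (\<forall>w\<in>support x. set (letters w) \<subseteq> {1..<n})"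
  by (simp add: free_alg_def)

lemma ring_free_alg: "ring (free_alg n :: (tl_word \<Rightarrow>\<^sub>0 'a) ring)"
proof (rule ringI)
  show "abelian_group (free_alg n :: (tl_word \<Rightarrow>\<^sub>0 'a) ring)"
  proof (rule abelian_groupI)
    fix x y :: "tl_word \<Rightarrow>\<^sub>0 'a" assume x: "x \<in> carrier (free_alg n)"
    { assume "y \<in> carrier (free_alg n)"
      then show "x \<oplus>\<^bsub>free_alg n\<^esub> y \<in> carrier (free_alg n)"
        using x keys_add[of x y] unfolding keys_free_alg by (auto simp: free_alg_def) }
    show "\<exists>y\<in>carrier (free_alg n). y \<oplus>\<^bsub>free_alg n\<^esub> x = \<zero>\<^bsub>free_alg n\<^esub>"
      by (rule bexI[of _ "- x"]) (use x in \<open>auto simp: free_alg_def\<close>)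
  qed (auto simp: free_alg_def algebra_simps)
  show "Group.monoid (free_alg n :: (tl_word \<Rightarrow>\<^sub>0 'a) ring)"
  proof (rule monoidI)
    fix x y :: "tl_word \<Rightarrow>\<^sub>0 'a" assume "x \<in> carrier (free_alg n)" "y \<in> carrier (free_alg n)"
    then have "set (letters w) \<subseteq> {1..<n}" if "w \<in> support (x * y)" for w
      using that keys_mult[of x y] unfolding keys_free_alg by (fastforce simp: plus_tl_word_def)
    then show "x \<otimes>\<^bsub>free_alg n\<^esub> y \<in> carrier (free_alg n)" by (simp add: free_alg_def)
  next
    have "support (1 :: tl_word \<Rightarrow>\<^sub>0 'a) \<subseteq> {0}" by (metis keys_single single_one empty_subsetI order_refl)
    then show "\<one>\<^bsub>free_alg n\<^esub> \<in> carrier (free_alg n :: (tl_word \<Rightarrow>\<^sub>0 'a) ring)"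
      by (auto simp: free_alg_def zero_tl_word_def)
  qed (auto simp: free_alg_def algebra_simps)
qed (auto simp: free_alg_def algebra_simps)

lemma free_alg_closed:
  fixes x y :: "tl_word \<Rightarrow>\<^sub>0 'a"
  assumes "x \<in> carrier (free_alg n)" "y \<in> carrier (free_alg n)"
  shows "x + y \<in> carrier (free_alg n)" "x * y \<in> carrier (free_alg n)" "- x \<in> carrier (free_alg n)" "x - y \<in> carrier (free_alg n)"
proof -
  interpret ring "free_alg n :: (tl_word \<Rightarrow>\<^sub>0 'a) ring" by (rule ring_free_alg)
  show "x + y \<in> carrier (free_alg n)" "x * y \<in> carrier (free_alg n)"
    using a_closed[OF assms] m_closed[OF assms] by (simp_all add: free_alg_def)
  have n: "- x \<in> carrier (free_alg n)" if "x \<in> carrier (free_alg n)" for x :: "tl_word \<Rightarrow>\<^sub>0 'a"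
    using that by (simp add: free_alg_def)
  show "- x \<in> carrier (free_alg n)" using n assms by blast
  show "x - y \<in> carrier (free_alg n)" using a_closed[OF assms(1) n[OF assms(2)]] by (simp add: free_alg_def)
qed

lemma free_alg_single: "set w \<subseteq> {1..<n} \<Longrightarrow> single (Word w) a \<in> carrier (free_alg n :: (tl_word \<Rightarrow>\<^sub>0 'a) ring)"
  by (simp add: free_alg_def)

lemma free_alg_gen: "i \<in> {1..<n} \<Longrightarrow> (free_gen i :: tl_word \<Rightarrow>\<^sub>0 'a) \<in> carrier (free_alg n)"
  unfolding free_gen_def by (rule free_alg_single) simp

lemma free_alg_sum:
  "(\<And>x. x \<in> A \<Longrightarrow> (f x :: tl_word \<Rightarrow>\<^sub>0 'a) \<in> carrier (free_alg n)) \<Longrightarrow> sum f A \<in> carrier (free_alg n)"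
proof (induction A rule: infinite_finite_induct)
  case (insert x A) then show ?case by (simp add: free_alg_closed)
qed (simp_all add: free_alg_def)

lemma free_scalar_single: "free_scalar a * single w b = single w (a * b)"
  by (simp add: free_scalar_def mult_single)

lemma relators_carrier: "tl_relators q c n \<subseteq> carrier (free_alg n)"
proof -
  have s: "free_scalar a \<in> carrier (free_alg n :: (tl_word \<Rightarrow>\<^sub>0 'a) ring)" for a
    unfolding free_scalar_def zero_tl_word_def by (rule free_alg_single) simp
  show ?thesis unfolding tl_relators_def using free_alg_gen s by (auto intro!: free_alg_closed)
qed

lemma ideal_tl: "ideal (tl_ideal q c n) (free_alg n)"
  unfolding tl_ideal_def by (rule ring.genideal_ideal[OF ring_free_alg relators_carrier])

lemma relator_in_ideal: "r \<in> tl_relators q c n \<Longrightarrow> r \<in> tl_ideal q c n"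
  unfolding tl_ideal_def using ring.genideal_self[OF ring_free_alg relators_carrier] by blast

lemma ideal_closed:
  shows "0 \<in> tl_ideal q c n" "x \<in> tl_ideal q c n \<Longrightarrow> x \<in> carrier (free_alg n)"
    "x \<in> tl_ideal q c n \<Longrightarrow> y \<in> tl_ideal q c n \<Longrightarrow> x + y \<in> tl_ideal q c n"
    "x \<in> tl_ideal q c n \<Longrightarrow> y \<in> carrier (free_alg n) \<Longrightarrow> y * x \<in> tl_ideal q c n"
    "x \<in> tl_ideal q c n \<Longrightarrow> y \<in> carrier (free_alg n) \<Longrightarrow> x * y \<in> tl_ideal q c n"
    "x \<in> tl_ideal q c n \<Longrightarrow> - x \<in> tl_ideal q c n"
proof -
  interpret ideal "tl_ideal q c n" "free_alg n" by (rule ideal_tl)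
  show "0 \<in> tl_ideal q c n" using additive_subgroup.zero_closed[OF ideal.axioms(1)[OF ideal_tl]] by (simp add: free_alg_def)
  show "x \<in> tl_ideal q c n \<Longrightarrow> x \<in> carrier (free_alg n)" by (rule a_Hcarr)
  show "x \<in> tl_ideal q c n \<Longrightarrow> y \<in> tl_ideal q c n \<Longrightarrow> x + y \<in> tl_ideal q c n"
    using additive_subgroup.a_closed[OF ideal.axioms(1)[OF ideal_tl], of x y] by (simp add: free_alg_def)
  show l: "y * x \<in> tl_ideal q c n" if "x \<in> tl_ideal q c n" "y \<in> carrier (free_alg n)" for x y
    using I_l_closed[OF that] by (simp add: free_alg_def)
  show "x \<in> tl_ideal q c n \<Longrightarrow> y \<in> carrier (free_alg n) \<Longrightarrow> x * y \<in> tl_ideal q c n"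
    using I_r_closed[of x y] by (simp add: free_alg_def)
  show "- x \<in> tl_ideal q c n" if "x \<in> tl_ideal q c n"
  proof -
    have "- 1 \<in> carrier (free_alg n :: (tl_word \<Rightarrow>\<^sub>0 'a) ring)"
      using free_alg_closed(3)[OF one_closed one_closed] by (simp add: free_alg_def)
    from l[OF that this] show ?thesis by simp
  qed
qed

lemma ideal_sum: "(\<And>x. x \<in> A \<Longrightarrow> f x \<in> tl_ideal q c n) \<Longrightarrow> sum f A \<in> tl_ideal q c n"
  by (induction A rule: infinite_finite_induct) (simp_all add: ideal_closed)

text \<open>The appended word is the start of the evaluation, so the claim holds for relators
  stacked on arbitrary diagrams, as required for right multiples in the ideal.\<close>

lemma relator_expansion:
  assumes r: "r \<in> tl_relators q c n" and w: "set w \<subseteq> {1..<n}"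
  shows "free_expansion q c n (r * single (Word w) 1) = 0"
  using r unfolding tl_relators_def
proof (elim UnE CollectE exE conjE)
  fix i assume i: "i \<in> {1..<n}" and r: "r = free_gen i * free_gen i + free_scalar (two_at q c i) * free_gen i"
  have iw: "set (i # w) \<subseteq> {1..<n}" "set (i # i # w) \<subseteq> {1..<n}" using i w by auto
  have "r * single (Word w) 1 = single (Word (i # i # w)) 1 + single (Word (i # w)) (two_at q c i)"
    by (simp add: r distrib_right mult.assoc gen_times_single free_scalar_single)
  then show ?thesis
    using matching_value_square[OF iw(1), of q c]
    by (simp only: free_expansion_add free_expansion_single tl_word.sel word_value_matching[OF iw(1)] word_value_matching[OF iw(2)] fst_conv snd_conv)
      (simp add: single_add[symmetric])
next
  fix i j assume ij: "i \<in> {1..<n}" "j \<in> {1..<n}" "i + 1 < j \<or> j + 1 < i" and r: "r = free_gen i * free_gen j - free_gen j * free_gen i"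
  have iw: "set (i # j # w) \<subseteq> {1..<n}" "set (j # i # w) \<subseteq> {1..<n}" using ij w by auto
  have "r * single (Word w) 1 = single (Word (i # j # w)) 1 - single (Word (j # i # w)) 1"
    by (simp add: r left_diff_distrib mult.assoc gen_times_single)
  then show ?thesis
    using matching_value_commute[OF iw(1) ij(3), of q c]
    by (simp only: free_expansion_minus free_expansion_single tl_word.sel word_value_matching[OF iw(1)] word_value_matching[OF iw(2)]) simp
next
  fix i j assume ij: "i \<in> {1..<n}" "j \<in> {1..<n}" "j = i + 1 \<or> i = j + 1" and r: "r = free_gen i * free_gen j * free_gen i - free_gen i"
  have iw: "set (i # j # w) \<subseteq> {1..<n}" "set (i # j # i # w) \<subseteq> {1..<n}" "set (i # w) \<subseteq> {1..<n}" using ij w by auto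
  have "r * single (Word w) 1 = single (Word (i # j # i # w)) 1 - single (Word (i # w)) 1"
    by (simp add: r left_diff_distrib mult.assoc gen_times_single)
  then show ?thesis
    using matching_value_braid[OF iw(1) ij(3), of q c]
    by (simp only: free_expansion_minus free_expansion_single tl_word.sel word_value_matching[OF iw(2)] word_value_matching[OF iw(3)]) simp
qed

lemma free_expansion_scale: "free_expansion q c n (single 0 a * x) = spread (\<lambda>d b. single d (a * b)) (free_expansion q c n x)"
proof -
  let ?h = "\<lambda>d b. single d (a * b)"
  have h: "spread ?h 0 = 0" "spread ?h (f + g) = spread ?h f + spread ?h g" for f g
    by (simp add: spread_def, rule spread_add) (simp_all add: distrib_left single_add)
  have "free_expansion q c n (single 0 a * x) = (\<Sum>w\<in>support x. free_expansion q c n (single 0 a * single w (lookup x w)))"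
    by (subst poly_mapping_eq_sum[of x]) (simp only: sum_distrib_left free_expansion_sum)
  also have "\<dots> = (\<Sum>w\<in>support x. spread ?h (free_expansion q c n (single w (lookup x w))))"
    by (rule sum.cong[OF HOL.refl]) (simp add: mult_single free_expansion_single spread_single mult.assoc)
  also have "\<dots> = spread ?h (free_expansion q c n x)"
    by (subst (3) poly_mapping_eq_sum[of x]) (simp only: free_expansion_sum additive_sum[of "spread ?h", OF h])
  finally show ?thesis .
qed

lemma free_expansion_left_zero:
  fixes x y :: "tl_word \<Rightarrow>\<^sub>0 'a"
  assumes "free_expansion q c n x = 0" shows "free_expansion q c n (y * x) = 0"
proof -
  have w: "free_expansion q c n (single (Word w) 1 * x) = 0" for w
  proof (induction w)
    case Nil
    have "single (Word []) (1::'a) = 1" by (simp flip: zero_tl_word_def)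
    then show ?case using assms by simp
  next
    case (Cons i w)
    have "single (Word (i # w)) 1 * x = free_gen i * (single (Word w) 1 * x)"
      by (simp add: gen_times_single mult.assoc[symmetric])
    then show ?case by (simp add: free_expansion_gen Cons stack_lin_zero)
  qed
  have "free_expansion q c n (single w a * x) = 0" for w a
  proof -
    obtain l where l: "w = Word l" by (cases w)
    have "single w a * x = single 0 a * (single (Word l) 1 * x)" by (simp add: mult.assoc[symmetric] mult_single l)
    then show ?thesis by (simp add: free_expansion_scale w spread_def)
  qed
  then have "(\<Sum>k\<in>support y. free_expansion q c n (single k (lookup y k) * x)) = 0" by simp
  then show ?thesis
    by (subst poly_mapping_eq_sum[of y]) (simp only: sum_distrib_right free_expansion_sum)
qed

lemma ideal_expansion:
  assumes "x \<in> tl_ideal q c n" shows "free_expansion q c n x = 0"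
proof -
  \<comment> \<open>Left multiples are covered by \<open>free_expansion_left_zero\<close>. Demanding
    the vanishing after every appended word makes \<open>K\<close> stable under right multiples as
    well, so it is a two-sided ideal.\<close>
  define K where "K = {x \<in> carrier (free_alg n). \<forall>w. set w \<subseteq> {1..<n} \<longrightarrow> free_expansion q c n (x * single (Word w) 1) = 0}"
  have "ideal K (free_alg n)"
  proof (rule idealI[OF ring_free_alg])
    have neg: "free_expansion q c n (- x) = - free_expansion q c n x" for x using free_expansion_minus[of 0 x] by (simp add: free_expansion_zero)
    show "subgroup K (add_monoid (free_alg n))"
    proof (rule group.subgroupI)
      show "Group.group (add_monoid (free_alg n :: (tl_word \<Rightarrow>\<^sub>0 'a) ring))"
        using ring.is_abelian_group[OF ring_free_alg] abelian_group.a_group by blast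
      show "K \<noteq> {}" using free_expansion_zero by (auto simp: K_def free_alg_def intro!: exI[of _ 0])
      fix x assume x: "x \<in> K"
      have "inv\<^bsub>add_monoid (free_alg n)\<^esub> x = - x"
      proof (rule group.inv_equality)
        show "Group.group (add_monoid (free_alg n :: (tl_word \<Rightarrow>\<^sub>0 'a) ring))"
          using ring.is_abelian_group[OF ring_free_alg] abelian_group.a_group by blast
      qed (use x in \<open>auto simp: K_def free_alg_def\<close>)
      then show "inv\<^bsub>add_monoid (free_alg n)\<^esub> x \<in> K"
        using x by (auto simp: K_def neg free_alg_closed)
      fix y assume "y \<in> K"
      then have "x + y \<in> K" using x by (auto simp: K_def distrib_right free_expansion_add free_alg_closed)
      then show "x \<otimes>\<^bsub>add_monoid (free_alg n)\<^esub> y \<in> K" by (simp add: free_alg_def)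
    qed (auto simp: K_def)
    fix x y :: "tl_word \<Rightarrow>\<^sub>0 'a"
    assume x: "x \<in> K" and y: "y \<in> carrier (free_alg n)"
    have "y * x \<in> K" using x y free_expansion_left_zero by (auto simp: K_def free_alg_closed mult.assoc)
    then show "y \<otimes>\<^bsub>free_alg n\<^esub> x \<in> K" by (simp add: free_alg_def)
    have "free_expansion q c n (x * y * single (Word w) 1) = 0" if w: "set w \<subseteq> {1..<n}" for w
    proof -
      have "free_expansion q c n (x * (single k a * single (Word w) 1)) = 0" if "k \<in> support y" for k a
      proof -
        obtain l where l: "k = Word l" by (cases k)
        have "set (letters k) \<subseteq> {1..<n}" using y that unfolding keys_free_alg by blast
        then have "set (l @ w) \<subseteq> {1..<n}" using w l by simp
        then have "free_expansion q c n (x * single (Word (l @ w)) 1) = 0" using x by (auto simp: K_def)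
        moreover have "x * (single k a * single (Word w) 1) = single 0 a * (x * single (Word (l @ w)) 1)"
        proof -
          have "single 0 a * z = z * single 0 a" for z :: "tl_word \<Rightarrow>\<^sub>0 'a"
          proof -
            have "single 0 a * z = (\<Sum>k\<in>support z. single 0 a * single k (lookup z k))"
              by (subst poly_mapping_eq_sum[of z]) (simp only: sum_distrib_left)
            also have "\<dots> = (\<Sum>k\<in>support z. single k (lookup z k) * single 0 a)" by (simp add: mult_single mult.commute)
            also have "\<dots> = z * single 0 a" by (subst (3) poly_mapping_eq_sum[of z]) (simp only: sum_distrib_right)
            finally show ?thesis .
          qed
          then have "single 0 a * (x * single (Word (l @ w)) 1) = x * (single 0 a * single (Word (l @ w)) 1)" by (metis mult.assoc)
          then show ?thesis by (simp add: mult_single l plus_tl_word_def zero_tl_word_def)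
        qed
        ultimately show ?thesis by (simp add: free_expansion_scale spread_def)
      qed
      then have "(\<Sum>k\<in>support y. free_expansion q c n (x * (single k (lookup y k) * single (Word w) 1))) = 0" by simp
      moreover have "x * y * single (Word w) 1 = (\<Sum>k\<in>support y. x * (single k (lookup y k) * single (Word w) 1))"
        by (subst poly_mapping_eq_sum[of y]) (simp only: sum_distrib_left sum_distrib_right mult.assoc)
      ultimately show ?thesis by (simp only: free_expansion_sum)
    qed
    moreover have "x * y \<in> carrier (free_alg n)" using x y free_alg_closed(2) by (auto simp: K_def)
    ultimately have "x * y \<in> K" by (simp add: K_def)
    then show "x \<otimes>\<^bsub>free_alg n\<^esub> y \<in> K" by (simp add: free_alg_def)
  qed
  moreover have "tl_relators q c n \<subseteq> K"
    using relators_carrier relator_expansion by (auto simp: K_def)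
  ultimately have "tl_ideal q c n \<subseteq> K" unfolding tl_ideal_def by (rule ring.genideal_minimal[OF ring_free_alg])
  then have "free_expansion q c n (x * single (Word []) 1) = 0" using assms by (auto simp: K_def)
  moreover have "single (Word []) (1::'a) = 1" by (simp flip: zero_tl_word_def)
  ultimately show ?thesis by simp
qed

end


section \<open>Projectors as coefficient functions\<close>

context
  fixes q :: "color \<Rightarrow> 'a::comm_ring_1" and c :: color and n :: nat
begin

abbreviation coset where "coset x \<equiv> tl_ideal q c n +>\<^bsub>free_alg n\<^esub> x"

lemma coset_eq: "coset x = {h + x | h. h \<in> tl_ideal q c n}"
  by (auto simp: a_r_coset_def' free_alg_def)

lemma coset_cong:
  assumes "x - y \<in> tl_ideal q c n" shows "coset x = coset y"
proof -
  have "coset x \<subseteq> coset y" if "x - y \<in> tl_ideal q c n" for x y :: "tl_word \<Rightarrow>\<^sub>0 'a"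
  proof
    fix z assume "z \<in> coset x"
    then obtain h where h: "h \<in> tl_ideal q c n" "z = h + x" by (auto simp: coset_eq)
    then have "z = (h + (x - y)) + y" "h + (x - y) \<in> tl_ideal q c n" using that ideal_closed(3) by auto
    then show "z \<in> coset y" unfolding coset_eq by blast
  qed
  from this[of x y] this[of y x] show ?thesis using assms ideal_closed(6)[OF assms] by auto
qed

lemma coset_eq_ideal_iff: "x \<in> carrier (free_alg n) \<Longrightarrow> coset x = tl_ideal q c n \<longleftrightarrow> x \<in> tl_ideal q c n"
  using ideal.rcos_const_imp_mem[OF ideal_tl] ring.a_rcos_zero[OF ring_free_alg ideal_tl] by blast

lemma TL_carrier: "X \<in> carrier (TL q c n) \<longleftrightarrow> (\<exists>x\<in>carrier (free_alg n). X = coset x)"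
  by (auto simp: TL_def FactRing_def A_RCOSETS_def')

lemma TL_zero: "\<zero>\<^bsub>TL q c n\<^esub> = tl_ideal q c n"
  by (simp add: TL_def FactRing_def)

lemma TL_mult: "x \<in> carrier (free_alg n) \<Longrightarrow> y \<in> carrier (free_alg n) \<Longrightarrow> coset x \<otimes>\<^bsub>TL q c n\<^esub> coset y = coset (x * y)"
  using ideal.rcoset_mult_add[OF ideal_tl] by (simp add: TL_def FactRing_def free_alg_def)

lemma expansion_coset: "expansion q c n (coset x) = free_expansion q c n x"
proof -
  have "free_expansion q c n ` coset x = {free_expansion q c n x}"
    using ideal_closed(1) by (auto simp: coset_eq free_expansion_add ideal_expansion intro!: image_eqI[of _ _ x] exI[of _ 0])
  then show ?thesis by (simp add: expansion_def)
qed

lemma support_free_expansion: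
  assumes "x \<in> carrier (free_alg n)"
  shows "support (free_expansion q c n x) \<subseteq> strands n ` {m. nc_matching (2 * n) m}"
proof
  fix d assume "d \<in> support (free_expansion q c n x)"
  then have "lookup (free_expansion q c n x) d \<noteq> 0" by (simp add: in_keys_iff)
  moreover have "free_expansion q c n x = (\<Sum>w\<in>support x. free_expansion q c n (single w (lookup x w)))"
    by (subst poly_mapping_eq_sum[of x]) (rule free_expansion_sum)
  ultimately obtain w where w: "w \<in> support x" "lookup (free_expansion q c n (single w (lookup x w))) d \<noteq> 0"
    by (auto simp: lookup_sum elim: sum.not_neutral_contains_not_neutral)
  have l: "set (letters w) \<subseteq> {1..<n}" using assms w(1) unfolding keys_free_alg by blast
  have "d = strands n (snd (matching_value q c n (letters w)))"
    using w(2) by (simp add: free_expansion_single lookup_single when_def word_value_matching[OF l] split: if_splits)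
  then show "d \<in> strands n ` {m. nc_matching (2 * n) m}" using nc_matching_value[OF l] by blast
qed

lemma sum_strands:
  "(\<Sum>d\<in>strands n ` {m. nc_matching (2 * n) m}. f d) = (\<Sum>m | nc_matching (2 * n) m. f (strands n m))"
  by (rule sum.reindex_cong[OF _ HOL.refl HOL.refl]) (auto intro!: inj_onI strands_inject)

lemma sum_delta_matching:
  "nc_matching N m \<Longrightarrow> (\<Sum>m' | nc_matching N m'. if m' = m then g m' else 0) = g m"
  using sum.delta[OF finite_nc_matching[of N], of m g] by simp

text \<open>The coefficient at \<open>d\<close> is collected from the matchings with closure
  \<open>d\<close>: from the fiber with factor 1, and from \<open>d\<close> itself with the value of
  a disk.\<close>

lemma lookup_stack_lin:
  assumes f: "support f \<subseteq> strands n ` {m. nc_matching (2 * n) m}"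
    and d: "nc_matching (2 * n) d" "d u = Suc u" and u: "Suc u < n"
  shows "lookup (stack_lin q c (Suc u) f) (strands n d)
     = defect (2 * n) (gap q c u) u (Suc u) (\<lambda>m. lookup f (strands n m)) d"
proof -
  define v where "v = (\<lambda>m. lookup f (strands n m))"
  have T: "{Top (Suc u), Top (Suc u + 1)} \<in> strands n m \<longleftrightarrow> m u = Suc u" if "nc_matching (2 * n) m" for m
    using strand_mem_iff[OF that, of u "Suc u"] u by (simp add: point_def)
  have inj: "strands n m = strands n m' \<longleftrightarrow> m = m'" if "nc_matching (2 * n) m" "nc_matching (2 * n) m'" for m m'
    using strands_inject that by blast
  have "lookup (stack_lin q c (Suc u) f) (strands n d) = (\<Sum>m | nc_matching (2 * n) m.
     lookup (if {Top (Suc u), Top (Suc u + 1)} \<in> strands n m then single (strands n m) (- two_at q c (Suc u) * v m)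
        else single (stack_gen (Suc u) (strands n m)) (v m)) (strands n d))"
    unfolding stack_lin_def v_def
    by (subst spread_superset[OF _ _ f]) (simp_all add: finite_nc_matching sum_strands lookup_sum)
  also have "\<dots> = (\<Sum>m | nc_matching (2 * n) m. (if m = d then - gap q c u * v m else 0)
       + (if m \<in> fiber (2 * n) u (Suc u) d then v m else 0))"
  proof (rule sum.cong[OF HOL.refl])
    fix m assume "m \<in> {m. nc_matching (2 * n) m}"
    then have m: "nc_matching (2 * n) m" by simp
    show "lookup (if {Top (Suc u), Top (Suc u + 1)} \<in> strands n m then single (strands n m) (- two_at q c (Suc u) * v m)
        else single (stack_gen (Suc u) (strands n m)) (v m)) (strands n d)
      = (if m = d then - gap q c u * v m else 0) + (if m \<in> fiber (2 * n) u (Suc u) d then v m else 0)"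
    proof (cases "m u = Suc u")
      case True
      then have "m \<notin> fiber (2 * n) u (Suc u) d" using cap_same[OF m True] by (auto simp: fiber_def)
      then show ?thesis using True T[OF m] inj[OF m d(1)] by (simp add: lookup_single when_def)
    next
      case False
      have c: "nc_matching (2 * n) (cap u (Suc u) m)" using u by (intro nc_matching_cap[OF m]) simp
      have "m \<noteq> d" using False d(2) by auto
      then show ?thesis using False T[OF m] inj[OF c d(1)] stack_gen_strands[OF m u False] m
        by (simp add: lookup_single when_def fiber_def)
    qed
  qed
  also have "\<dots> = - gap q c u * v d + (\<Sum>m\<in>fiber (2 * n) u (Suc u) d. v m)"
  proof -
    have "(\<Sum>m | nc_matching (2 * n) m. if m \<in> fiber (2 * n) u (Suc u) d then v m else 0) = (\<Sum>m\<in>fiber (2 * n) u (Suc u) d. v m)"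
      by (rule sum.mono_neutral_cong_right[OF finite_nc_matching]) (auto simp: fiber_def)
    then show ?thesis by (simp add: sum.distrib sum_delta_matching[OF d(1)])
  qed
  finally show ?thesis by (simp add: defect_def v_def)
qed

text \<open>If e_i J = 0 in the quotient, then a representative of e_i J lies in the ideal and has
  expansion 0; the coefficients of this expansion are the defects.\<close>

lemma JW_top_killed:
  assumes J: "is_JW q c n J"
  shows "support (expansion q c n J) \<subseteq> strands n ` {m. nc_matching (2 * n) m}"
    and "top_killed q c n (\<lambda>m. lookup (expansion q c n J) (strands n m))"
    and "lookup (expansion q c n J) (strands n (rainbow n)) = 1"
proof -
  obtain x where x: "x \<in> carrier (free_alg n)" "J = coset x" using J TL_carrier by (auto simp: is_JW_def)
  have e: "expansion q c n J = free_expansion q c n x" by (simp add: x(2) expansion_coset)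
  show s: "support (expansion q c n J) \<subseteq> strands n ` {m. nc_matching (2 * n) m}"
    unfolding e by (rule support_free_expansion[OF x(1)])
  show "lookup (expansion q c n J) (strands n (rainbow n)) = 1" using J by (simp add: is_JW_def strands_rainbow)
  show "top_killed q c n (\<lambda>m. lookup (expansion q c n J) (strands n m))"
    unfolding top_killed_def
  proof (intro allI impI; elim conjE)
    fix u d assume u: "Suc u < n" and d: "nc_matching (2 * n) d" "d u = Suc u"
    have i: "Suc u \<in> {1..<n}" using u by simp
    have g: "(free_gen (Suc u) :: tl_word \<Rightarrow>\<^sub>0 'a) \<in> carrier (free_alg n)" by (rule free_alg_gen[OF i])
    have "tl_gen q c n (Suc u) \<otimes>\<^bsub>TL q c n\<^esub> J = \<zero>\<^bsub>TL q c n\<^esub>" using J i by (auto simp: is_JW_def)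
    then have "coset (free_gen (Suc u) * x) = tl_ideal q c n"
      unfolding tl_gen_def x(2) TL_mult[OF g x(1)] TL_zero .
    then have "free_gen (Suc u) * x \<in> tl_ideal q c n" using coset_eq_ideal_iff free_alg_closed(2)[OF g x(1)] by blast
    then have "stack_lin q c (Suc u) (free_expansion q c n x) = 0" using ideal_expansion free_expansion_gen by metis
    then show "defect (2 * n) (gap q c u) u (Suc u) (\<lambda>m. lookup (expansion q c n J) (strands n m)) d = 0"
      using lookup_stack_lin[OF s d u] unfolding e by simp
  qed
qed

section \<open>From coefficient functions to elements of the algebra\<close>

lemma single_sum: "single k (sum f A) = (\<Sum>x\<in>A. single k (f x :: 'a))"
  by (rule additive_sum) (simp_all add: single_add)

lemma word_eq_ideal: "word_eq n w w' \<Longrightarrow> single (Word w) 1 - single (Word w') (1::'a) \<in> tl_ideal q c n"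
proof (induction rule: word_eq.induct)
  case (comm xs i j ys)
  have r: "free_gen i * free_gen j - free_gen j * free_gen i \<in> tl_ideal q c n"
    by (rule relator_in_ideal) (use comm in \<open>auto simp: tl_relators_def\<close>)
  have "set xs \<subseteq> {1..<n}" "set ys \<subseteq> {1..<n}" using comm by auto
  then have "single (Word xs) 1 * (free_gen i * free_gen j - free_gen j * free_gen i) * single (Word ys) 1 \<in> tl_ideal q c n"
    using r by (intro ideal_closed free_alg_single)
  then show ?case by (simp add: free_gen_def mult_single plus_tl_word_def left_diff_distrib right_diff_distrib)
next
  case (braid xs i j ys)
  have r: "free_gen i * free_gen j * free_gen i - free_gen i \<in> tl_ideal q c n"
    by (rule relator_in_ideal) (use braid in \<open>auto simp: tl_relators_def\<close>)
  have "set xs \<subseteq> {1..<n}" "set ys \<subseteq> {1..<n}" using braid by auto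
  then have "single (Word xs) 1 * (free_gen i * free_gen j * free_gen i - free_gen i) * single (Word ys) 1 \<in> tl_ideal q c n"
    using r by (intro ideal_closed free_alg_single)
  then show ?case by (simp add: free_gen_def mult_single plus_tl_word_def left_diff_distrib right_diff_distrib)
next
  case (refl w) then show ?case by (simp add: ideal_closed)
next
  case (sym w w') then show ?case using ideal_closed(6) by (metis minus_diff_eq)
next
  case (trans w w' w'')
  from ideal_closed(3)[OF trans.IH] show ?case by simp
qed

lemma ideal_scale: "x \<in> tl_ideal q c n \<Longrightarrow> single 0 a * x \<in> tl_ideal q c n"
  by (rule ideal_closed(4)) (simp_all add: zero_tl_word_def free_alg_single)

text \<open>Without a disk this is \<open>normal_word_stack\<close>. If \<open>m\<close> has a cup
  at \<open>u\<close>, its word may be replaced by one that starts with \<open>Suc u\<close>, and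
  the quadratic relation supplies the scalar.\<close>

lemma stack_normal_word:
  assumes m: "nc_matching (2 * n) m" and u: "Suc u < n"
  shows "single (Word (Suc u # normal_word n m)) a
     - single (Word (normal_word n (cap u (Suc u) m))) ((if m u = Suc u then - gap q c u else 1) * a) \<in> tl_ideal q c n"
proof -
  obtain n' where n': "n = Suc n'" using u by (cases n) auto
  have one: "single (Word (Suc u # normal_word n m)) 1
     - single (Word (normal_word n (cap u (Suc u) m))) (if m u = Suc u then - gap q c u else 1) \<in> tl_ideal q c n"
  proof (cases "m u = Suc u")
    case False
    then have "word_eq n (Suc u # normal_word n m) (normal_word n (cap u (Suc u) m))"
      using normal_word_stack[of n' m u] m u unfolding n' by simp
    then show ?thesis using word_eq_ideal False by simp
  next
    case True
    define w where "w = [Suc (Suc u)..<n] @ normal_word n' (rem u m)"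
    have "[Suc u..<n] @ normal_word n' (rem u m) = Suc u # w" using u by (simp add: w_def upt_conv_Cons)
    then have e: "word_eq n (Suc u # w) (normal_word n m)"
      using normal_word_any_cup[of n' m u] m u True unfolding n' by simp
    have i: "Suc u \<in> {1..<n}" using u by simp
    have "nc_matching (2 * n') (rem u m)" using nc_matching_rem[of "2 * n'" m u] m True n' by simp
    then have "set w \<subseteq> {1..<n}" using normal_word_letters[of n' "rem u m"] n' by (auto simp: w_def)
    then have "(free_gen (Suc u) * free_gen (Suc u) + free_scalar (gap q c u) * free_gen (Suc u)) * single (Word w) 1 \<in> tl_ideal q c n"
      by (intro ideal_closed(5) relator_in_ideal free_alg_single) (use i in \<open>auto simp: tl_relators_def\<close>)
    then have 1: "single (Word (Suc u # Suc u # w)) 1 + single (Word (Suc u # w)) (gap q c u) \<in> tl_ideal q c n"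
      by (simp add: distrib_right mult.assoc gen_times_single free_scalar_single)
    have 2: "single (Word (Suc u # normal_word n m)) 1 - single (Word (Suc u # Suc u # w)) (1::'a) \<in> tl_ideal q c n"
      by (rule word_eq_ideal[OF word_eq_Cons[OF word_eq.sym[OF e] i]])
    have "single 0 (gap q c u) * (single (Word (normal_word n m)) 1 - single (Word (Suc u # w)) 1) \<in> tl_ideal q c n"
      by (rule ideal_scale[OF word_eq_ideal[OF word_eq.sym[OF e]]])
    then have 3: "single (Word (normal_word n m)) (gap q c u) - single (Word (Suc u # w)) (gap q c u) \<in> tl_ideal q c n"
      by (simp add: right_diff_distrib mult_single)
    have "single (Word (Suc u # normal_word n m)) 1 + single (Word (normal_word n m)) (gap q c u) \<in> tl_ideal q c n"
      using ideal_closed(3)[OF ideal_closed(3)[OF 1 2] 3] by (simp add: algebra_simps)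
    then show ?thesis using True cap_same[OF m True] by (simp add: single_uminus)
  qed
  from ideal_scale[OF one, of a] show ?thesis by (simp add: right_diff_distrib mult_single mult.commute)
qed

definition of_matchings :: "((nat \<Rightarrow> nat) \<Rightarrow> 'a) \<Rightarrow> (tl_word \<Rightarrow>\<^sub>0 'a)" where
  "of_matchings v = (\<Sum>m | nc_matching (2 * n) m. single (Word (normal_word n m)) (v m))"

lemma of_matchings_carrier: "of_matchings v \<in> carrier (free_alg n)"
  unfolding of_matchings_def by (rule free_alg_sum, rule free_alg_single, rule normal_word_letters) simp

lemma free_expansion_of_matchings: "free_expansion q c n (of_matchings v) = (\<Sum>m | nc_matching (2 * n) m. single (strands n m) (v m))"
  unfolding of_matchings_def free_expansion_sum
  by (rule sum.cong[OF HOL.refl])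
    (simp add: free_expansion_single word_value_matching[OF normal_word_letters] matching_value_normal_word)

lemma lookup_sum_strands:
  assumes "nc_matching (2 * n) m"
  shows "lookup (\<Sum>m | nc_matching (2 * n) m. single (strands n m) (v m :: 'a)) (strands n m) = v m"
proof -
  have "lookup (\<Sum>m | nc_matching (2 * n) m. single (strands n m) (v m)) (strands n m)
      = (\<Sum>m' | nc_matching (2 * n) m'. if m' = m then v m' else 0)"
    unfolding lookup_sum
    by (rule sum.cong[OF HOL.refl]) (use strands_inject[OF _ assms] in \<open>auto simp: lookup_single when_def\<close>)
  then show ?thesis by (simp only: sum_delta_matching[OF assms])
qed

text \<open>Modulo the ideal, every term becomes a multiple of the word of its closure. Grouped by
  closures, the coefficients are the defects, which vanish.\<close>

lemma gen_of_matchings: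
  assumes v: "top_killed q c n v" and u: "Suc u < n"
  shows "free_gen (Suc u) * of_matchings v \<in> tl_ideal q c n"
proof -
  let ?S = "{m. nc_matching (2 * n) m}" and ?cap = "cap u (Suc u)"
  let ?s = "\<lambda>m. (if m u = Suc u then - gap q c u else 1) * v m"
  have uN: "Suc u < 2 * n" using u by simp
  have "(\<Sum>m\<in>?S. single (Word (Suc u # normal_word n m)) (v m) - single (Word (normal_word n (?cap m))) (?s m)) \<in> tl_ideal q c n"
    by (rule ideal_sum) (use stack_normal_word[OF _ u] in auto)
  moreover have "(\<Sum>m\<in>?S. single (Word (normal_word n (?cap m))) (?s m)) = 0"
  proof -
    have "(\<Sum>m\<in>?S. single (Word (normal_word n (?cap m))) (?s m))
       = (\<Sum>d\<in>?cap ` ?S. \<Sum>m\<in>{m \<in> ?S. ?cap m = d}. single (Word (normal_word n (?cap m))) (?s m))"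
      by (rule sum.image_gen[OF finite_nc_matching])
    also have "\<dots> = (\<Sum>d\<in>?cap ` ?S. single (Word (normal_word n d)) (\<Sum>m\<in>{m \<in> ?S. ?cap m = d}. ?s m))"
      by (rule sum.cong[OF HOL.refl]) (simp add: single_sum)
    also have "\<dots> = 0"
    proof (rule sum.neutral, rule ballI)
      fix d assume "d \<in> ?cap ` ?S"
      then obtain m where m: "nc_matching (2 * n) m" "d = ?cap m" by auto
      have d: "nc_matching (2 * n) d" "d u = Suc u" using nc_matching_cap[OF m(1) uN] m(2) by (auto simp: cap_def)
      have "{m \<in> ?S. ?cap m = d} = insert d (fiber (2 * n) u (Suc u) d)"
        using cap_same[OF d] d(1) by (auto simp: fiber_def)
      moreover have "d \<notin> fiber (2 * n) u (Suc u) d" by (simp add: fiber_def)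
      moreover have "(\<Sum>m\<in>fiber (2 * n) u (Suc u) d. ?s m) = (\<Sum>m\<in>fiber (2 * n) u (Suc u) d. v m)"
        by (rule sum.cong[OF HOL.refl]) (auto simp: fiber_def cap_same)
      ultimately have "(\<Sum>m\<in>{m \<in> ?S. ?cap m = d}. ?s m) = defect (2 * n) (gap q c u) u (Suc u) v d"
        using d(2) by (simp add: finite_fiber defect_def)
      also have "\<dots> = 0" using v d u by (simp add: top_killed_def)
      finally show "single (Word (normal_word n d)) (\<Sum>m\<in>{m \<in> ?S. ?cap m = d}. ?s m) = 0" by simp
    qed
    finally show ?thesis .
  qed
  ultimately show ?thesis
    by (simp add: of_matchings_def sum_distrib_left gen_times_single sum_subtractf)
qed

lemma is_JW_of_matchings:
  assumes v: "top_killed q c n v" and one: "v (rainbow n) = 1"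
  shows "is_JW q c n (coset (of_matchings v))"
proof -
  define x where "x = of_matchings v"
  have x: "x \<in> carrier (free_alg n)" unfolding x_def by (rule of_matchings_carrier)
  have lk: "lookup (free_expansion q c n x) (id_diagram n) = 1"
    unfolding x_def free_expansion_of_matchings strands_rainbow[symmetric] lookup_sum_strands[OF nc_matching_rainbow] by (rule one)
  have gen: "free_gen i * x \<in> tl_ideal q c n" if i: "i \<in> {1..<n}" for i
    using gen_of_matchings[OF v, of "i - 1"] i by (simp add: x_def)
  have word: "single (Word w) a * x \<in> tl_ideal q c n" if w: "set w \<subseteq> {1..<n}" "w \<noteq> []" for w a
  proof -
    obtain w' i where wi: "w = w' @ [i]" using w(2) by (cases w rule: rev_cases) auto
    have "single (Word w) a * x = single (Word w') a * (free_gen i * x)"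
      by (simp add: wi free_gen_def mult.assoc[symmetric] mult_single plus_tl_word_def)
    then show ?thesis using w wi gen[of i] ideal_closed(4)[OF gen[of i] free_alg_single[of w' n a]] by auto
  qed
  \<comment> \<open>Only the identity has the empty normal word, and its coefficient is 1. Every
    other term ends in a generator that kills \<open>x\<close>, so multiplying \<open>x\<close> by
    itself changes nothing modulo the ideal.\<close>
  have "x * x - x \<in> tl_ideal q c n"
  proof -
    let ?S = "{m. nc_matching (2 * n) m}"
    have r: "rainbow n \<in> ?S" by (simp add: nc_matching_rainbow)
    have "x = single (Word (normal_word n (rainbow n))) (v (rainbow n)) + (\<Sum>m\<in>?S - {rainbow n}. single (Word (normal_word n m)) (v m))"
      unfolding x_def of_matchings_def by (rule sum.remove[OF finite_nc_matching r])
    also have "single (Word (normal_word n (rainbow n))) (v (rainbow n)) = 1"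
      by (simp add: normal_word_rainbow one flip: zero_tl_word_def)
    finally have "x * x = (1 + (\<Sum>m\<in>?S - {rainbow n}. single (Word (normal_word n m)) (v m))) * x" by simp
    then have "x * x - x = (\<Sum>m\<in>?S - {rainbow n}. single (Word (normal_word n m)) (v m) * x)"
      by (simp add: distrib_right sum_distrib_right)
    also have "\<dots> \<in> tl_ideal q c n"
    proof (rule ideal_sum)
      fix m assume m: "m \<in> ?S - {rainbow n}"
      then have "nc_matching (2 * n) m" by simp
      then have "normal_word n m \<noteq> []" using matching_value_normal_word[of n m q c] m by auto
      then show "single (Word (normal_word n m)) (v m) * x \<in> tl_ideal q c n"
        using word[OF normal_word_letters] m by simp
    qed
    finally show ?thesis .
  qed
  then have idem: "coset x \<otimes>\<^bsub>TL q c n\<^esub> coset x = coset x" unfolding TL_mult[OF x x] by (rule coset_cong)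
  have "x \<notin> tl_ideal q c n" using ideal_expansion[of x q c n] lk by auto
  then have "coset x \<noteq> tl_ideal q c n" using coset_eq_ideal_iff[OF x] by blast
  moreover have "tl_gen q c n i \<otimes>\<^bsub>TL q c n\<^esub> coset x = tl_ideal q c n" if i: "i \<in> {1..<n}" for i
  proof -
    have g: "(free_gen i :: tl_word \<Rightarrow>\<^sub>0 'a) \<in> carrier (free_alg n)" by (rule free_alg_gen[OF i])
    show ?thesis unfolding tl_gen_def TL_mult[OF g x]
      using coset_eq_ideal_iff[OF free_alg_closed(2)[OF g x]] gen[OF i] by blast
  qed
  ultimately show ?thesis
    using x idem lk unfolding is_JW_def TL_carrier TL_zero x_def[symmetric] expansion_coset by blast
qed

end

lemma rotate_diagrams_spread: "rotate_diagrams r = spread (\<lambda>d a. single ((`) r ` d) a)"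
  by (rule ext) (simp add: rotate_diagrams_def spread_def)

lemma lookup_map_times: "lookup (Poly_Mapping.map ((*) a) f) d = a * lookup f (d :: 'b)" for a :: "'a::comm_ring_1"
  by (simp add: Poly_Mapping.map.rep_eq when_def)

lemma bij_rot: "bij_betw (rot N) {m. nc_matching N m} {m. nc_matching N m}"
  unfolding bij_betw_def
proof
  show "inj_on (rot N) {m. nc_matching N m}" by (rule inj_onI) (auto intro: rot_inj)
  show "rot N ` {m. nc_matching N m} = {m. nc_matching N m}"
  proof (intro equalityI subsetI)
    fix m assume "m \<in> {m. nc_matching N m}"
    then obtain m' where "nc_matching N m'" "rot N m' = m" using rot_surj by blast
    then show "m \<in> rot N ` {m. nc_matching N m}" by blast
  qed (auto intro: nc_matching_rot)
qed

lemma rotate_sum_strands: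
  fixes v w :: "(nat \<Rightarrow> nat) \<Rightarrow> 'a::comm_ring_1"
  shows
  "rotate_diagrams (rot1 n) (\<Sum>m | nc_matching (2 * n) m. single (strands n m) (v m))
     = (\<Sum>m | nc_matching (2 * n) m. single (strands n m) (v (rot (2 * n) m)))"
  "rotate_diagrams (rot2 n) (\<Sum>m | nc_matching (2 * n) m. single (strands n m) (w (rot (2 * n) m)))
     = (\<Sum>m | nc_matching (2 * n) m. single (strands n m) (w m))"
proof -
  have R: "rotate_diagrams r (\<Sum>m | nc_matching (2 * n) m. single (strands n m) (f m))
     = (\<Sum>m | nc_matching (2 * n) m. single ((`) r ` strands n m) (f m))" for r and f :: "_ \<Rightarrow> 'a"
  proof -
    have "rotate_diagrams r (0 :: diagram \<Rightarrow>\<^sub>0 'a) = 0" by (simp add: rotate_diagrams_def)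
    moreover have "rotate_diagrams r (f + g) = rotate_diagrams r f + rotate_diagrams r g" for f g :: "diagram \<Rightarrow>\<^sub>0 'a"
      unfolding rotate_diagrams_spread by (rule spread_add) (simp_all add: single_add)
    ultimately have "rotate_diagrams r (\<Sum>m | nc_matching (2 * n) m. single (strands n m) (f m))
      = (\<Sum>m | nc_matching (2 * n) m. rotate_diagrams r (single (strands n m) (f m)))" by (rule additive_sum)
    then show ?thesis unfolding rotate_diagrams_spread by (simp add: spread_single)
  qed
  note re = sum.reindex_bij_betw[OF bij_rot[of "2 * n"], symmetric]
  show "rotate_diagrams (rot1 n) (\<Sum>m | nc_matching (2 * n) m. single (strands n m) (v m))
     = (\<Sum>m | nc_matching (2 * n) m. single (strands n m) (v (rot (2 * n) m)))"
    unfolding R by (subst re, rule sum.cong[OF HOL.refl]) (simp add: rot1_strands)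
  show "rotate_diagrams (rot2 n) (\<Sum>m | nc_matching (2 * n) m. single (strands n m) (w (rot (2 * n) m)))
     = (\<Sum>m | nc_matching (2 * n) m. single (strands n m) (w m))"
    unfolding R by (subst (2) re, rule sum.cong[OF HOL.refl]) (simp add: rot2_strands)
qed

lemma eq_sum_strands:
  fixes f :: "diagram \<Rightarrow>\<^sub>0 'a::comm_ring_1"
  assumes "support f \<subseteq> strands n ` {m. nc_matching (2 * n) m}"
  shows "f = (\<Sum>m | nc_matching (2 * n) m. single (strands n m) (lookup f (strands n m)))"
proof -
  have "f = (\<Sum>d\<in>strands n ` {m. nc_matching (2 * n) m}. single d (lookup f d))"
    by (subst poly_mapping_eq_sum, rule sum.mono_neutral_left)
      (use assms in \<open>auto simp: finite_nc_matching in_keys_iff\<close>)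
  then show ?thesis unfolding sum_strands .
qed

text \<open>The bound on n excludes the single strand: it is a projector that rotates to itself for
  all values of the scalars, whereas the condition for n = 1 would be [2]_s = [2]_t = 0.\<close>

theorem theorem1p2:
  fixes q :: "color \<Rightarrow> 'a::comm_ring_1" and n :: nat
  assumes "n \<ge> 2"
  shows "(\<exists>Js Jt. is_JW q ColS n Js \<and> is_JW q ColT n Jt \<and>
            rotatable q ColS n Js Jt \<and> rotatable q ColT n Jt Js) \<longleftrightarrow>
         (\<forall>k \<in> {1..n}. specialize q (qbinom ColS (n + 1) k) = 0 \<and>
                       specialize q (qbinom ColT (n + 1) k) = 0)"
    (is "?L \<longleftrightarrow> ?R")
proof
  assume ?L
  then obtain J where J: "\<And>c. is_JW q c n (J c)" "\<And>c. rotatable q c n (J c) (J (other c))"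
  proof (elim exE conjE)
    fix Js Jt assume a: "is_JW q ColS n Js" "is_JW q ColT n Jt" "rotatable q ColS n Js Jt" "rotatable q ColT n Jt Js"
    show thesis
    proof (rule that[of "case_color Js Jt"])
      fix c show "is_JW q c n (case_color Js Jt c)" "rotatable q c n (case_color Js Jt c) (case_color Js Jt (other c))"
        using a by (cases c; simp)+
    qed
  qed
  define v where "v = (\<lambda>c m. lookup (expansion q c n (J c)) (strands n m))"
  note K = JW_top_killed[OF J(1)]
  have "\<exists>a. \<forall>m. nc_matching (2 * n) m \<longrightarrow> v c (rot (2 * n) m) = a * v (other c) m" for c
  proof -
    obtain a where a: "rotate_diagrams (rot1 n) (expansion q c n (J c)) = Poly_Mapping.map ((*) a) (expansion q (other c) n (J (other c)))"
      using J(2)[of c] by (auto simp: rotatable_def)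
    \<comment> \<open>Since \<open>rot1\<close> undoes \<open>rot\<close>, the rotated vector has at
      \<open>m\<close> the coefficient of \<open>rot (2 * n) m\<close>.\<close>
    have "rotate_diagrams (rot1 n) (expansion q c n (J c)) = (\<Sum>m | nc_matching (2 * n) m. single (strands n m) (v c (rot (2 * n) m)))"
      by (subst eq_sum_strands[OF K(1)]) (simp add: rotate_sum_strands v_def)
    then have "v c (rot (2 * n) m) = a * v (other c) m" if "nc_matching (2 * n) m" for m
      using lookup_sum_strands[OF that, of "\<lambda>m. v c (rot (2 * n) m)"] unfolding a[symmetric] v_def
      by (metis a lookup_map_times)
    then show ?thesis by blast
  qed
  then obtain lam where lam: "\<And>c m. nc_matching (2 * n) m \<Longrightarrow> v c (rot (2 * n) m) = lam c * v (other c) m" by metis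
  have "specialize q (qbinom c (n + 1) k) = 0" if "k \<in> {1..n}" for c k
    by (rule qbinom_zero_of_rotatable[where v = v and lam = lam, OF assms])
      (use K lam that in \<open>simp_all add: v_def\<close>)
  then show ?R by blast
next
  assume R: ?R
  have z: "specialize q (qbinom c (n + 1) k) = 0" if "1 \<le> k" "k \<le> n" for c k
    using R that by (cases c) auto
  obtain v :: "color \<Rightarrow> (nat \<Rightarrow> nat) \<Rightarrow> 'a" and lam where v: "\<And>c. top_killed q c n (v c)" "\<And>c. v c (rainbow n) = 1"
    "\<And>c m. nc_matching (2 * n) m \<Longrightarrow> v c (rot (2 * n) m) = lam c * v (other c) m"
    "\<And>c m. nc_matching (2 * n) m \<Longrightarrow> v c m = lam c * v (other c) (rot (2 * n) m)"
    using rotatable_of_qbinom_zero[OF _ z] assms by (metis One_nat_def Suc_1 Suc_leD)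
  define J where "J c = tl_ideal q c n +>\<^bsub>free_alg n\<^esub> of_matchings n (v c)" for c
  have JW: "is_JW q c n (J c)" for c unfolding J_def by (rule is_JW_of_matchings[OF v(1,2)])
  have e: "expansion q c n (J c) = (\<Sum>m | nc_matching (2 * n) m. single (strands n m) (v c m))" for c
    unfolding J_def expansion_coset free_expansion_of_matchings ..
  have map: "Poly_Mapping.map ((*) a) (\<Sum>m | nc_matching (2 * n) m. single (strands n m) (f m))
     = (\<Sum>m | nc_matching (2 * n) m. single (strands n m) (a * f m))" for a and f :: "_ \<Rightarrow> 'a"
    by (rule poly_mapping_eqI)
      (simp add: lookup_map_times lookup_sum lookup_single sum_distrib_left when_def if_distrib cong: if_cong)
  have "rotatable q c n (J c) (J (other c))" for c
    unfolding rotatable_def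
  proof (intro exI[of _ "lam c"] conjI)
    show "rotate_diagrams (rot1 n) (expansion q c n (J c)) = Poly_Mapping.map ((*) (lam c)) (expansion q (other c) n (J (other c)))"
      unfolding e map rotate_sum_strands by (rule sum.cong[OF HOL.refl]) (simp add: v(3))
    have "expansion q c n (J c) = (\<Sum>m | nc_matching (2 * n) m. single (strands n m) (lam c * v (other c) (rot (2 * n) m)))"
      unfolding e by (rule sum.cong[OF HOL.refl]) (subst v(4)[where c = c], simp_all)
    then show "rotate_diagrams (rot2 n) (expansion q c n (J c)) = Poly_Mapping.map ((*) (lam c)) (expansion q (other c) n (J (other c)))"
      using rotate_sum_strands(2)[of n "\<lambda>m. lam c * v (other c) m"] unfolding e map by simp
  qed
  then show ?L using JW by (metis other.simps)
qed

end
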